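(* Let $\beta\in(0,1)$, let $N_A,N_B\in\mathbb{N}$, and let $(A,B)$ solve the lattice double-bubble problem $$\min\{P(A,B)\colon A,B\subset\mathbb{Z}^2,\ A\cap B=\emptyset,\ \#A=N_A,\ \#B=N_B\}.$$ Then: (i) (Connectedness) The sets $A$, $B$ and $A\cup B$ are connected. Moreover, the sets $A\cap R_z$, $B\cap R_z$, $(A\cup B)\cap R_z$, $A\cap C_z$, $B\cap C_z$ and $(A\cup B)\cap C_z$ are connected (possibly being empty) for all $z\in\mathbb{Z}$. (ii) (Separation) If $\max\{x\colon (x,z)\in A\}\le\min\{x\colon (x,z)\in B\}-1$ for some $z\in\mathbb{Z}$, then the same holds with equality for all $z\in\mathbb{Z}$ (whenever the sets involved are not empty). An analogous statement is valid for columns, possibly after exchanging the roles of $A$ and $B$. (iii) (Interface) Let $I\subset\mathbb{R}^2$ be the set of midpoints of segments connecting points in $A$ with points in $B$ at distance $1$. Then, for all $x\in I$ there exists $y\in I\setminus\{x\}$ with $|x-y|\in\{1/\sqrt2,1\}$, and $I$ can be included in the image of a piecewise-affine curve $\iota\colon[0,1]\to\mathbb{R}^2$ with monotone components. If $N_A=N_B=N$ and $\beta\le 1/2$, we additionally have that: (iv) (Minimal perimeter) $$P(A,B)=\min_{h\in\mathbb{N}}\big(4\lceil N/h\rceil+2h(2-\beta)\big),$$ where all minimisers $h$ satisfy $|h-\sqrt{2N/(2-\beta)}|\le C_\beta N^{1/4}$ for some constant $C_\beta$ only depending on $\beta$. For $\beta\in\mathbb{R}\setminus\mathbb{Q}$,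 there exists a unique minimiser $h$. (v) (Explicit solution) Let $h$ minimise $4\lceil N/h\rceil+2h(2-\beta)$ over $\mathbb{N}$, and let $\ell\in\mathbb{N}$ and $0\le r<h$ be given with $N=h\ell+r$. Then, letting $$A':=\{(x,y)\in\mathbb{Z}^2\colon x\in[-\ell+1,0],\ y\in[1,h]\ \text{ or }\ x=-\ell,\ y\in[1,r]\},$$ $$B':=\{(x,y)\in\mathbb{Z}^2\colon x\in[1,\ell],\ y\in[1,h]\ \text{ or }\ x=\ell+1,\ y\in[1,r]\},$$ the pair $(A',B')$ solves the double-bubble problem. (vi) (Fluctuations) There exist a constant $C_\beta$ only depending on $\beta$ and an isometry $T$ of $\mathbb{Z}^2$ such that $$\#(A\triangle T(A'))+\#(B\triangle T(B'))\le C_\beta N^{1/2}\quad\text{if }\beta\in\mathbb{R}\setminus\mathbb{Q},$$ $$\#(A\triangle T(A'))+\#(B\triangle T(B'))\le C_\beta N^{3/4}\quad\text{if }\beta\in\mathbb{Q},$$ where the pair $(A',B')$ is the one defined in (v).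
   Context: $|\cdot|$ is the Euclidean norm. For disjoint sets $C,D\subset\mathbb{Z}^2$, $Q(C,D)=\#\{(c,d)\in C\times D\colon |c-d|=1\}$; complements are taken in $\mathbb{Z}^2$. For disjoint finite $A,B\subset\mathbb{Z}^2$ the lattice perimeter is $$P(A,B)=Q(A,A^c)+Q(B,B^c)-2\beta Q(A,B)=Q(A,A^c\setminus B)+Q(B,B^c\setminus A)+(2-2\beta)Q(A,B).$$ A set $V\subset\mathbb{Z}^2$ is connected if its unit-disk graph (vertex set $V$, an edge between two points exactly when they are at distance $1$) is connected. $R_z=\mathbb{Z}\times\{z\}$ and $C_z=\{z\}\times\mathbb{Z}$ denote the rows and columns of $\mathbb{Z}^2$, $z\in\mathbb{Z}$. An isometry $T$ of $\mathbb{Z}^2$ is a composition of translations $x\mapsto x+\tau$ ($\tau\in\mathbb{Z}^2$), the rotation $(x_1,x_2)\mapsto(-x_2,x_1)$, and the reflections $(x_1,x_2)\mapsto(x_1,-x_2)$, $(x_1,x_2)\mapsto(-x_1,x_2)$. $\triangle$ is the symmetric difference.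
   Formalization: In (iii), the claim that each x in I has some y in I∖{x} with |x−y| in {1/√2, 1} is stated only when I is not the single point {x}; it fails for a one-point interface, e.g. N_A = N_B = 1. *)

theory Defs
  imports "HOL-Analysis.Analysis"
begin

type_synonym site = "int \<times> int"

definition to_plane :: "site \<Rightarrow> real \<times> real" where
  "to_plane = map_prod real_of_int real_of_int"

text \<open>The norm on \<^typ>\<open>real \<times> real\<close> is the Euclidean one.\<close>

definition unit_dist :: "site \<Rightarrow> site \<Rightarrow> bool" where
  "unit_dist c d \<longleftrightarrow> norm (to_plane c - to_plane d) = 1"

definition Q :: "site set \<Rightarrow> site set \<Rightarrow> nat" where
  "Q C D = card {(c, d). c \<in> C \<and> d \<in> D \<and> unit_dist c d}"

definition perimeter :: "real \<Rightarrow> site set \<Rightarrow> site set \<Rightarrow> real" where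
  "perimeter \<beta> A B = real (Q A (- A)) + real (Q B (- B)) - 2 * \<beta> * real (Q A B)"

definition admissible :: "nat \<Rightarrow> nat \<Rightarrow> site set \<Rightarrow> site set \<Rightarrow> bool" where
  "admissible N\<^sub>A N\<^sub>B A B \<longleftrightarrow>
     finite A \<and> finite B \<and> A \<inter> B = {} \<and> card A = N\<^sub>A \<and> card B = N\<^sub>B"

definition solves_double_bubble :: "real \<Rightarrow> nat \<Rightarrow> nat \<Rightarrow> site set \<Rightarrow> site set \<Rightarrow> bool" where
  "solves_double_bubble \<beta> N\<^sub>A N\<^sub>B A B \<longleftrightarrow>
     is_arg_min (\<lambda>(A, B). perimeter \<beta> A B) (\<lambda>(A, B). admissible N\<^sub>A N\<^sub>B A B) (A, B)"

definition lattice_connected :: "site set \<Rightarrow> bool" where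
  "lattice_connected V \<longleftrightarrow>
     (\<forall>u\<in>V. \<forall>v\<in>V. (u, v) \<in> {(x, y). x \<in> V \<and> y \<in> V \<and> unit_dist x y}\<^sup>*)"

definition Row :: "int \<Rightarrow> site set" where
  "Row z = UNIV \<times> {z}"

definition Col :: "int \<Rightarrow> site set" where
  "Col z = {z} \<times> UNIV"

definition row_slice :: "site set \<Rightarrow> int \<Rightarrow> int set" where
  "row_slice S z = {x. (x, z) \<in> S}"

definition col_slice :: "site set \<Rightarrow> int \<Rightarrow> int set" where
  "col_slice S z = {y. (z, y) \<in> S}"

text \<open>Slices that are empty impose no condition: the guards below also keep \<^const>\<open>Max\<close>
  and \<^const>\<open>Min\<close> away from the empty set.\<close>

definition separation :: "(int \<Rightarrow> int set) \<Rightarrow> (int \<Rightarrow> int set) \<Rightarrow> bool" where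
  "separation a b \<longleftrightarrow>
     ((\<exists>z. a z \<noteq> {} \<and> b z \<noteq> {} \<and> Max (a z) \<le> Min (b z) - 1) \<longrightarrow>
      (\<forall>z. a z \<noteq> {} \<and> b z \<noteq> {} \<longrightarrow> Max (a z) = Min (b z) - 1))"

definition interface :: "site set \<Rightarrow> site set \<Rightarrow> (real \<times> real) set" where
  "interface A B =
     {midpoint (to_plane a) (to_plane b) | a b. a \<in> A \<and> b \<in> B \<and> unit_dist a b}"

definition piecewise_affine_path :: "(real \<Rightarrow> real \<times> real) \<Rightarrow> bool" where
  "piecewise_affine_path \<gamma> \<longleftrightarrow> path \<gamma> \<and>
     (\<exists>(n::nat) t. t 0 = 0 \<and> t n = 1 \<and> (\<forall>i<n. t i < t (Suc i)) \<and>
        (\<forall>i<n. \<exists>p v. \<forall>s\<in>{t i..t (Suc i)}. \<gamma> s = p + s *\<^sub>R v))"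

definition monotone_on_unit :: "(real \<Rightarrow> real) \<Rightarrow> bool" where
  "monotone_on_unit f \<longleftrightarrow> mono_on {0..1} f \<or> antimono_on {0..1} f"

text \<open>The perimeter of a pair of rectangle-like sets of height \<open>h\<close> sharing a vertical
  interface of length \<open>h\<close>: each set contributes \<open>2 * \<lceil>N / h\<rceil> + 2 * h\<close>, and the interface
  \<open>- 2 * \<beta> * h\<close>. Only positive heights are admitted as competitors.\<close>

definition height_energy :: "real \<Rightarrow> nat \<Rightarrow> nat \<Rightarrow> real" where
  "height_energy \<beta> N h = 4 * real_of_int \<lceil>real N / real h\<rceil> + 2 * real h * (2 - \<beta>)"

definition optimal_height :: "real \<Rightarrow> nat \<Rightarrow> nat \<Rightarrow> bool" where
  "optimal_height \<beta> N h \<longleftrightarrow> is_arg_min (height_energy \<beta> N) (\<lambda>h. 1 \<le> h) h"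

definition model_A :: "nat \<Rightarrow> nat \<Rightarrow> nat \<Rightarrow> site set" where
  "model_A h l r =
     {(x, y). (x \<in> {- int l + 1..0} \<and> y \<in> {1..int h}) \<or> (x = - int l \<and> y \<in> {1..int r})}"

definition model_B :: "nat \<Rightarrow> nat \<Rightarrow> nat \<Rightarrow> site set" where
  "model_B h l r =
     {(x, y). (x \<in> {1..int l} \<and> y \<in> {1..int h}) \<or> (x = int l + 1 \<and> y \<in> {1..int r})}"

inductive lattice_isometry :: "(site \<Rightarrow> site) \<Rightarrow> bool" where
  translation: "lattice_isometry (\<lambda>x. x + \<tau>)"
| rotation: "lattice_isometry (\<lambda>(x\<^sub>1, x\<^sub>2). (- x\<^sub>2, x\<^sub>1))"
| reflection1: "lattice_isometry (\<lambda>(x\<^sub>1, x\<^sub>2). (x\<^sub>1, - x\<^sub>2))"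
| reflection2: "lattice_isometry (\<lambda>(x\<^sub>1, x\<^sub>2). (- x\<^sub>1, x\<^sub>2))"
| composition: "lattice_isometry S \<Longrightarrow> lattice_isometry T \<Longrightarrow> lattice_isometry (S \<circ> T)"

end

theory Submission
  imports Defs
begin

text \<open>The perimeter of a pair is the convex combination with weights \<open>1 - \<beta>\<close> and \<open>\<beta>\<close> of the boundaries
  of \<open>A\<close> and \<open>B\<close> and of the boundary of \<open>A \<union> B\<close>. A finite set has boundary at least twice the number of
  rows and columns that it meets, with equality iff all its slices are intervals. Hence the perimeter is
  bounded below by a cost that depends only on how many rows and columns \<open>A\<close> and \<open>B\<close> meet (\<open>ra\<close>, \<open>ca\<close>,
  \<open>rb\<close>, \<open>cb\<close>) and share (\<open>p\<close>, \<open>q\<close>). Conversely, every choice of these six numbers that leaves enough room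
  in the two bounding boxes is attained by two overlapping rectangles cut suitably. So a minimizer solves
  a minimization problem in six integers, and all its slices, also those of the union, are intervals;
  disconnected sets would waste room in the boxes. Separation and the shape of the interface are
  consequences of convexity along lines and connectedness.

  For equal cardinalities and \<open>\<beta> \<le> 1 / 2\<close> the integer problem is solved by cost-neutral or cost-decreasing
  moves that end with \<open>q = 0\<close> (or \<open>p = 0\<close>), where averaging the two sets gives the bound by the height
  energy. Quantitative stability of its continuous relaxation bounds \<open>q\<close> and \<open>ra - p\<close>, \<open>rb - p\<close> by constants
  and puts \<open>ra\<close>, \<open>rb\<close> within \<open>O(N powr (1 / 4))\<close> of the ideal height; for irrational \<open>\<beta>\<close> the value of the
  cost determines \<open>p + q = h\<close>, so that they are even within a constant of \<open>h\<close>.\<close>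

section \<open>Perimeters of finite sets\<close>

text \<open>An edge between \<open>A\<close> and \<open>B\<close> is a boundary edge of each set but
  not of the union; this gives the convex combination. Its weights are strictly positive, so
  equality makes three separate defects vanish at once, and the union enters only through its
  \<open>ra + rb - p\<close> rows and \<open>ca + cb - q\<close> columns. Six numbers suffice
  because the overlap of the two boxes is itself a product of \<open>p\<close> rows and
  \<open>q\<close> columns. The difficulty for equal cardinalities is the trade-off in sharing both
  rows and columns: each shared line earns \<open>2 * \<beta>\<close>, but the overlap wastes area
  \<open>p * q\<close>, which has to be paid for with wider boxes. The exponents in the fluctuation
  bound arise as follows. The continuous energy has curvature of order N^(-1/2) at the ideal height,
  while rounding costs O(1), so heights are only determined up to N^(1/4); multiplied by a width of
  order N^(1/2) this is N^(3/4). If heights are known up to a constant, only strips of bounded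
  thickness are misplaced, which is N^(1/2).\<close>

lemma unit_dist_iff:
  "unit_dist c d \<longleftrightarrow> d - c \<in> {(1, 0), (- 1, 0), (0, 1), (0, - 1)}"
proof -
  obtain a b where c: "c = (a, b)" by fastforce
  obtain x y where d: "d = (x, y)" by fastforce
  have "unit_dist c d \<longleftrightarrow> sqrt (of_int ((a - x)\<^sup>2 + (b - y)\<^sup>2)) = 1"
    by (simp add: unit_dist_def c d to_plane_def norm_Pair)
  also have "\<dots> \<longleftrightarrow> (a - x)\<^sup>2 + (b - y)\<^sup>2 = 1"
    using of_int_eq_iff[where 'a = real, of "(a - x)\<^sup>2 + (b - y)\<^sup>2" 1]
    by (simp only: real_sqrt_eq_1_iff of_int_1)
  also have "\<dots> \<longleftrightarrow> (\<bar>a - x\<bar> = 1 \<and> b - y = 0 \<or> a - x = 0 \<and> \<bar>b - y\<bar> = 1)"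
    (is "_ \<longleftrightarrow> ?rhs")
  proof
    assume *: "(a - x)\<^sup>2 + (b - y)\<^sup>2 = 1"
    \<comment> \<open>Integer squares are 0, 1 or at least 4, which leaves a linear problem.\<close>
    have large: "u\<^sup>2 \<ge> 4" if "\<bar>u\<bar> \<ge> 2" for u :: int
      using power_mono[OF that, of 2] by simp
    have "u = 0 \<and> u\<^sup>2 = 0 \<or> \<bar>u\<bar> = 1 \<and> u\<^sup>2 = 1 \<or> u\<^sup>2 \<ge> 4" for u :: int
    proof -
      have "u = 0 \<or> u = 1 \<or> u = - 1 \<or> \<bar>u\<bar> \<ge> 2" by linarith
      then show ?thesis using large[of u] by auto
    qed
    from this[of "a - x"] this[of "b - y"] * show ?rhs
      using zero_le_power2[of "a - x"] zero_le_power2[of "b - y"] by linarith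
  next
    assume ?rhs
    then have "\<bar>a - x\<bar>\<^sup>2 + \<bar>b - y\<bar>\<^sup>2 = 1" by (elim disjE conjE) (simp_all only: abs_0 power2_eq_square)
    then show "(a - x)\<^sup>2 + (b - y)\<^sup>2 = 1" by simp
  qed
  also have "\<dots> \<longleftrightarrow> (x - a, y - b) \<in> {(1, 0), (- 1, 0), (0, 1), (0, - 1)}"
    by auto
  finally show ?thesis by (simp add: c d)
qed

lemma unit_dist_cases:
  "unit_dist (a, b) (x, y) \<longleftrightarrow> \<bar>x - a\<bar> = 1 \<and> y = b \<or> x = a \<and> \<bar>y - b\<bar> = 1"
  unfolding unit_dist_iff by (auto simp: abs_if)

lemma unit_dist_commute: "unit_dist c d \<longleftrightarrow> unit_dist d c"
  by (simp add: unit_dist_def norm_minus_commute)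

text \<open>\<open>D\<close> is usually a complement and hence infinite; finiteness comes from the
  four possible offsets of a partner.\<close>

lemma finite_contacts:
  assumes "finite C"
  shows "finite {(c, d). c \<in> C \<and> d \<in> D \<and> unit_dist c d}"
proof (rule finite_subset)
  let ?U = "{(1, 0), (- 1, 0), (0, 1), (0, - 1)} :: site set"
  show "{(c, d). c \<in> C \<and> d \<in> D \<and> unit_dist c d} \<subseteq> (\<lambda>(c, u). (c, c + u)) ` (C \<times> ?U)"
  proof clarify
    fix a b x y assume "(a, b) \<in> C" "unit_dist (a, b) (x, y)"
    then show "((a, b), x, y) \<in> (\<lambda>(c, u). (c, c + u)) ` (C \<times> ?U)"
      by (intro image_eqI[of _ _ "((a, b), (x, y) - (a, b))"]) (auto simp: unit_dist_iff)
  qed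
qed (use assms in auto)

lemma Q_Un_right:
  assumes "finite C" "D \<inter> E = {}"
  shows "Q C (D \<union> E) = Q C D + Q C E"
  unfolding Q_def
  by (subst card_Un_disjoint[symmetric]) (use assms in \<open>auto intro!: finite_contacts arg_cong[where f = card]\<close>)

lemma Q_Un_left:
  assumes "finite C" "finite D" "C \<inter> D = {}"
  shows "Q (C \<union> D) E = Q C E + Q D E"
  unfolding Q_def
  by (subst card_Un_disjoint[symmetric]) (use assms in \<open>auto intro!: finite_contacts arg_cong[where f = card]\<close>)

lemma Q_commute: "Q C D = Q D C"
  unfolding Q_def
  by (rule bij_betw_same_card[of prod.swap])
     (auto simp: bij_betw_def inj_on_def unit_dist_commute image_iff)

lemma perimeter_convex_combination:
  assumes "finite A" "finite B" "A \<inter> B = {}"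
  shows "perimeter \<beta> A B =
    (1 - \<beta>) * (real (Q A (- A)) + real (Q B (- B))) + \<beta> * real (Q (A \<union> B) (- (A \<union> B)))"
proof -
  define D where "D = - (A \<union> B)"
  have "- A = B \<union> D" "- B = A \<union> D" "B \<inter> D = {}" "A \<inter> D = {}"
    using assms(3) by (auto simp: D_def)
  then have "Q A (- A) = Q A B + Q A D" "Q B (- B) = Q B A + Q B D"
    using Q_Un_right assms(1,2) by simp_all
  moreover have "Q (A \<union> B) D = Q A D + Q B D"
    using assms by (rule Q_Un_left)
  moreover have "Q B A = Q A B" by (rule Q_commute)
  moreover have "- (A \<union> B) = D" by (simp add: D_def)
  ultimately show ?thesis by (simp only: perimeter_def) (simp add: algebra_simps)
qed

section \<open>Counting boundary edges by direction\<close>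

definition exits :: "site \<Rightarrow> site set \<Rightarrow> site set" where
  "exits u S = {s \<in> S. s + u \<notin> S}"

lemma finite_exits [simp]: "finite S \<Longrightarrow> finite (exits u S)"
  by (simp add: exits_def)

text \<open>A boundary edge is encoded by its inner endpoint and its direction \<open>u\<close>; the
  four directions give disjoint families.\<close>

lemma Q_eq_exits:
  assumes "finite S"
  shows "Q S (- S) = card (exits (1, 0) S) + card (exits (- 1, 0) S)
    + card (exits (0, 1) S) + card (exits (0, - 1) S)"
proof -
  let ?U = "{(1, 0), (- 1, 0), (0, 1), (0, - 1)} :: site set"
  have "Q S (- S) = card (\<Union>u\<in>?U. (\<lambda>s. (s, s + u)) ` exits u S)"
    unfolding Q_def
  proof (rule arg_cong[where f = card], intro equalityI subsetI)
    fix z assume "z \<in> {(c, d). c \<in> S \<and> d \<in> - S \<and> unit_dist c d}"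
    then obtain c d where z: "z = (c, d)" "c \<in> S" "d \<notin> S" "d - c \<in> ?U"
      by (auto simp: unit_dist_iff)
    then have "z = (c, c + (d - c))" "c \<in> exits (d - c) S" by (auto simp: exits_def)
    with z(4) show "z \<in> (\<Union>u\<in>?U. (\<lambda>s. (s, s + u)) ` exits u S)" by blast
  next
    fix z assume "z \<in> (\<Union>u\<in>?U. (\<lambda>s. (s, s + u)) ` exits u S)"
    then obtain u s where *: "u \<in> ?U" "s \<in> exits u S" "z = (s, s + u)" by blast
    then have "unit_dist s (s + u)" unfolding unit_dist_iff by simp
    with * show "z \<in> {(c, d). c \<in> S \<and> d \<in> - S \<and> unit_dist c d}" by (auto simp: exits_def)
  qed
  also have "\<dots> = (\<Sum>u\<in>?U. card ((\<lambda>s. (s, s + u)) ` exits u S))"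
    by (rule card_UN_disjoint) (use assms in auto)
  also have "\<dots> = (\<Sum>u\<in>?U. card (exits u S))"
    by (intro sum.cong refl card_image) (auto simp: inj_on_def)
  also have "\<dots> = card (exits (1, 0) S) + card (exits (- 1, 0) S)
    + card (exits (0, 1) S) + card (exits (0, - 1) S)" by simp
  finally show ?thesis .
qed

text \<open>\<open>f\<close> labels the lines in direction \<open>u\<close> and \<open>g\<close> is
  a coordinate along them. The last site of \<open>S\<close> on a line, maximal for
  \<open>g\<close>, leaves \<open>S\<close>, so every line meeting \<open>S\<close> contributes an
  exit.\<close>

lemma image_exits:
  fixes g :: "site \<Rightarrow> int"
  assumes "finite S" "\<And>s. f (s + u) = f s" "\<And>s. g (s + u) = g s + 1"
  shows "f ` exits u S = f ` S"
proof
  show "f ` S \<subseteq> f ` exits u S"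
  proof
    fix v assume "v \<in> f ` S"
    define V where "V = {t \<in> S. f t = v}"
    have V: "finite V" "V \<noteq> {}" using assms(1) \<open>v \<in> f ` S\<close> by (auto simp: V_def)
    then have "Max (g ` V) \<in> g ` V" by simp
    then obtain t where t: "t \<in> V" "g t = Max (g ` V)" by auto
    have "t + u \<notin> V"
    proof
      assume "t + u \<in> V"
      then have "g (t + u) \<le> Max (g ` V)" using V by simp
      with t assms(3) show False by simp
    qed
    with t have "t \<in> exits u S" by (auto simp: V_def exits_def assms(2))
    with t show "v \<in> f ` exits u S" by (auto simp: V_def)
  qed
qed (auto simp: exits_def)

definition row_convex :: "site set \<Rightarrow> bool" where
  "row_convex S \<longleftrightarrow> (\<forall>x\<^sub>1 x\<^sub>2 x\<^sub>3 y. (x\<^sub>1, y) \<in> S \<longrightarrow> (x\<^sub>3, y) \<in> S \<longrightarrow> x\<^sub>1 \<le> x\<^sub>2 \<longrightarrow> x\<^sub>2 \<le> x\<^sub>3 \<longrightarrow> (x\<^sub>2, y) \<in> S)"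

definition col_convex :: "site set \<Rightarrow> bool" where
  "col_convex S \<longleftrightarrow> (\<forall>x y\<^sub>1 y\<^sub>2 y\<^sub>3. (x, y\<^sub>1) \<in> S \<longrightarrow> (x, y\<^sub>3) \<in> S \<longrightarrow> y\<^sub>1 \<le> y\<^sub>2 \<longrightarrow> y\<^sub>2 \<le> y\<^sub>3 \<longrightarrow> (x, y\<^sub>2) \<in> S)"

lemma row_convexD:
  "row_convex S \<Longrightarrow> (x\<^sub>1, y) \<in> S \<Longrightarrow> (x\<^sub>3, y) \<in> S \<Longrightarrow> x\<^sub>1 \<le> x\<^sub>2 \<Longrightarrow> x\<^sub>2 \<le> x\<^sub>3 \<Longrightarrow> (x\<^sub>2, y) \<in> S"
  unfolding row_convex_def by blast

lemma col_convexD: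
  "col_convex S \<Longrightarrow> (x, y\<^sub>1) \<in> S \<Longrightarrow> (x, y\<^sub>3) \<in> S \<Longrightarrow> y\<^sub>1 \<le> y\<^sub>2 \<Longrightarrow> y\<^sub>2 \<le> y\<^sub>3 \<Longrightarrow> (x, y\<^sub>2) \<in> S"
  unfolding col_convex_def by blast

lemma swap_mem_image: "(a, b) \<in> prod.swap ` S \<longleftrightarrow> (b, a) \<in> S"
  by force

lemma col_convex_swap: "col_convex S \<longleftrightarrow> row_convex (prod.swap ` S)"
  unfolding row_convex_def col_convex_def swap_mem_image by blast

text \<open>An interval is left exactly once to the right, while a gap in a row produces a second
  exit, from the part before the gap.\<close>

lemma inj_on_exits_iff:
  assumes "finite S"
  shows "inj_on snd (exits (1, 0) S) \<longleftrightarrow> row_convex S"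
proof
  assume inj: "inj_on snd (exits (1, 0) S)"
  show "row_convex S"
    unfolding row_convex_def
  proof (intro allI impI, rule ccontr)
    fix a b c y assume *: "(a, y) \<in> S" "(c, y) \<in> S" "a \<le> b" "b \<le> c" "(b, y) \<notin> S"
    define L where "L = {s \<in> S. fst s < b \<and> snd s = y}"
    define R where "R = {s \<in> S. fst s > b \<and> snd s = y}"
    have "a \<noteq> b" "b \<noteq> c" using * by auto
    then have "(a, y) \<in> L" "(c, y) \<in> R" using * by (auto simp: L_def R_def)
    then have "y \<in> snd ` L" "y \<in> snd ` R" by force+
    moreover have "snd ` exits (1, 0) L = snd ` L" "snd ` exits (1, 0) R = snd ` R"
      by (rule image_exits[where g = fst]; use assms in \<open>auto simp: L_def R_def\<close>)+
    ultimately have "y \<in> snd ` exits (1, 0) L" "y \<in> snd ` exits (1, 0) R" by auto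
    then obtain l r where l: "l \<in> exits (1, 0) L" and r: "r \<in> exits (1, 0) R" by auto
    have "r \<in> exits (1, 0) S" using r by (auto simp: exits_def R_def)
    moreover have "l \<in> exits (1, 0) S"
    proof -
      \<comment> \<open>The right neighbour of \<open>l\<close> is either still before the gap,
        hence outside \<open>S\<close> because \<open>l\<close> leaves \<open>L\<close>, or it is
        the gap \<open>(b, y)\<close> itself.\<close>
      have "fst l + 1 < b \<or> fst l + 1 = b" using l by (auto simp: exits_def L_def)
      then show ?thesis using l * by (cases l) (auto simp: exits_def L_def)
    qed
    moreover have "l \<noteq> r" "snd l = snd r" using l r by (auto simp: exits_def L_def R_def)
    ultimately show False using inj by (auto simp: inj_on_def)
  qed
next
  assume conv: "row_convex S"
  have False if "(a, y) \<in> exits (1, 0) S" "(b, y) \<in> exits (1, 0) S" "a < b" for a b y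
    using that row_convexD[OF conv, of a y b "a + 1"] by (auto simp: exits_def)
  then show "inj_on snd (exits (1, 0) S)"
    by (intro inj_onI) (metis linorder_neqE_linordered_idom prod.collapse)
qed

lemma inj_on_exits_left:
  assumes "row_convex S"
  shows "inj_on snd (exits (- 1, 0) S)"
proof -
  have False if "(a, y) \<in> exits (- 1, 0) S" "(b, y) \<in> exits (- 1, 0) S" "a < b" for a b y
    using that row_convexD[OF assms, of a y b "b - 1"] by (auto simp: exits_def)
  then show "inj_on snd (exits (- 1, 0) S)"
    by (intro inj_onI) (metis linorder_neqE_linordered_idom prod.collapse)
qed

text \<open>Equality is characterised on the right exits; the left exits obey the same lower bound
  and reach it under row convexity, so this decides equality for the sum of both.\<close>

lemma row_exits:
  assumes "finite S"
  shows "card (snd ` S) \<le> card (exits (1, 0) S)" "card (snd ` S) \<le> card (exits (- 1, 0) S)"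
    and "card (exits (1, 0) S) = card (snd ` S) \<longleftrightarrow> row_convex S"
    and "row_convex S \<Longrightarrow> card (exits (- 1, 0) S) = card (snd ` S)"
proof -
  have im: "snd ` exits (1, 0) S = snd ` S" "snd ` exits (- 1, 0) S = snd ` S"
    using image_exits[OF assms, of snd "(1, 0)" fst] image_exits[OF assms, of snd "(- 1, 0)" "\<lambda>s. - fst s"]
    by auto
  show "card (snd ` S) \<le> card (exits (1, 0) S)" "card (snd ` S) \<le> card (exits (- 1, 0) S)"
    using card_image_le[of "exits (1, 0) S" snd] card_image_le[of "exits (- 1, 0) S" snd] assms
    by (simp_all add: im)
  show "card (exits (1, 0) S) = card (snd ` S) \<longleftrightarrow> row_convex S"
    using inj_on_iff_eq_card[of "exits (1, 0) S" snd] inj_on_exits_iff[OF assms] assms by (auto simp: im)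
  show "row_convex S \<Longrightarrow> card (exits (- 1, 0) S) = card (snd ` S)"
    using card_image[OF inj_on_exits_left] by (metis im(2))
qed

lemma card_exits_swap:
  "card (exits (0, c) S) = card (exits (c, 0) (prod.swap ` S))"
proof -
  have "exits (c, 0) (prod.swap ` S) = prod.swap ` exits (0, c) S"
    by (force simp: exits_def image_iff)
  then show ?thesis by (simp add: card_image)
qed

lemma snd_swap_image: "snd ` prod.swap ` S = fst ` S"
  and fst_swap_image: "fst ` prod.swap ` S = snd ` S"
  by (simp_all add: image_image)

definition hv_convex :: "site set \<Rightarrow> bool" where
  "hv_convex S \<longleftrightarrow> row_convex S \<and> col_convex S"

lemma boundary_ge:
  assumes "finite S"
  shows "2 * (card (snd ` S) + card (fst ` S)) \<le> Q S (- S)"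
  using row_exits(1,2)[of S] row_exits(1,2)[of "prod.swap ` S"] assms
  by (simp add: Q_eq_exits card_exits_swap snd_swap_image)

lemma boundary_eq_iff:
  assumes "finite S"
  shows "Q S (- S) = 2 * (card (snd ` S) + card (fst ` S)) \<longleftrightarrow> hv_convex S"
proof -
  note r = row_exits[of S] and c = row_exits[of "prod.swap ` S"]
  show ?thesis
    using r c assms unfolding hv_convex_def col_convex_swap
    by (simp add: Q_eq_exits card_exits_swap snd_swap_image) linarith
qed

section \<open>Reduction to a finite-dimensional problem\<close>

text \<open>The perimeter of a pair for which all slices of \<open>A\<close>, \<open>B\<close> and
  \<open>A \<union> B\<close> are intervals.\<close>

definition bubble_cost :: "real \<Rightarrow> nat \<Rightarrow> nat \<Rightarrow> nat \<Rightarrow> nat \<Rightarrow> nat \<Rightarrow> nat \<Rightarrow> real" where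
  "bubble_cost \<beta> ra ca rb cb p q =
     2 * (real ra + real ca + real rb + real cb) - 2 * \<beta> * (real p + real q)"

text \<open>Two boxes of these sizes with \<open>p\<close> common rows and \<open>q\<close> common
  columns cover \<open>ra * ca + rb * cb - p * q\<close> cells; the product stands on the left to
  avoid truncated subtraction.\<close>

definition realizable :: "nat \<Rightarrow> nat \<Rightarrow> nat \<Rightarrow> nat \<Rightarrow> nat \<Rightarrow> nat \<Rightarrow> nat \<Rightarrow> nat \<Rightarrow> bool" where
  "realizable M N ra ca rb cb p q \<longleftrightarrow>
     M \<le> ra * ca \<and> N \<le> rb * cb \<and> M + N + p * q \<le> ra * ca + rb * cb \<and>
     p \<le> ra \<and> p \<le> rb \<and> q \<le> ca \<and> q \<le> cb"

abbreviation row_count :: "site set \<Rightarrow> nat" where "row_count S \<equiv> card (snd ` S)"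
abbreviation col_count :: "site set \<Rightarrow> nat" where "col_count S \<equiv> card (fst ` S)"
abbreviation shared_rows :: "site set \<Rightarrow> site set \<Rightarrow> nat" where
  "shared_rows A B \<equiv> card (snd ` A \<inter> snd ` B)"
abbreviation shared_cols :: "site set \<Rightarrow> site set \<Rightarrow> nat" where
  "shared_cols A B \<equiv> card (fst ` A \<inter> fst ` B)"

definition cost_of :: "real \<Rightarrow> site set \<Rightarrow> site set \<Rightarrow> real" where
  "cost_of \<beta> A B =
     bubble_cost \<beta> (row_count A) (col_count A) (row_count B) (col_count B) (shared_rows A B) (shared_cols A B)"

lemma card_image_Un:
  assumes "finite A" "finite B"
  shows "real (card (f ` (A \<union> B))) = real (card (f ` A)) + real (card (f ` B)) - real (card (f ` A \<inter> f ` B))"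
  using card_Un_Int[of "f ` A" "f ` B"] assms by (simp add: image_Un)

lemma cost_of_convex_combination:
  assumes "finite A" "finite B"
  shows "cost_of \<beta> A B = (1 - \<beta>) * (2 * (real (row_count A) + real (col_count A)) + 2 * (real (row_count B) + real (col_count B)))
    + \<beta> * (2 * (real (row_count (A \<union> B)) + real (col_count (A \<union> B))))"
  by (simp add: cost_of_def bubble_cost_def card_image_Un assms algebra_simps)

lemma perimeter_ge_cost:
  assumes "0 < \<beta>" "\<beta> < 1" "finite A" "finite B" "A \<inter> B = {}"
  shows "cost_of \<beta> A B \<le> perimeter \<beta> A B"
    and "perimeter \<beta> A B \<le> cost_of \<beta> A B \<Longrightarrow> hv_convex A \<and> hv_convex B \<and> hv_convex (A \<union> B)"
proof -
  \<comment> \<open>The defects in the three boundary estimates. Perimeter minus cost is their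
    combination with weights \<open>1 - \<beta>\<close>, \<open>1 - \<beta>\<close> and
    \<open>\<beta>\<close>.\<close>
  define u v w where
    "u = real (Q A (- A)) - 2 * (real (row_count A) + real (col_count A))"
    and "v = real (Q B (- B)) - 2 * (real (row_count B) + real (col_count B))"
    and "w = real (Q (A \<union> B) (- (A \<union> B))) - 2 * (real (row_count (A \<union> B)) + real (col_count (A \<union> B)))"
  have bd: "2 * (real (row_count S) + real (col_count S)) \<le> real (Q S (- S))" if "finite S" for S
    using of_nat_mono[OF boundary_ge[OF that], where 'a = real] by simp
  have nonneg: "u \<ge> 0" "v \<ge> 0" "w \<ge> 0"
    using assms bd[of A] bd[of B] bd[of "A \<union> B"] by (simp_all add: u_def v_def w_def del: compl_sup Compl_Un)
  have diff: "perimeter \<beta> A B - cost_of \<beta> A B = (1 - \<beta>) * u + (1 - \<beta>) * v + \<beta> * w"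
    using assms by (simp only: perimeter_convex_combination cost_of_convex_combination u_def v_def w_def)
      (simp add: algebra_simps)
  have prods: "(1 - \<beta>) * u \<ge> 0" "(1 - \<beta>) * v \<ge> 0" "\<beta> * w \<ge> 0" using nonneg assms by simp_all
  then show "cost_of \<beta> A B \<le> perimeter \<beta> A B" using diff by linarith
  assume "perimeter \<beta> A B \<le> cost_of \<beta> A B"
  with prods diff have "(1 - \<beta>) * u = 0" "(1 - \<beta>) * v = 0" "\<beta> * w = 0" by linarith+
  then have "u = 0" "v = 0" "w = 0" using assms by simp_all
  then have "real (Q A (- A)) = real (2 * (row_count A + col_count A))"
    "real (Q B (- B)) = real (2 * (row_count B + col_count B))"
    "real (Q (A \<union> B) (- (A \<union> B))) = real (2 * (row_count (A \<union> B) + col_count (A \<union> B)))"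
    unfolding u_def v_def w_def by (simp_all del: compl_sup Compl_Un)
  then show "hv_convex A \<and> hv_convex B \<and> hv_convex (A \<union> B)"
    using assms by (simp only: of_nat_eq_iff boundary_eq_iff finite_Un)
qed

text \<open>Each set lies in the product of its column set and its row set. The two products
  intersect in the product of the shared columns and shared rows, so inclusion-exclusion bounds the
  size of the union.\<close>

lemma realizable_of_sets:
  assumes "finite A" "finite B" "A \<inter> B = {}"
  shows "realizable (card A) (card B) (row_count A) (col_count A) (row_count B) (col_count B) (shared_rows A B) (shared_cols A B)"
proof -
  have A: "A \<subseteq> fst ` A \<times> snd ` A" and B: "B \<subseteq> fst ` B \<times> snd ` B" by force+
  have "card A \<le> row_count A * col_count A" "card B \<le> row_count B * col_count B"
    using card_mono[OF _ A] card_mono[OF _ B] assms by (simp_all add: card_cartesian_product mult.commute)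
  moreover have "card A + card B + shared_rows A B * shared_cols A B \<le> row_count A * col_count A + row_count B * col_count B"
  proof -
    let ?RA = "fst ` A \<times> snd ` A" and ?RB = "fst ` B \<times> snd ` B"
    have "card A + card B = card (A \<union> B)" using assms by (simp add: card_Un_disjoint)
    also have "\<dots> \<le> card (?RA \<union> ?RB)" using A B assms by (intro card_mono) auto
    moreover have "card (?RA \<union> ?RB) + card (?RA \<inter> ?RB) = card ?RA + card ?RB"
      using assms by (intro card_Un_Int[symmetric]) auto
    moreover have "?RA \<inter> ?RB = (fst ` A \<inter> fst ` B) \<times> (snd ` A \<inter> snd ` B)" by auto
    ultimately show ?thesis by (simp only: card_cartesian_product mult.commute)
  qed
  ultimately show ?thesis unfolding realizable_def using assms by (auto intro!: card_mono)
qed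

text \<open>Upper bounds are used since a constructed pair may miss some lines of its boxes. Sharing
  is expressed through the lines of the union: in that form all coefficients are nonnegative,
  whereas the cost decreases in \<open>p\<close> and \<open>q\<close>.\<close>

lemma perimeter_le_cost:
  assumes "0 < \<beta>" "\<beta> < 1" "finite A" "finite B" "A \<inter> B = {}"
    and "hv_convex A" "hv_convex B" "hv_convex (A \<union> B)"
    and "row_count A \<le> ra" "col_count A \<le> ca" "row_count B \<le> rb" "col_count B \<le> cb"
    and "row_count (A \<union> B) + p \<le> ra + rb" "col_count (A \<union> B) + q \<le> ca + cb"
  shows "perimeter \<beta> A B \<le> bubble_cost \<beta> ra ca rb cb p q"
proof -
  have bd: "Q S (- S) = 2 * (row_count S + col_count S)" if "S \<in> {A, B, A \<union> B}" for S
    using boundary_eq_iff[of S] that assms(3,4,6-8) by auto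
  have "perimeter \<beta> A B = (1 - \<beta>) * (2 * (real (row_count A) + real (col_count A) + real (row_count B) + real (col_count B)))
      + \<beta> * (2 * (real (row_count (A \<union> B)) + real (col_count (A \<union> B))))"
    using assms by (subst perimeter_convex_combination) (simp_all add: bd del: compl_sup Compl_Un)
  also have "\<dots> \<le> (1 - \<beta>) * (2 * (real ra + real ca + real rb + real cb))
      + \<beta> * (2 * (real ra + real rb - real p + (real ca + real cb - real q)))"
    by (intro add_mono mult_left_mono) (use assms in simp_all)
  also have "\<dots> = bubble_cost \<beta> ra ca rb cb p q" by (simp add: bubble_cost_def algebra_simps)
  finally show ?thesis .
qed

text \<open>Cuts a prescribed number of sites off a traversal: as \<open>f\<close> is injective,
  moving the threshold to the next value adds exactly one site.\<close>

lemma initial_segment_exists: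
  fixes f :: "'a \<Rightarrow> int"
  assumes "finite S" "inj_on f S" "k \<le> card S"
  shows "\<exists>t. card {s \<in> S. f s \<le> t} = k"
  using assms(3)
proof (induction k)
  case 0
  show ?case
  proof (cases "S = {}")
    case False
    then have "f s > Min (f ` S) - 1" if "s \<in> S" for s
    proof -
      have "Min (f ` S) \<le> f s" using that assms(1) by simp
      then show ?thesis by linarith
    qed
    then have "{s \<in> S. f s \<le> Min (f ` S) - 1} = {}" by force
    then show ?thesis by (metis card.empty)
  qed simp
next
  case (Suc k)
  then obtain t where t: "card {s \<in> S. f s \<le> t} = k" by auto
  define R where "R = {s \<in> S. f s > t}"
  have "R \<noteq> {}"
  proof
    assume "R = {}"
    then have "{s \<in> S. f s \<le> t} = S" by (force simp: R_def)
    with t Suc.prems show False by simp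
  qed
  moreover have R: "finite R" using assms(1) by (simp add: R_def)
  ultimately have "Min (f ` R) \<in> f ` R" by simp
  then obtain r where r: "r \<in> R" "f r = Min (f ` R)" by auto
  have "{s \<in> S. f s \<le> f r} = insert r {s \<in> S. f s \<le> t}"
  proof (intro equalityI subsetI)
    fix s assume s: "s \<in> {s \<in> S. f s \<le> f r}"
    show "s \<in> insert r {s \<in> S. f s \<le> t}"
    proof (cases "f s \<le> t")
      case False
      then have "f r \<le> f s" using s R r(2) by (simp add: R_def)
      then have "s = r" using s r(1) assms(2) by (auto simp: R_def dest: inj_onD)
      then show ?thesis by simp
    qed (use s in simp)
  qed (use r in \<open>auto simp: R_def\<close>)
  moreover have "r \<notin> {s \<in> S. f s \<le> t}" using r by (auto simp: R_def)
  ultimately have "card {s \<in> S. f s \<le> f r} = Suc k" using t assms(1) by simp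
  then show ?case by blast
qed

lemma final_segment_exists:
  fixes f :: "'a \<Rightarrow> int"
  assumes "finite S" "inj_on f S" "k \<le> card S"
  shows "\<exists>t. card {s \<in> S. f s > t} = k"
proof -
  obtain t where t: "card {s \<in> S. f s \<le> t} = card S - k"
    using initial_segment_exists[OF assms(1,2), of "card S - k"] by auto
  have "card S = card {s \<in> S. f s \<le> t} + card {s \<in> S. f s > t}"
    using assms(1) by (subst card_Un_disjoint[symmetric]) (auto intro!: arg_cong[where f = card])
  then show ?thesis using t assms(3) by (intro exI[of _ t]) simp
qed

text \<open>Two rectangles of the prescribed sizes overlap in a \<open>p\<close> by \<open>q\<close> corner rectangle. Traversing the
  sites column by column, the first part of the overlap goes to the lower left set and the rest to
  the upper right one; superfluous sites are then deleted from the far ends of the same traversal.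
  Monotonicity of the traversal in both coordinates keeps every slice an interval.\<close>

lemma realizable_competitor:
  assumes \<beta>: "0 < \<beta>" "\<beta> < 1" and real: "realizable M N ra ca rb cb p q"
  shows "\<exists>A B. admissible M N A B \<and> perimeter \<beta> A B \<le> bubble_cost \<beta> ra ca rb cb p q"
proof -
  note real = real[unfolded realizable_def]
  \<comment> \<open>\<open>W\<close> exceeds every row index that occurs, so \<open>f\<close> runs
    column by column and is injective on both boxes.\<close>
  define W where "W = int (ra + rb) + 1"
  define f :: "site \<Rightarrow> int" where "f = (\<lambda>(x, y). x * W + y)"
  define X where "X = {1..int ca} \<times> {1..int ra}"
  \<comment> \<open>The shift makes the upper right corner of \<open>X\<close> and the lower left
    corner of \<open>Y\<close> the common rectangle of \<open>p\<close> rows and \<open>q\<close>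
    columns.\<close>
  define Y where "Y = {int ca - int q + 1..int ca - int q + int cb} \<times> {int ra - int p + 1..int ra - int p + int rb}"
  have f_row: "f (x, y) \<le> f (x', y)" if "x \<le> x'" for x x' y
    using that by (simp add: f_def W_def mult_right_mono)
  have f_row': "f (x, y) < f (x', y)" if "x < x'" for x x' y
    using that by (simp add: f_def W_def mult_strict_right_mono)
  have f_col: "f (x, y) \<le> f (x, y')" if "y \<le> y'" for x y y'
    using that by (simp add: f_def)
  have f_col': "f (x, y) < f (x, y')" if "y < y'" for x y y'
    using that by (simp add: f_def)
  have fin: "finite X" "finite Y" by (simp_all add: X_def Y_def)
  have "inj_on f {(x, y). 0 \<le> y \<and> y < W}"
  proof (rule inj_onI, clarify)
    fix a b c d assume "0 \<le> b" "b < W" "0 \<le> d" "d < W" and eq: "f (a, b) = f (c, d)"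
    then have "(a * W + b) div W = a" "(c * W + d) div W = c" by simp_all
    with eq have "a = c" by (simp add: f_def)
    with eq show "a = c \<and> b = d" by (simp add: f_def)
  qed
  moreover have "X \<union> Y \<subseteq> {(x, y). 0 \<le> y \<and> y < W}"
    using real by (auto simp: X_def Y_def W_def)
  ultimately have inj: "inj_on f (X \<union> Y)" by (rule inj_on_subset)
  have XY: "X \<inter> Y = {int ca - int q + 1..int ca} \<times> {int ra - int p + 1..int ra}"
    using real by (auto simp: X_def Y_def)
  have card_X: "card X = ra * ca" and card_Y: "card Y = rb * cb" and card_XY: "card (X \<inter> Y) = p * q"
    unfolding XY by (simp_all add: X_def Y_def card_cartesian_product)
  \<comment> \<open>The number of overlap cells that the lower left set needs in addition to its own
    cells; truncation yields 0 if it needs none. The area condition then leaves enough cells for the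
    other set.\<close>
  define k where "k = M + p * q - ra * ca"
  have k: "k \<le> p * q" "M + p * q \<le> ra * ca + k" "N + k \<le> rb * cb" using real by (auto simp: k_def)
  have "\<exists>t. card {s \<in> X \<inter> Y. f s \<le> t} = k"
    by (rule initial_segment_exists) (use fin k(1) card_XY inj_on_subset[OF inj, of "X \<inter> Y"] in auto)
  then obtain \<kappa> where \<kappa>: "card {s \<in> X \<inter> Y. f s \<le> \<kappa>} = k" by blast
  define X' where "X' = {s \<in> X. s \<in> Y \<longrightarrow> f s \<le> \<kappa>}"
  define Y' where "Y' = {s \<in> Y. s \<in> X \<longrightarrow> f s > \<kappa>}"
  have fin': "finite X'" "finite Y'" using fin by (simp_all add: X'_def Y'_def)
  have "card X' + p * q = ra * ca + k"
  proof -
    have "card X' = card (X - Y) + card {s \<in> X \<inter> Y. f s \<le> \<kappa>}"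
      using fin by (subst card_Un_disjoint[symmetric]) (auto simp: X'_def intro!: arg_cong[where f = card])
    moreover have "card X = card (X - Y) + card (X \<inter> Y)"
      using fin by (subst card_Un_disjoint[symmetric]) (auto intro!: arg_cong[where f = card])
    ultimately show ?thesis using card_X card_XY \<kappa> by simp
  qed
  then have cX': "M \<le> card X'" using k(2) by simp
  have "card Y' + k = rb * cb"
  proof -
    have "card Y = card Y' + card {s \<in> X \<inter> Y. f s \<le> \<kappa>}"
      using fin by (subst card_Un_disjoint[symmetric]) (auto simp: Y'_def intro!: arg_cong[where f = card])
    then show ?thesis using card_Y \<kappa> by simp
  qed
  then have cY': "N \<le> card Y'" using k(3) by simp
  \<comment> \<open>\<open>A\<close> keeps the last \<open>M\<close> sites of \<open>X'\<close> and
    \<open>B\<close> the first \<open>N\<close> of \<open>Y'\<close>, so cells are deleted only at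
    the ends facing away from the other set.\<close>
  obtain \<mu> where \<mu>: "card {s \<in> X'. f s > \<mu>} = M"
    using final_segment_exists[of X' f M] fin' cX' inj_on_subset[OF inj, of X'] by (auto simp: X'_def)
  obtain \<nu> where \<nu>: "card {s \<in> Y'. f s \<le> \<nu>} = N"
    using initial_segment_exists[of Y' f N] fin' cY' inj_on_subset[OF inj, of Y'] by (auto simp: Y'_def)
  define A where "A = {s \<in> X'. f s > \<mu>}"
  define B where "B = {s \<in> Y'. f s \<le> \<nu>}"
  have finAB: "finite A" "finite B" using fin' by (simp_all add: A_def B_def)
  have disj: "A \<inter> B = {}" by (auto simp: A_def B_def X'_def Y'_def)
  have adm: "admissible M N A B" using \<mu> \<nu> finAB disj by (simp add: admissible_def A_def B_def)
  have X'_or_Y': "s \<in> X' \<or> s \<in> Y'" if "s \<in> X \<or> s \<in> Y" for s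
    using that by (auto simp: X'_def Y'_def)
  have row_AB: "(x2, y) \<in> A" if "(x1, y) \<in> A" "(x3, y) \<in> A" "x1 \<le> x2" "x2 \<le> x3" for x1 x2 x3 y
    using that f_row[of x1 x2 y] f_row[of x2 x3 y] real
    by (auto simp: A_def X'_def X_def Y_def)
  have col_A: "(x, y2) \<in> A" if "(x, y1) \<in> A" "(x, y3) \<in> A" "y1 \<le> y2" "y2 \<le> y3" for x y1 y2 y3
    using that f_col[of y1 y2 x] f_col[of y2 y3 x] real
    by (auto simp: A_def X'_def X_def Y_def)
  have row_B: "(x2, y) \<in> B" if "(x1, y) \<in> B" "(x3, y) \<in> B" "x1 \<le> x2" "x2 \<le> x3" for x1 x2 x3 y
    using that f_row[of x1 x2 y] f_row[of x2 x3 y] real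
    by (auto simp: B_def Y'_def X_def Y_def)
  have col_B: "(x, y2) \<in> B" if "(x, y1) \<in> B" "(x, y3) \<in> B" "y1 \<le> y2" "y2 \<le> y3" for x y1 y2 y3
    using that f_col[of y1 y2 x] f_col[of y2 y3 x] real
    by (auto simp: B_def Y'_def X_def Y_def)
  \<comment> \<open>A site between \<open>a\<close> and \<open>b\<close> in the traversal survives
    the deletion: in \<open>X'\<close> it lies beyond \<open>\<mu>\<close>, in \<open>Y'\<close> not
    beyond \<open>\<nu>\<close>.\<close>
  have cross: "s \<in> A \<union> B" if "a \<in> A" "b \<in> B" "f a \<le> f s" "f s \<le> f b" "s \<in> X \<or> s \<in> Y" for a b s
    using that X'_or_Y'[OF that(5)] by (auto simp: A_def B_def)
  have convA: "hv_convex A"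
    unfolding hv_convex_def row_convex_def col_convex_def using row_AB col_A by blast
  have convB: "hv_convex B"
    unfolding hv_convex_def row_convex_def col_convex_def using row_B col_B by blast
  have row_mixed: "(x2, y) \<in> A \<union> B" if "(x1, y) \<in> A" "(x3, y) \<in> B" "x1 \<le> x2" "x2 \<le> x3" for x1 x2 x3 y
    by (rule cross[OF that(1,2)])
      (use that f_row[of x1 x2 y] f_row[of x2 x3 y] real in \<open>auto simp: A_def B_def X'_def Y'_def X_def Y_def\<close>)
  \<comment> \<open>A \<open>B\<close> site left of an \<open>A\<close> site in the same row would
    put both into the overlap, where \<open>f\<close> is at most \<open>\<kappa>\<close> on
    \<open>A\<close> and larger on \<open>B\<close>.\<close>
  have row_back: False if "(x1, y) \<in> B" "(x3, y) \<in> A" "x1 \<le> x3" for x1 x3 y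
    using that f_row[of x1 x3 y] real by (auto simp: A_def B_def X'_def Y'_def X_def Y_def)
  have col_mixed: "(x, y2) \<in> A \<union> B" if "(x, y1) \<in> A" "(x, y3) \<in> B" "y1 \<le> y2" "y2 \<le> y3" for x y1 y2 y3
    by (rule cross[OF that(1,2)])
      (use that f_col[of y1 y2 x] f_col[of y2 y3 x] real in \<open>auto simp: A_def B_def X'_def Y'_def X_def Y_def\<close>)
  have col_back: False if "(x, y1) \<in> B" "(x, y3) \<in> A" "y1 \<le> y3" for x y1 y3
    using that f_col[of y1 y3 x] real by (auto simp: A_def B_def X'_def Y'_def X_def Y_def)
  have "(x2, y) \<in> A \<union> B" if "(x1, y) \<in> A \<union> B" "(x3, y) \<in> A \<union> B" "x1 \<le> x2" "x2 \<le> x3" for x1 x2 x3 y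
    using that row_AB[of x1 y x3 x2] row_B[of x1 y x3 x2] row_mixed[of x1 y x3 x2] row_back[of x1 y x3]
    by auto
  moreover have "(x, y2) \<in> A \<union> B" if "(x, y1) \<in> A \<union> B" "(x, y3) \<in> A \<union> B" "y1 \<le> y2" "y2 \<le> y3" for x y1 y2 y3
    using that col_A[of x y1 y3 y2] col_B[of x y1 y3 y2] col_mixed[of x y1 y3 y2] col_back[of x y1 y3]
    by auto
  ultimately have convAB: "hv_convex (A \<union> B)"
    unfolding hv_convex_def row_convex_def col_convex_def by blast
  have "A \<subseteq> X" "B \<subseteq> Y" by (auto simp: A_def B_def X'_def Y'_def)
  have sA: "snd ` A \<subseteq> {1..int ra}" "fst ` A \<subseteq> {1..int ca}"
    using \<open>A \<subseteq> X\<close> by (auto simp: X_def)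
  have sB: "snd ` B \<subseteq> {int ra - int p + 1..int ra - int p + int rb}"
    "fst ` B \<subseteq> {int ca - int q + 1..int ca - int q + int cb}"
    using \<open>B \<subseteq> Y\<close> by (auto simp: Y_def)
  have sAB: "snd ` (A \<union> B) \<subseteq> {1..int ra - int p + int rb}"
    "fst ` (A \<union> B) \<subseteq> {1..int ca - int q + int cb}"
    unfolding image_Un
    by (intro Un_least order_trans[OF sA(1)] order_trans[OF sB(1)] order_trans[OF sA(2)] order_trans[OF sB(2)];
        use real in auto)+
  have "int (row_count (A \<union> B)) \<le> int ra - int p + int rb" "int (col_count (A \<union> B)) \<le> int ca - int q + int cb"
    using card_mono[OF _ sAB(1)] card_mono[OF _ sAB(2)] real by (simp_all add: le_nat_iff)
  then have "row_count (A \<union> B) + p \<le> ra + rb" "col_count (A \<union> B) + q \<le> ca + cb"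
    by linarith+
  then have "perimeter \<beta> A B \<le> bubble_cost \<beta> ra ca rb cb p q"
    by (intro perimeter_le_cost[OF \<beta> finAB disj convA convB convAB])
       (use card_mono[OF _ sA(1)] card_mono[OF _ sA(2)] card_mono[OF _ sB(1)] card_mono[OF _ sB(2)]
        in simp_all)
  with adm show ?thesis by blast
qed

text \<open>The six numbers of a minimizer are realizable, so the competitor built from them bounds
  its perimeter by its own cost. Together with the lower bound this is equality, which gives
  convexity and transfers minimality to the integer problem.\<close>

lemma minimizer_cost:
  assumes "0 < \<beta>" "\<beta> < 1" and sol: "solves_double_bubble \<beta> M N A B"
  shows "admissible M N A B" "perimeter \<beta> A B = cost_of \<beta> A B"
    and "hv_convex A" "hv_convex B" "hv_convex (A \<union> B)"
    and "\<And>ra ca rb cb p q. realizable M N ra ca rb cb p q \<Longrightarrow> cost_of \<beta> A B \<le> bubble_cost \<beta> ra ca rb cb p q"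
proof -
  have min: "perimeter \<beta> A B \<le> perimeter \<beta> A' B'" if "admissible M N A' B'" for A' B'
    using sol that unfolding solves_double_bubble_def is_arg_min_linorder by auto
  show adm: "admissible M N A B"
    using sol by (auto simp: solves_double_bubble_def is_arg_min_linorder)
  then have fin: "finite A" "finite B" "A \<inter> B = {}" "card A = M" "card B = N"
    by (auto simp: admissible_def)
  have le: "perimeter \<beta> A B \<le> bubble_cost \<beta> ra ca rb cb p q"
    if "realizable M N ra ca rb cb p q" for ra ca rb cb p q
    using realizable_competitor[OF assms(1,2) that] min by force
  have "perimeter \<beta> A B \<le> cost_of \<beta> A B"
    unfolding cost_of_def by (rule le) (use realizable_of_sets[of A B] fin in simp)
  with perimeter_ge_cost[OF assms(1,2) fin(1-3)]
  show eq: "perimeter \<beta> A B = cost_of \<beta> A B" and "hv_convex A" "hv_convex B" "hv_convex (A \<union> B)"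
    by auto
  show "cost_of \<beta> A B \<le> bubble_cost \<beta> ra ca rb cb p q"
    if "realizable M N ra ca rb cb p q" for ra ca rb cb p q
    using le[OF that] eq by simp
qed

section \<open>Connectedness\<close>

definition adj :: "site set \<Rightarrow> (site \<times> site) set" where
  "adj S = {(x, y). x \<in> S \<and> y \<in> S \<and> unit_dist x y}"

lemma lattice_connected_adj: "lattice_connected V \<longleftrightarrow> (\<forall>u\<in>V. \<forall>v\<in>V. (u, v) \<in> (adj V)\<^sup>*)"
  by (simp add: lattice_connected_def adj_def)

lemma adj_rtrancl_sym: "(u, v) \<in> (adj S)\<^sup>* \<Longrightarrow> (v, u) \<in> (adj S)\<^sup>*"
proof -
  have "sym (adj S)" by (auto simp: adj_def sym_def unit_dist_commute)
  then show "(u, v) \<in> (adj S)\<^sup>* \<Longrightarrow> (v, u) \<in> (adj S)\<^sup>*" using sym_rtrancl symD by metis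
qed

lemma adj_mono: "S \<subseteq> T \<Longrightarrow> (u, v) \<in> (adj S)\<^sup>* \<Longrightarrow> (u, v) \<in> (adj T)\<^sup>*"
  using rtrancl_mono[of "adj S" "adj T"] by (auto simp: adj_def)

lemma row_path:
  assumes "row_convex S" "(a, y) \<in> S" "(b, y) \<in> S"
  shows "((a, y), (b, y)) \<in> (adj S)\<^sup>*"
proof -
  have "((u, y), (v, y)) \<in> (adj S)\<^sup>*" if "u \<le> v" "(u, y) \<in> S" "(v, y) \<in> S" for u v
    using that
  proof (induction v rule: int_ge_induct)
    case (step v)
    then have "(v, y) \<in> S" using row_convexD[OF assms(1), of u y "v + 1" v] by simp
    with step have "((u, y), (v, y)) \<in> (adj S)\<^sup>*" "((v, y), (v + 1, y)) \<in> adj S"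
      by (auto simp: adj_def unit_dist_cases)
    then show ?case by (rule rtrancl_into_rtrancl)
  qed simp
  then show ?thesis using assms adj_rtrancl_sym by (metis linear)
qed

lemma col_path:
  assumes "col_convex S" "(x, a) \<in> S" "(x, b) \<in> S"
  shows "((x, a), (x, b)) \<in> (adj S)\<^sup>*"
proof -
  have "((x, u), (x, v)) \<in> (adj S)\<^sup>*" if "u \<le> v" "(x, u) \<in> S" "(x, v) \<in> S" for u v
    using that
  proof (induction v rule: int_ge_induct)
    case (step v)
    then have "(x, v) \<in> S" using col_convexD[OF assms(1), of x u "v + 1" v] by simp
    with step have "((x, u), (x, v)) \<in> (adj S)\<^sup>*" "((x, v), (x, v + 1)) \<in> adj S"
      by (auto simp: adj_def unit_dist_cases)
    then show ?case by (rule rtrancl_into_rtrancl)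
  qed simp
  then show ?thesis using assms adj_rtrancl_sym by (metis linear)
qed

lemma lattice_connected_row:
  assumes "row_convex S"
  shows "lattice_connected (S \<inter> Row z)"
proof -
  have conv: "row_convex (S \<inter> Row z)" using assms unfolding row_convex_def Row_def by blast
  have "(u, v) \<in> (adj (S \<inter> Row z))\<^sup>*" if "u \<in> S \<inter> Row z" "v \<in> S \<inter> Row z" for u v
    using row_path[OF conv, of "fst u" z "fst v"] that by (auto simp: Row_def)
  then show ?thesis by (simp add: lattice_connected_adj)
qed

lemma lattice_connected_col:
  assumes "col_convex S"
  shows "lattice_connected (S \<inter> Col z)"
proof -
  have conv: "col_convex (S \<inter> Col z)" using assms unfolding col_convex_def Col_def by blast
  have "(u, v) \<in> (adj (S \<inter> Col z))\<^sup>*" if "u \<in> S \<inter> Col z" "v \<in> S \<inter> Col z" for u v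
    using col_path[OF conv, of z "snd u" "snd v"] that by (auto simp: Col_def)
  then show ?thesis by (simp add: lattice_connected_adj)
qed

lemma lattice_connected_crossing:
  assumes "lattice_connected V" "u \<in> V" "v \<in> V" "P u" "\<not> P v"
  obtains s t where "s \<in> V" "t \<in> V" "P s" "\<not> P t" "unit_dist s t"
proof -
  have "(u, v) \<in> (adj V)\<^sup>*" using assms by (simp add: lattice_connected_adj)
  then have "P v \<or> (\<exists>s t. s \<in> V \<and> t \<in> V \<and> P s \<and> \<not> P t \<and> unit_dist s t)"
    using assms(4) by (induction rule: rtrancl_induct) (auto simp: adj_def)
  with assms(5) that show thesis by blast
qed

text \<open>Sites of a convex slice are joined within the slice, so a connected component contains
  every slice that it meets.\<close>

lemma disconnected_split:
  assumes "hv_convex S" "\<not> lattice_connected S"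
  obtains T U where "T \<noteq> {}" "U \<noteq> {}" "S = T \<union> U" "T \<inter> U = {}"
    "snd ` T \<inter> snd ` U = {}" "fst ` T \<inter> fst ` U = {}"
proof -
  obtain u v where uv: "u \<in> S" "v \<in> S" "(u, v) \<notin> (adj S)\<^sup>*"
    using assms(2) by (auto simp: lattice_connected_adj)
  define T where "T = {x \<in> S. (u, x) \<in> (adj S)\<^sup>*}"
  have ends: "u \<in> T" "v \<in> S - T" using uv by (auto simp: T_def)
  have no_path: "(s, t) \<notin> (adj S)\<^sup>*" if "s \<in> T" "t \<in> S - T" for s t
    using that by (auto simp: T_def dest: rtrancl_trans)
  show thesis
  proof
    show "snd ` T \<inter> snd ` (S - T) = {}"
    proof (rule ccontr)
      assume "snd ` T \<inter> snd ` (S - T) \<noteq> {}"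
      then obtain v where "v \<in> snd ` T" "v \<in> snd ` (S - T)" by blast
      then obtain a b y where ab: "(a, y) \<in> T" "(b, y) \<in> S - T"
        by (elim imageE) (metis prod.collapse)
      then have "((a, y), (b, y)) \<in> (adj S)\<^sup>*"
        using assms(1) by (intro row_path) (auto simp: hv_convex_def T_def)
      with no_path[OF ab] show False by simp
    qed
    show "fst ` T \<inter> fst ` (S - T) = {}"
    proof (rule ccontr)
      assume "fst ` T \<inter> fst ` (S - T) \<noteq> {}"
      then obtain v where "v \<in> fst ` T" "v \<in> fst ` (S - T)" by blast
      then obtain a b x where ab: "(x, a) \<in> T" "(x, b) \<in> S - T"
        by (elim imageE) (metis prod.collapse)
      then have "((x, a), (x, b)) \<in> (adj S)\<^sup>*"
        using assms(1) by (intro col_path) (auto simp: hv_convex_def T_def)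
      with no_path[OF ab] show False by simp
    qed
    show "T \<noteq> {}" "S - T \<noteq> {}" "T \<inter> (S - T) = {}" using ends by blast+
    show "S = T \<union> (S - T)" by (auto simp: T_def)
  qed
qed

lemma solves_double_bubble_commute:
  assumes "solves_double_bubble \<beta> M N A B"
  shows "solves_double_bubble \<beta> N M B A"
proof -
  have per: "perimeter \<beta> B A = perimeter \<beta> A B" for A B by (simp add: perimeter_def Q_commute[of B A])
  have adm: "admissible N M B A \<longleftrightarrow> admissible M N A B" for A B by (auto simp: admissible_def)
  show ?thesis
    unfolding solves_double_bubble_def is_arg_min_linorder
  proof (clarsimp, intro conjI allI impI)
    show "admissible N M B A" using assms by (simp add: solves_double_bubble_def is_arg_min_linorder adm)
    show "perimeter \<beta> B A \<le> perimeter \<beta> X Y" if "admissible N M X Y" for X Y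
      using assms that by (auto simp: solves_double_bubble_def is_arg_min_linorder adm[of X Y] per[of B A] per[of X Y])
  qed
qed

text \<open>The union lies in the box of \<open>B\<close> together with those parts of the boxes of
  \<open>T\<close> and \<open>U\<close> that are outside it. With \<open>B\<close> empty this bounds
  the size of \<open>T \<union> U\<close> alone.\<close>

lemma card_split_rectangles:
  fixes T U B :: "site set"
  assumes fin: "finite T" "finite U" "finite B"
    and disj: "snd ` T \<inter> snd ` U = {}" "fst ` T \<inter> fst ` U = {}"
  shows "card (B \<union> (T \<union> U)) + shared_rows T B * shared_cols T B + shared_rows U B * shared_cols U B
    \<le> row_count B * col_count B + row_count T * col_count T + row_count U * col_count U"
proof -
  let ?R = "\<lambda>S. fst ` S \<times> snd ` S"
  have diff: "card (?R S - ?R B) + shared_rows S B * shared_cols S B = row_count S * col_count S"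
    if "finite S" for S
  proof -
    have "?R S \<inter> ?R B = (fst ` S \<inter> fst ` B) \<times> (snd ` S \<inter> snd ` B)" by auto
    then have "card (?R S \<inter> ?R B) = shared_rows S B * shared_cols S B"
      by (simp only: card_cartesian_product mult.commute)
    moreover have "card (?R S) = row_count S * col_count S" by (simp only: card_cartesian_product mult.commute)
    moreover have "card (?R S) = card (?R S \<inter> ?R B) + card (?R S - ?R B)"
      using that by (intro card_Int_Diff) simp
    ultimately show ?thesis by simp
  qed
  have "B \<union> (T \<union> U) \<subseteq> ?R B \<union> ((?R T - ?R B) \<union> (?R U - ?R B))" by force
  then have "card (B \<union> (T \<union> U)) \<le> card (?R B \<union> ((?R T - ?R B) \<union> (?R U - ?R B)))"
    using fin by (intro card_mono) auto
  also have "\<dots> \<le> card (?R B) + (card (?R T - ?R B) + card (?R U - ?R B))"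
    by (intro order_trans[OF card_Un_le] add_mono order_refl card_Un_le)
  also have "card (?R B) = row_count B * col_count B" by (simp only: card_cartesian_product mult.commute)
  finally show ?thesis using diff[OF fin(1)] diff[OF fin(2)] by linarith
qed

text \<open>If \<open>A\<close> fell into two pieces, these would occupy disjoint rows and columns; the two off-diagonal
  blocks left empty by them are large enough to do without one column of \<open>A\<close>.\<close>

lemma minimizer_connected:
  assumes \<beta>: "0 < \<beta>" "\<beta> < 1" and sol: "solves_double_bubble \<beta> M N A B"
  shows "lattice_connected A"
proof (rule ccontr)
  note min = minimizer_cost[OF \<beta> sol]
  assume "\<not> lattice_connected A"
  then obtain T U where TU: "T \<noteq> {}" "U \<noteq> {}" "A = T \<union> U" "T \<inter> U = {}"
    and disj: "snd ` T \<inter> snd ` U = {}" "fst ` T \<inter> fst ` U = {}"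
    using disconnected_split min(3) by metis
  have fin: "finite A" "finite B" "A \<inter> B = {}" "card A = M" "card B = N" "finite T" "finite U"
    using min(1) TU(3) by (auto simp: admissible_def)
  have pos: "row_count T \<ge> 1" "row_count U \<ge> 1" "col_count T \<ge> 1" "col_count U \<ge> 1"
    using TU fin by (simp_all add: Suc_le_eq card_gt_0_iff)
  have counts: "row_count A = row_count T + row_count U" "col_count A = col_count T + col_count U"
    unfolding TU(3) image_Un using fin disj by (simp_all add: card_Un_disjoint)
  have shared: "shared_rows A B = shared_rows T B + shared_rows U B"
    "shared_cols A B = shared_cols T B + shared_cols U B"
    unfolding TU(3) image_Un Int_Un_distrib2 using fin disj
    by (auto intro!: card_Un_disjoint)
  have sh_le: "shared_rows T B \<le> row_count T" "shared_rows U B \<le> row_count U"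
    "shared_cols T B \<le> col_count T" "shared_cols U B \<le> col_count U"
    using fin by (auto intro!: card_mono)
  have real: "realizable M N (row_count A) (col_count A) (row_count B) (col_count B) (shared_rows A B) (shared_cols A B)"
    using realizable_of_sets[of A B] fin by simp
  define r\<^sub>1 r\<^sub>2 c\<^sub>1 c\<^sub>2 p\<^sub>1 p\<^sub>2 q\<^sub>1 q\<^sub>2 where
    defs: "r\<^sub>1 = row_count T" "r\<^sub>2 = row_count U" "c\<^sub>1 = col_count T" "c\<^sub>2 = col_count U"
    "p\<^sub>1 = shared_rows T B" "p\<^sub>2 = shared_rows U B" "q\<^sub>1 = shared_cols T B" "q\<^sub>2 = shared_cols U B"
  note folded = pos[folded defs] sh_le[folded defs]
  have "card A \<le> r\<^sub>1 * c\<^sub>1 + r\<^sub>2 * c\<^sub>2"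
    using card_split_rectangles[of T U "{}"] fin disj by (simp add: TU(3) defs)
  then have M: "M \<le> r\<^sub>1 * c\<^sub>1 + r\<^sub>2 * c\<^sub>2" using fin by simp
  have "card (A \<union> B) = M + N" using fin by (simp add: card_Un_disjoint)
  then have MN: "M + N + p\<^sub>1 * q\<^sub>1 + p\<^sub>2 * q\<^sub>2 \<le> row_count B * col_count B + r\<^sub>1 * c\<^sub>1 + r\<^sub>2 * c\<^sub>2"
    using card_split_rectangles[OF fin(6,7,2) disj] by (simp add: TU(3) defs Un_commute)
  \<comment> \<open>The two empty blocks have
    \<open>r\<^sub>1 * c\<^sub>2 + r\<^sub>2 * c\<^sub>1\<close> cells, at least one full column of
    length \<open>r\<^sub>1 + r\<^sub>2\<close>.\<close>
  have M': "M \<le> (r\<^sub>1 + r\<^sub>2) * (c\<^sub>1 + c\<^sub>2 - 1)"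
  proof -
    obtain a b where "c\<^sub>1 = Suc a" "c\<^sub>2 = Suc b" using folded by (metis Suc_le_D One_nat_def)
    with M show ?thesis by (simp add: algebra_simps)
  qed
  have N': "N \<le> row_count B * col_count B" using real by (simp add: realizable_def)
  \<comment> \<open>The block of \<open>r\<^sub>1\<close> rows and \<open>c\<^sub>2\<close> columns
    has at least \<open>r\<^sub>1 - p\<^sub>1\<close> cells outside the overlap, and similarly for
    the other block. Together they replace the cells lost when a shared column of \<open>A\<close>
    is dropped.\<close>
  have block: "p\<^sub>1 * q\<^sub>2 + r\<^sub>1 \<le> r\<^sub>1 * c\<^sub>2 + p\<^sub>1" "p\<^sub>2 * q\<^sub>1 + r\<^sub>2 \<le> r\<^sub>2 * c\<^sub>1 + p\<^sub>2"
  proof -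
    have *: "p * q + r \<le> r * c + p" if "p \<le> r" "q \<le> c" "1 \<le> c" for p q r c :: nat
    proof -
      from \<open>p \<le> r\<close> obtain k where k: "r = p + k" by (metis le_Suc_ex)
      have "p * q \<le> p * c" using that(2) by (rule mult_le_mono2)
      moreover have "k * 1 \<le> k * c" using that(3) by (rule mult_le_mono2)
      ultimately show ?thesis unfolding k add_mult_distrib by linarith
    qed
    from folded show "p\<^sub>1 * q\<^sub>2 + r\<^sub>1 \<le> r\<^sub>1 * c\<^sub>2 + p\<^sub>1" "p\<^sub>2 * q\<^sub>1 + r\<^sub>2 \<le> r\<^sub>2 * c\<^sub>1 + p\<^sub>2"
      using * by blast+
  qed
  have AB: "row_count A = r\<^sub>1 + r\<^sub>2" "col_count A = c\<^sub>1 + c\<^sub>2" "shared_rows A B = p\<^sub>1 + p\<^sub>2" "shared_cols A B = q\<^sub>1 + q\<^sub>2"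
    by (simp_all only: counts shared defs)
  note real' = real[unfolded realizable_def AB]
  \<comment> \<open>Dropping a column saves 2 if no column is shared, and
    \<open>2 - 2 * \<beta>\<close> if the number of shared columns drops as well.\<close>
  show False
  proof (cases "q\<^sub>1 + q\<^sub>2 = 0")
    case True
    have "M + N + (p\<^sub>1 + p\<^sub>2) * 0 \<le> (r\<^sub>1 + r\<^sub>2) * (c\<^sub>1 + c\<^sub>2 - 1) + row_count B * col_count B"
      using M' N' by linarith
    then have "realizable M N (r\<^sub>1 + r\<^sub>2) (c\<^sub>1 + c\<^sub>2 - 1) (row_count B) (col_count B) (p\<^sub>1 + p\<^sub>2) 0"
      using real' M' N' unfolding realizable_def by blast
    from min(6)[OF this] show False
      using folded True by (simp add: cost_of_def bubble_cost_def AB of_nat_diff)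
  next
    case False
    then obtain k where k: "q\<^sub>1 + q\<^sub>2 = Suc k" using not0_implies_Suc by blast
    obtain m where m: "c\<^sub>1 + c\<^sub>2 = Suc m" using folded by (metis Suc_le_D One_nat_def add_Suc)
    have "M + N + (p\<^sub>1 + p\<^sub>2) * (q\<^sub>1 + q\<^sub>2) + (r\<^sub>1 + r\<^sub>2) \<le> (r\<^sub>1 + r\<^sub>2) * (c\<^sub>1 + c\<^sub>2) + row_count B * col_count B + (p\<^sub>1 + p\<^sub>2)"
      using MN block by (simp add: algebra_simps)
    then have "M + N + (p\<^sub>1 + p\<^sub>2) * k \<le> (r\<^sub>1 + r\<^sub>2) * m + row_count B * col_count B"
      unfolding k m by simp
    moreover have "M \<le> (r\<^sub>1 + r\<^sub>2) * m" using M' by (simp add: m)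
    moreover have "k \<le> m" "k \<le> col_count B" using real' unfolding k m by auto
    ultimately have "realizable M N (r\<^sub>1 + r\<^sub>2) m (row_count B) (col_count B) (p\<^sub>1 + p\<^sub>2) k"
      using real' N' unfolding realizable_def by blast
    from min(6)[OF this] show False
      using \<beta> by (simp add: cost_of_def bubble_cost_def AB k m algebra_simps)
  qed
qed

lemma lattice_connected_Un:
  assumes "lattice_connected A" "lattice_connected B" "a \<in> A" "b \<in> B" "unit_dist a b"
  shows "lattice_connected (A \<union> B)"
proof -
  have A: "(u, v) \<in> (adj (A \<union> B))\<^sup>*" if "u \<in> A" "v \<in> A" for u v
    using that assms(1) adj_mono[of A "A \<union> B"] by (auto simp: lattice_connected_adj)
  have B: "(u, v) \<in> (adj (A \<union> B))\<^sup>*" if "u \<in> B" "v \<in> B" for u v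
    using that assms(2) adj_mono[of B "A \<union> B"] by (auto simp: lattice_connected_adj)
  have ab: "(a, b) \<in> adj (A \<union> B)" using assms by (auto simp: adj_def)
  have "(a, u) \<in> (adj (A \<union> B))\<^sup>*" if "u \<in> A \<union> B" for u
    using that A B assms(3,4) converse_rtrancl_into_rtrancl[OF ab] by blast
  then show ?thesis
    unfolding lattice_connected_adj by (meson adj_rtrancl_sym rtrancl_trans)
qed

text \<open>Without contact, convexity of the slices of the union excludes shared rows and columns.
  With \<open>q = 0\<close> the overlap is empty for every \<open>p\<close>, so \<open>p = 1\<close>
  is realizable and cheaper by \<open>2 * \<beta>\<close>.\<close>

lemma minimizer_contact:
  assumes \<beta>: "0 < \<beta>" "\<beta> < 1" and sol: "solves_double_bubble \<beta> M N A B" and "1 \<le> M" "1 \<le> N"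
  obtains a b where "a \<in> A" "b \<in> B" "unit_dist a b"
proof (rule ccontr)
  note min = minimizer_cost[OF \<beta> sol] and contact = that
  assume "\<not> thesis"
  then have none: "\<not> unit_dist a b" if "a \<in> A" "b \<in> B" for a b using contact that by blast
  have fin: "finite A" "finite B" "A \<inter> B = {}" "card A = M" "card B = N" "A \<noteq> {}" "B \<noteq> {}"
    using min(1) assms(4,5) by (auto simp: admissible_def)
  have real: "realizable M N (row_count A) (col_count A) (row_count B) (col_count B) (shared_rows A B) (shared_cols A B)"
    using realizable_of_sets[of A B] fin by simp
  have no_slice: False if conn: "lattice_connected V" and "V \<subseteq> A \<union> B" "V \<inter> A \<noteq> {}" "V \<inter> B \<noteq> {}" for V
  proof -
    note V = that
    obtain u v where "u \<in> V" "u \<in> A" "v \<in> V" "v \<in> B" "v \<notin> A" using V fin(3) by blast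
    then obtain s t where "s \<in> V" "t \<in> V" "s \<in> A" "t \<notin> A" "unit_dist s t"
      using lattice_connected_crossing[OF conn, of u v "\<lambda>s. s \<in> A"] by metis
    then show False using none V(2) by blast
  qed
  have "snd ` A \<inter> snd ` B = {}"
  proof (rule ccontr)
    assume "snd ` A \<inter> snd ` B \<noteq> {}"
    then obtain x x' z where "(x, z) \<in> A" "(x', z) \<in> B" by auto
    then show False
      using no_slice[OF lattice_connected_row[of "A \<union> B" z]] min(5) by (auto simp: hv_convex_def Row_def)
  qed
  moreover have "fst ` A \<inter> fst ` B = {}"
  proof (rule ccontr)
    assume "fst ` A \<inter> fst ` B \<noteq> {}"
    then obtain x x' z where "(z, x) \<in> A" "(z, x') \<in> B" by auto
    then show False
      using no_slice[OF lattice_connected_col[of "A \<union> B" z]] min(5) by (auto simp: hv_convex_def Col_def)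
  qed
  moreover have "row_count A \<ge> 1" "row_count B \<ge> 1" using fin by (simp_all add: Suc_le_eq card_gt_0_iff)
  ultimately have "realizable M N (row_count A) (col_count A) (row_count B) (col_count B) 1 0"
    using real by (simp add: realizable_def)
  from min(6)[OF this] show False
    using \<beta> \<open>snd ` A \<inter> snd ` B = {}\<close> \<open>fst ` A \<inter> fst ` B = {}\<close> by (simp add: cost_of_def bubble_cost_def)
qed

section \<open>Separation and the interface\<close>

text \<open>All that the geometric arguments use about a minimizer. The notion is stable under
  exchanging the sets, \<open>prod.swap\<close> and \<open>flip\<close>, so one orientation can be
  treated for all.\<close>

definition bubble_pair :: "site set \<Rightarrow> site set \<Rightarrow> bool" where
  "bubble_pair A B \<longleftrightarrow> A \<inter> B = {} \<and> hv_convex A \<and> hv_convex B \<and> hv_convex (A \<union> B) \<and>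
     lattice_connected A \<and> lattice_connected B"

lemma bubble_pair_commute: "bubble_pair A B \<Longrightarrow> bubble_pair B A"
  by (auto simp: bubble_pair_def Un_commute)

lemma bubble_pairD:
  assumes "bubble_pair A B"
  shows "A \<inter> B = {}" "row_convex A" "col_convex A" "row_convex B" "col_convex B"
    "row_convex (A \<union> B)" "col_convex (A \<union> B)" "lattice_connected A" "lattice_connected B"
  using assms by (auto simp: bubble_pair_def hv_convex_def)

lemma lattice_connected_image:
  assumes "lattice_connected V" "\<And>u v. unit_dist u v \<Longrightarrow> unit_dist (f u) (f v)"
  shows "lattice_connected (f ` V)"
proof -
  have "(f u, f v) \<in> (adj (f ` V))\<^sup>*" if "(u, v) \<in> (adj V)\<^sup>*" for u v
    using that
  proof (induction rule: rtrancl_induct)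
    case (step v w)
    then have "(f v, f w) \<in> adj (f ` V)" using assms(2) by (auto simp: adj_def)
    with step show ?case by (meson rtrancl_into_rtrancl)
  qed simp
  with assms(1) show ?thesis by (auto simp: lattice_connected_adj)
qed

lemma unit_dist_swap: "unit_dist (prod.swap u) (prod.swap v) \<longleftrightarrow> unit_dist u v"
  by (cases u; cases v) (auto simp: unit_dist_cases)

lemma row_convex_swap: "row_convex (prod.swap ` S) \<longleftrightarrow> col_convex S"
  and col_convex_swap': "col_convex (prod.swap ` S) \<longleftrightarrow> row_convex S"
  by (simp_all add: col_convex_swap image_image)

lemma bubble_pair_swap:
  assumes "bubble_pair A B"
  shows "bubble_pair (prod.swap ` A) (prod.swap ` B)"
  using assms lattice_connected_image[of A prod.swap] lattice_connected_image[of B prod.swap]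
  by (auto simp: bubble_pair_def hv_convex_def row_convex_swap col_convex_swap' unit_dist_swap
      simp flip: image_Un)

definition flip :: "site \<Rightarrow> site" where "flip = (\<lambda>(x, y). (x, - y))"

lemma flip_mem_image: "(a, b) \<in> flip ` S \<longleftrightarrow> (a, - b) \<in> S"
  by (force simp: flip_def)

lemma hv_convex_flip:
  assumes "hv_convex S"
  shows "hv_convex (flip ` S)"
proof -
  have "row_convex (flip ` S)" using assms unfolding hv_convex_def row_convex_def flip_mem_image by blast
  moreover have "col_convex (flip ` S)"
    unfolding col_convex_def flip_mem_image
  proof (intro allI impI)
    fix x a b c :: int assume "(x, - a) \<in> S" "(x, - c) \<in> S" "a \<le> b" "b \<le> c"
    then show "(x, - b) \<in> S"
      using assms col_convexD[of S x "- c" "- a" "- b"] by (auto simp: hv_convex_def)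
  qed
  ultimately show ?thesis by (simp add: hv_convex_def)
qed

lemma bubble_pair_flip:
  assumes "bubble_pair A B"
  shows "bubble_pair (flip ` A) (flip ` B)"
proof -
  have "unit_dist (flip u) (flip v)" if "unit_dist u v" for u v
    using that by (cases u; cases v) (auto simp: unit_dist_cases flip_def)
  moreover have "flip ` A \<inter> flip ` B = {}" using assms by (force simp: bubble_pair_def flip_def)
  ultimately show ?thesis
    using assms lattice_connected_image[of A flip] lattice_connected_image[of B flip]
      hv_convex_flip[of A] hv_convex_flip[of B] hv_convex_flip[of "A \<union> B"]
    by (auto simp: bubble_pair_def image_Un)
qed

section \<open>Order of the two sets along rows\<close>

lemma vertical_edge:
  assumes "lattice_connected V" "(a, y) \<in> V" "(b, z) \<in> V" "y \<le> t" "t < z"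
  obtains x where "(x, t) \<in> V" "(x, t + 1) \<in> V"
proof -
  have "snd (a, y) \<le> t" "\<not> snd (b, z) \<le> t" using assms(4,5) by simp_all
  from lattice_connected_crossing[where P = "\<lambda>s. snd s \<le> t", OF assms(1-3) this]
  obtain s s' where *: "s \<in> V" "s' \<in> V" "snd s \<le> t" "\<not> snd s' \<le> t" "unit_dist s s'"
    by blast
  then have "snd s = t" "snd s' = t + 1" "fst s' = fst s"
    by (cases s; cases s'; auto simp: unit_dist_cases)+
  with * that show thesis by (metis prod.collapse)
qed

lemma int_crossing:
  fixes a b :: int
  assumes "a < b" "P a" "\<not> P b"
  obtains x where "a \<le> x" "x < b" "P x" "\<not> P (x + 1)"
proof (rule ccontr)
  note witness = that
  assume "\<not> thesis"
  then have step: "P (x + 1)" if "a \<le> x" "x < b" "P x" for x using witness that by blast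
  have "x \<le> b \<longrightarrow> P x" if "a \<le> x" for x
    using that by (induction x rule: int_ge_induct) (use assms step in auto)
  with assms show False by auto
qed

text \<open>The first site outside \<open>A\<close> on the way from \<open>a\<close> to
  \<open>b\<close> belongs to the union by convexity, hence to \<open>B\<close>.\<close>

lemma row_adjacent:
  assumes "bubble_pair A B" "(a, y) \<in> A" "(b, y) \<in> B" "a < b"
  obtains x where "a \<le> x" "x < b" "(x, y) \<in> A" "(x + 1, y) \<in> B"
proof -
  note d = bubble_pairD[OF assms(1)]
  have "(b, y) \<notin> A" using assms d(1) by auto
  then obtain x where x: "a \<le> x" "x < b" "(x, y) \<in> A" "(x + 1, y) \<notin> A"
    using int_crossing[OF assms(4), of "\<lambda>x. (x, y) \<in> A"] assms(2) by metis
  have "(x + 1, y) \<in> A \<union> B"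
    by (rule row_convexD[OF d(6), of a y b]) (use assms x in auto)
  with x that show thesis by blast
qed

lemma row_order_same:
  assumes "bubble_pair A B" "(a, y) \<in> A" "(b, y) \<in> B" "a < b" "(a', y) \<in> A" "(b', y) \<in> B"
  shows "a' < b'"
proof (rule ccontr)
  note d = bubble_pairD[OF assms(1)]
  have ne: "(x, y) \<notin> B" if "(x, y) \<in> A" for x using that d(1) by auto
  assume "\<not> a' < b'"
  moreover have "\<not> b \<le> a'" using row_convexD[OF d(2) assms(2,5), of b] ne assms by auto
  moreover have "\<not> (b' \<le> a' \<and> a' \<le> b)" using row_convexD[OF d(4) assms(6,3), of a'] ne assms by auto
  ultimately show False by linarith
qed

text \<open>The order passes from a row to the next: \<open>A\<close> and \<open>B\<close> each have
  a vertical edge between the two rows, and the lower and the upper ends of these two edges are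
  ordered alike.\<close>

lemma row_order:
  assumes pair: "bubble_pair A B" and "(a, y) \<in> A" "(b, y) \<in> B" "a < b"
    and "(a', z) \<in> A" "(b', z) \<in> B"
  shows "a' < b'"
proof -
  note conn = bubble_pairD(8,9)[OF pair]
  have "\<forall>a' b'. (a', z) \<in> A \<longrightarrow> (b', z) \<in> B \<longrightarrow> a' < b'" if "y \<le> z" for z
    using that
  proof (induction z rule: int_ge_induct)
    case base
    then show ?case using row_order_same[OF pair assms(2-4)] by blast
  next
    case (step z)
    show ?case
    proof (intro allI impI)
      fix a' b' assume *: "(a', z + 1) \<in> A" "(b', z + 1) \<in> B"
      obtain v where v: "(v, z) \<in> A" "(v, z + 1) \<in> A"
        using vertical_edge[OF conn(1) assms(2) *(1)] step.hyps by auto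
      obtain w where w: "(w, z) \<in> B" "(w, z + 1) \<in> B"
        using vertical_edge[OF conn(2) assms(3) *(2)] step.hyps by auto
      from v w step.IH have "v < w" by blast
      then show "a' < b'" using row_order_same[OF pair v(2) w(2)] * by blast
    qed
  qed
  moreover have "\<forall>a' b'. (a', z) \<in> A \<longrightarrow> (b', z) \<in> B \<longrightarrow> a' < b'" if "z \<le> y" for z
    using that
  proof (induction z rule: int_le_induct)
    case base
    then show ?case using row_order_same[OF pair assms(2-4)] by blast
  next
    case (step z)
    show ?case
    proof (intro allI impI)
      fix a' b' assume *: "(a', z - 1) \<in> A" "(b', z - 1) \<in> B"
      obtain v where v: "(v, z - 1) \<in> A" "(v, z - 1 + 1) \<in> A"
        using vertical_edge[OF conn(1) *(1) assms(2), of "z - 1"] step.hyps by auto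
      obtain w where w: "(w, z - 1) \<in> B" "(w, z - 1 + 1) \<in> B"
        using vertical_edge[OF conn(2) *(2) assms(3), of "z - 1"] step.hyps by auto
      from v w step.IH have "v < w" by simp
      then show "a' < b'" using row_order_same[OF pair v(1) w(1)] * by blast
    qed
  qed
  ultimately show ?thesis using assms(5,6) by (metis linear)
qed

text \<open>The order in one row spreads to all rows; in each of them an adjacent pair lies between
  the maximum of \<open>A\<close> and the minimum of \<open>B\<close> and therefore consists of
  these two.\<close>

lemma row_separation:
  assumes pair: "bubble_pair A B" and fin: "finite A" "finite B"
  shows "separation (row_slice A) (row_slice B)"
  unfolding separation_def
proof (intro impI allI)
  have fin_slice: "finite (row_slice S z)" if "finite S" for S z
  proof -
    have "row_slice S z \<subseteq> fst ` S" by (force simp: row_slice_def)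
    then show ?thesis using that finite_subset by blast
  qed
  assume "\<exists>z. row_slice A z \<noteq> {} \<and> row_slice B z \<noteq> {} \<and> Max (row_slice A z) \<le> Min (row_slice B z) - 1"
  then obtain y where y: "row_slice A y \<noteq> {}" "row_slice B y \<noteq> {}" "Max (row_slice A y) < Min (row_slice B y)"
    by force
  then have y': "(Max (row_slice A y), y) \<in> A" "(Min (row_slice B y), y) \<in> B"
    using Max_in[OF fin_slice[OF fin(1)] y(1)] Min_in[OF fin_slice[OF fin(2)] y(2)]
    by (auto simp: row_slice_def)
  fix z assume z: "row_slice A z \<noteq> {} \<and> row_slice B z \<noteq> {}"
  define m n where "m = Max (row_slice A z)" and "n = Min (row_slice B z)"
  have mn: "(m, z) \<in> A" "(n, z) \<in> B"
    using Max_in[OF fin_slice[OF fin(1)]] Min_in[OF fin_slice[OF fin(2)]] z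
    unfolding m_def n_def by (auto simp: row_slice_def)
  then have "m < n" using row_order[OF pair y' y(3)] by blast
  then obtain x where x: "m \<le> x" "x < n" "(x, z) \<in> A" "(x + 1, z) \<in> B"
    using row_adjacent[OF pair mn] by blast
  have "x \<in> row_slice A z" "x + 1 \<in> row_slice B z" using x(3,4) by (simp_all add: row_slice_def)
  then have "x \<le> m" "n \<le> x + 1" unfolding m_def n_def using fin_slice fin by simp_all
  with x show "Max (row_slice A z) = Min (row_slice B z) - 1" by (simp add: m_def n_def)
qed

lemma col_separation:
  assumes "bubble_pair A B" "finite A" "finite B"
  shows "separation (col_slice A) (col_slice B)"
proof -
  have "col_slice S = row_slice (prod.swap ` S)" for S
    by (auto simp: col_slice_def row_slice_def fun_eq_iff swap_mem_image)
  then show ?thesis using row_separation[OF bubble_pair_swap[OF assms(1)]] assms(2,3) by simp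
qed

section \<open>Monotonicity of the interface\<close>

definition left_of :: "site set \<Rightarrow> site set \<Rightarrow> bool" where
  "left_of A B \<longleftrightarrow> (\<forall>a b y. (a, y) \<in> A \<longrightarrow> (b, y) \<in> B \<longrightarrow> a < b)"

definition below :: "site set \<Rightarrow> site set \<Rightarrow> bool" where
  "below A B \<longleftrightarrow> (\<forall>a b x. (x, a) \<in> A \<longrightarrow> (x, b) \<in> B \<longrightarrow> a < b)"

lemma left_of_swap: "left_of (prod.swap ` A) (prod.swap ` B) \<longleftrightarrow> below A B"
  and below_swap: "below (prod.swap ` A) (prod.swap ` B) \<longleftrightarrow> left_of A B"
  unfolding left_of_def below_def swap_mem_image by auto

text \<open>If no row is shared, both alternatives hold vacuously.\<close>

lemma left_of_cases:
  assumes "bubble_pair A B"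
  shows "left_of A B \<or> left_of B A"
proof (rule disjCI)
  assume "\<not> left_of B A"
  then obtain a b y where "(b, y) \<in> B" "(a, y) \<in> A" "a \<le> b" by (auto simp: left_of_def)
  moreover from this have "a \<noteq> b" using bubble_pairD(1)[OF assms] by auto
  ultimately show "left_of A B" unfolding left_of_def using row_order[OF assms, of a y b] by auto
qed

lemma below_cases:
  assumes "bubble_pair A B"
  shows "below A B \<or> below B A"
  using left_of_cases[OF bubble_pair_swap[OF assms]] by (simp add: left_of_swap)

text \<open>Row slices are intervals and consecutive ones have a column in common, so the slices at
  heights from \<open>s\<close> to \<open>t\<close> cover all columns between \<open>x\<close> and
  \<open>x'\<close>. The control of the height is what \<open>no_crossing_row\<close> relies
  on.\<close>

lemma connected_columns:
  assumes "lattice_connected V" "row_convex V" "(x, s) \<in> V" "(x', t) \<in> V" "s \<le> t"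
    and "min x x' \<le> u" "u \<le> max x x'"
  shows "\<exists>y. s \<le> y \<and> y \<le> t \<and> (u, y) \<in> V"
  using assms(5,4,6,7)
proof (induction t arbitrary: x' rule: int_ge_induct)
  case base
  have "(u, s) \<in> V"
    using row_convexD[OF assms(2), of x s x' u] row_convexD[OF assms(2), of x' s x u] base assms(3)
    by (auto simp: min_def max_def split: if_splits)
  then show ?case by auto
next
  case (step t)
  obtain w where w: "(w, t) \<in> V" "(w, t + 1) \<in> V"
    using vertical_edge[OF assms(1,3) step.prems(1), of t] step.hyps by auto
  consider "min x w \<le> u \<and> u \<le> max x w" | "w \<le> u \<and> u \<le> x' \<or> x' \<le> u \<and> u \<le> w"
    using step.prems(2,3) by linarith
  then show ?case
  proof cases
    case 1
    then obtain y where "s \<le> y" "y \<le> t" "(u, y) \<in> V" using step.IH[OF w(1)] by auto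
    then show ?thesis by (intro exI[of _ y]) auto
  next
    case 2
    then have "(u, t + 1) \<in> V"
      using row_convexD[OF assms(2), of x' "t + 1" w u] row_convexD[OF assms(2), of w "t + 1" x' u]
        step.prems(1) w(2) by auto
    then show ?thesis using step.hyps by (intro exI[of _ "t + 1"]) auto
  qed
qed

lemma connected_rows:
  assumes "lattice_connected V" "(a, y) \<in> V" "(b, z) \<in> V" "y \<le> t" "t \<le> z"
  shows "\<exists>x. (x, t) \<in> V"
proof (cases "t = z")
  case False
  then obtain x where "(x, t) \<in> V" using vertical_edge[OF assms(1-4)] assms(5) by auto
  then show ?thesis by blast
qed (use assms in blast)

text \<open>Some row \<open>t\<close> between \<open>y\<^sub>b\<close> and \<open>y\<^sub>a\<close>
  meets both sets, with \<open>A\<close> to the left. Above it \<open>A\<close> leads to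
  \<open>x\<^sub>a\<close>, below it \<open>B\<close> comes from \<open>x\<^sub>b\<close>; the
  columns swept by the two overlap, and in a common column \<open>B\<close> would not lie above
  \<open>A\<close>.\<close>

lemma no_crossing_row:
  assumes pair: "bubble_pair A B" and ord: "left_of A B" "below A B"
    and shared: "(\<alpha>, s) \<in> A" "(\<beta>, s) \<in> B"
    and ab: "(x\<^sub>a, y\<^sub>a) \<in> A" "(x\<^sub>b, y\<^sub>b) \<in> B" and le: "x\<^sub>b \<le> x\<^sub>a" "y\<^sub>b \<le> y\<^sub>a"
  shows False
proof -
  note d = bubble_pairD[OF pair]
  have "y\<^sub>b \<noteq> y\<^sub>a" using ord(1) ab le by (force simp: left_of_def)
  have "\<exists>t \<alpha> \<beta>. y\<^sub>b \<le> t \<and> t \<le> y\<^sub>a \<and> (\<alpha>, t) \<in> A \<and> (\<beta>, t) \<in> B"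
  proof -
    consider "y\<^sub>b \<le> s" "s \<le> y\<^sub>a" | "s < y\<^sub>b" | "y\<^sub>a < s" by linarith
    then show ?thesis
    proof cases
      case 1
      then show ?thesis using shared by blast
    next
      case 2
      then obtain x where "(x, y\<^sub>b) \<in> A" using connected_rows[OF d(8) shared(1) ab(1), of y\<^sub>b] le by auto
      then show ?thesis using ab le by blast
    next
      case 3
      then obtain x where "(x, y\<^sub>a) \<in> B" using connected_rows[OF d(9) ab(2) shared(2), of y\<^sub>a] le by auto
      then show ?thesis using ab le by blast
    qed
  qed
  then obtain t \<alpha> \<beta> where t: "y\<^sub>b \<le> t" "t \<le> y\<^sub>a" "(\<alpha>, t) \<in> A" "(\<beta>, t) \<in> B" by blast
  then have "\<alpha> < \<beta>" using ord by (auto simp: left_of_def)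
  \<comment> \<open>The larger of the two left ends; it belongs to both column ranges because
    \<open>\<alpha> < \<beta>\<close> and \<open>x\<^sub>b \<le> x\<^sub>a\<close>.\<close>
  define u where "u = max (min \<alpha> x\<^sub>a) (min x\<^sub>b \<beta>)"
  have u: "min \<alpha> x\<^sub>a \<le> u" "u \<le> max \<alpha> x\<^sub>a" "min x\<^sub>b \<beta> \<le> u" "u \<le> max x\<^sub>b \<beta>"
    using \<open>\<alpha> < \<beta>\<close> le by (auto simp: u_def)
  obtain y where y: "t \<le> y" "(u, y) \<in> A"
    using connected_columns[OF d(8,2) t(3) ab(1) t(2) u(1,2)] by auto
  obtain z where z: "z \<le> t" "(u, z) \<in> B"
    using connected_columns[OF d(9,4) ab(2) t(4) t(1) u(3,4)] by auto
  show False using ord(2) y z by (force simp: below_def)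
qed

text \<open>A contact provides a shared row or a shared column; the latter case is the former after
  \<open>prod.swap\<close>.\<close>

lemma no_crossing:
  assumes pair: "bubble_pair A B" and ord: "left_of A B" "below A B"
    and contact: "a \<in> A" "b \<in> B" "unit_dist a b"
    and ab: "(x\<^sub>a, y\<^sub>a) \<in> A" "(x\<^sub>b, y\<^sub>b) \<in> B" and le: "x\<^sub>b \<le> x\<^sub>a" "y\<^sub>b \<le> y\<^sub>a"
  shows False
proof -
  obtain a\<^sub>1 a\<^sub>2 b\<^sub>1 b\<^sub>2 where eq: "a = (a\<^sub>1, a\<^sub>2)" "b = (b\<^sub>1, b\<^sub>2)" by fastforce
  have "a\<^sub>2 = b\<^sub>2 \<or> a\<^sub>1 = b\<^sub>1" using contact(3) by (auto simp: eq unit_dist_cases)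
  then show False
  proof
    assume "a\<^sub>2 = b\<^sub>2"
    then show False using no_crossing_row[OF pair ord _ _ ab le] contact eq by blast
  next
    assume "a\<^sub>1 = b\<^sub>1"
    then show False
      using no_crossing_row[OF bubble_pair_swap[OF pair], of a\<^sub>2 a\<^sub>1 b\<^sub>2 y\<^sub>a x\<^sub>a y\<^sub>b x\<^sub>b] ord ab le contact eq
      by (simp add: left_of_swap below_swap swap_mem_image)
  qed
qed

lemma interface_iff:
  "p \<in> interface A B \<longleftrightarrow> (\<exists>a\<^sub>1 a\<^sub>2 b\<^sub>1 b\<^sub>2. (a\<^sub>1, a\<^sub>2) \<in> A \<and> (b\<^sub>1, b\<^sub>2) \<in> B \<and> unit_dist (a\<^sub>1, a\<^sub>2) (b\<^sub>1, b\<^sub>2) \<and>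
     p = ((real_of_int a\<^sub>1 + real_of_int b\<^sub>1) / 2, (real_of_int a\<^sub>2 + real_of_int b\<^sub>2) / 2))"
  by (auto simp: interface_def to_plane_def midpoint_def algebra_simps add_divide_distrib)

lemma interface_commute: "interface A B = interface B A"
proof -
  have "interface A B \<subseteq> interface B A" for A B
    unfolding interface_def by clarify (metis midpoint_sym unit_dist_commute)
  then show ?thesis by blast
qed

lemma finite_interface:
  assumes "finite A" "finite B"
  shows "finite (interface A B)"
proof (rule finite_subset)
  show "interface A B \<subseteq> (\<lambda>(a, b). midpoint (to_plane a) (to_plane b)) ` (A \<times> B)"
    by (auto simp: interface_def)
qed (use assms in simp)

text \<open>If \<open>A\<close> is also below \<open>B\<close> and two midpoints increased strictly
  in both coordinates, the \<open>B\<close> end of the first contact would lie weakly below and left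
  of the \<open>A\<close> end of the second, against \<open>no_crossing\<close>. The other vertical
  order is reflected by \<open>flip\<close>; \<open>\<sigma>\<close> records which of the two
  occurs.\<close>

lemma interface_chain_left:
  assumes pair: "bubble_pair A B" and left: "left_of A B"
  shows "\<exists>\<sigma>\<in>{1, - 1 :: real}. \<forall>p\<in>interface A B. \<forall>q\<in>interface A B. fst p < fst q \<longrightarrow> \<sigma> * snd p \<le> \<sigma> * snd q"
  using below_cases[OF pair]
proof
  assume below: "below A B"
  have "snd p \<ge> snd q" if "p \<in> interface A B" "q \<in> interface A B" "fst p < fst q" for p q
  proof (rule ccontr)
    assume "\<not> snd p \<ge> snd q"
    from that(1) obtain a\<^sub>1 a\<^sub>2 b\<^sub>1 b\<^sub>2 where p: "(a\<^sub>1, a\<^sub>2) \<in> A" "(b\<^sub>1, b\<^sub>2) \<in> B" "unit_dist (a\<^sub>1, a\<^sub>2) (b\<^sub>1, b\<^sub>2)"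
      "p = ((real_of_int a\<^sub>1 + real_of_int b\<^sub>1) / 2, (real_of_int a\<^sub>2 + real_of_int b\<^sub>2) / 2)"
      by (auto simp: interface_iff)
    from that(2) obtain c\<^sub>1 c\<^sub>2 d\<^sub>1 d\<^sub>2 where q: "(c\<^sub>1, c\<^sub>2) \<in> A" "(d\<^sub>1, d\<^sub>2) \<in> B" "unit_dist (c\<^sub>1, c\<^sub>2) (d\<^sub>1, d\<^sub>2)"
      "q = ((real_of_int c\<^sub>1 + real_of_int d\<^sub>1) / 2, (real_of_int c\<^sub>2 + real_of_int d\<^sub>2) / 2)"
      by (auto simp: interface_iff)
    have pq: "a\<^sub>1 + b\<^sub>1 < c\<^sub>1 + d\<^sub>1" "a\<^sub>2 + b\<^sub>2 < c\<^sub>2 + d\<^sub>2"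
      using that(3) \<open>\<not> snd p \<ge> snd q\<close> p(4) q(4) by simp_all
    have "b\<^sub>1 - a\<^sub>1 = 1 \<and> b\<^sub>2 - a\<^sub>2 = 0 \<or> b\<^sub>1 - a\<^sub>1 = 0 \<and> b\<^sub>2 - a\<^sub>2 = 1"
      using p(1-3) left below by (force simp: unit_dist_cases left_of_def below_def)
    moreover have "d\<^sub>1 - c\<^sub>1 = 1 \<and> d\<^sub>2 - c\<^sub>2 = 0 \<or> d\<^sub>1 - c\<^sub>1 = 0 \<and> d\<^sub>2 - c\<^sub>2 = 1"
      using q(1-3) left below by (force simp: unit_dist_cases left_of_def below_def)
    ultimately have "b\<^sub>1 \<le> c\<^sub>1" "b\<^sub>2 \<le> c\<^sub>2" using pq by linarith+
    then show False using no_crossing[OF pair left below p(1-3) q(1) p(2)] by blast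
  qed
  then show ?thesis by (intro bexI[of _ "- 1"]) auto
next
  assume above: "below B A"
  have flipped: "bubble_pair (flip ` A) (flip ` B)" "left_of (flip ` A) (flip ` B)" "below (flip ` A) (flip ` B)"
    using bubble_pair_flip[OF pair] left above unfolding left_of_def below_def flip_mem_image by force+
  have "snd p \<le> snd q" if "p \<in> interface A B" "q \<in> interface A B" "fst p < fst q" for p q
  proof (rule ccontr)
    assume "\<not> snd p \<le> snd q"
    from that(1) obtain a\<^sub>1 a\<^sub>2 b\<^sub>1 b\<^sub>2 where p: "(a\<^sub>1, a\<^sub>2) \<in> A" "(b\<^sub>1, b\<^sub>2) \<in> B" "unit_dist (a\<^sub>1, a\<^sub>2) (b\<^sub>1, b\<^sub>2)"
      "p = ((real_of_int a\<^sub>1 + real_of_int b\<^sub>1) / 2, (real_of_int a\<^sub>2 + real_of_int b\<^sub>2) / 2)"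
      by (auto simp: interface_iff)
    from that(2) obtain c\<^sub>1 c\<^sub>2 d\<^sub>1 d\<^sub>2 where q: "(c\<^sub>1, c\<^sub>2) \<in> A" "(d\<^sub>1, d\<^sub>2) \<in> B" "unit_dist (c\<^sub>1, c\<^sub>2) (d\<^sub>1, d\<^sub>2)"
      "q = ((real_of_int c\<^sub>1 + real_of_int d\<^sub>1) / 2, (real_of_int c\<^sub>2 + real_of_int d\<^sub>2) / 2)"
      by (auto simp: interface_iff)
    have pq: "a\<^sub>1 + b\<^sub>1 < c\<^sub>1 + d\<^sub>1" "a\<^sub>2 + b\<^sub>2 > c\<^sub>2 + d\<^sub>2"
      using that(3) \<open>\<not> snd p \<le> snd q\<close> p(4) q(4) by simp_all
    have "b\<^sub>1 - a\<^sub>1 = 1 \<and> b\<^sub>2 - a\<^sub>2 = 0 \<or> b\<^sub>1 - a\<^sub>1 = 0 \<and> b\<^sub>2 - a\<^sub>2 = - 1"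
      using p(1-3) left above by (force simp: unit_dist_cases left_of_def below_def)
    moreover have "d\<^sub>1 - c\<^sub>1 = 1 \<and> d\<^sub>2 - c\<^sub>2 = 0 \<or> d\<^sub>1 - c\<^sub>1 = 0 \<and> d\<^sub>2 - c\<^sub>2 = - 1"
      using q(1-3) left above by (force simp: unit_dist_cases left_of_def below_def)
    ultimately have "b\<^sub>1 \<le> c\<^sub>1" "- b\<^sub>2 \<le> - c\<^sub>2" using pq by linarith+
    moreover have "unit_dist (a\<^sub>1, - a\<^sub>2) (b\<^sub>1, - b\<^sub>2)" using p(3) by (auto simp: unit_dist_cases)
    ultimately show False
      using no_crossing[OF flipped, of "(a\<^sub>1, - a\<^sub>2)" "(b\<^sub>1, - b\<^sub>2)" c\<^sub>1 "- c\<^sub>2" b\<^sub>1 "- b\<^sub>2"] p q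
      by (simp add: flip_mem_image)
  qed
  then show ?thesis by (intro bexI[of _ 1]) auto
qed

lemma interface_chain:
  assumes "bubble_pair A B"
  shows "\<exists>\<sigma>\<in>{1, - 1 :: real}. \<forall>p\<in>interface A B. \<forall>q\<in>interface A B. fst p < fst q \<longrightarrow> \<sigma> * snd p \<le> \<sigma> * snd q"
  using left_of_cases[OF assms]
proof
  assume "left_of B A"
  then show ?thesis
    using interface_chain_left[OF bubble_pair_commute[OF assms]] by (simp only: interface_commute[of B A])
qed (rule interface_chain_left[OF assms])

section \<open>Neighbouring points of the interface\<close>

definition close_points :: "real \<times> real \<Rightarrow> real \<times> real \<Rightarrow> bool" where
  "close_points x y \<longleftrightarrow> norm (x - y) \<in> {1 / sqrt 2, 1}"

text \<open>The offsets that occur around the midpoint of a horizontal contact; vertical contacts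
  are transposed first.\<close>

lemma close_pointsI:
  assumes "\<bar>u - x\<bar> = 1 / 2 \<and> \<bar>v - y\<bar> = 1 / 2 \<or> u = x \<and> \<bar>v - y\<bar> = 1"
  shows "close_points (x, y) (u, v)"
proof -
  have half: "w\<^sup>2 = 1 / 4" if "\<bar>w\<bar> = 1 / 2" for w :: real
    by (subst power2_abs[symmetric]) (simp add: that power2_eq_square)
  show ?thesis using assms
  proof
    assume *: "\<bar>u - x\<bar> = 1 / 2 \<and> \<bar>v - y\<bar> = 1 / 2"
    then have "(x - u)\<^sup>2 = 1 / 4" "(y - v)\<^sup>2 = 1 / 4" by (simp_all add: half abs_minus_commute)
    then have "norm ((x, y) - (u, v)) = sqrt (1 / 2)" by (simp add: norm_Pair)
    then show ?thesis by (simp add: close_points_def real_sqrt_divide)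
  next
    assume "u = x \<and> \<bar>v - y\<bar> = 1"
    then show ?thesis by (simp add: close_points_def norm_Pair abs_minus_commute)
  qed
qed

lemma close_points_neq: "close_points x y \<Longrightarrow> y \<noteq> x"
  by (auto simp: close_points_def)

text \<open>Suppose there is no neighbour. Then in the two adjacent rows \<open>B\<close> stays
  right of column \<open>x\<close> and \<open>A\<close> left of column \<open>x + 1\<close>, so a
  shared adjacent row would have its contact straight above or below \<open>m\<close>, at distance
  1. Hence no adjacent row is shared, and connectedness leaves no place for a second
  contact.\<close>

lemma interface_neighbour_row:
  assumes pair: "bubble_pair A B" and e: "(x, y) \<in> A" "(x + 1, y) \<in> B"
    and m: "m = (real_of_int x + 1 / 2, real_of_int y)" and ne: "interface A B \<noteq> {m}"
  shows "\<exists>q\<in>interface A B. close_points m q"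
proof (rule ccontr)
  assume none: "\<not> ?thesis"
  note d = bubble_pairD[OF pair]
  have order: "a < b" if "(a, z) \<in> A" "(b, z) \<in> B" for a b z
    using row_order[OF pair e _ that] by simp
  \<comment> \<open>Doubled coordinates keep the case analysis within linear integer
    arithmetic.\<close>
  have near_m: "close_points m ((real_of_int p + real_of_int q) / 2, (real_of_int r + real_of_int s) / 2)"
    if "\<bar>p + q - 2 * x - 1\<bar> = 1 \<and> \<bar>r + s - 2 * y\<bar> = 1 \<or> p + q = 2 * x + 1 \<and> \<bar>r + s - 2 * y\<bar> = 2"
    for p q r s
  proof -
    have "real_of_int \<bar>p + q - 2 * x - 1\<bar> = 1 \<and> real_of_int \<bar>r + s - 2 * y\<bar> = 1 \<or>
      real_of_int (p + q) = real_of_int (2 * x + 1) \<and> real_of_int \<bar>r + s - 2 * y\<bar> = 2"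
      using that by (elim disjE conjE) (simp_all only: of_int_1 of_int_numeral simp_thms)
    then have "\<bar>real_of_int p + real_of_int q - 2 * real_of_int x - 1\<bar> = 1 \<and> \<bar>real_of_int r + real_of_int s - 2 * real_of_int y\<bar> = 1 \<or>
      real_of_int p + real_of_int q = 2 * real_of_int x + 1 \<and> \<bar>real_of_int r + real_of_int s - 2 * real_of_int y\<bar> = 2"
      by simp
    moreover have "(real_of_int p + real_of_int q) / 2 - (real_of_int x + 1 / 2) = (real_of_int p + real_of_int q - 2 * real_of_int x - 1) / 2"
      "(real_of_int r + real_of_int s) / 2 - real_of_int y = (real_of_int r + real_of_int s - 2 * real_of_int y) / 2"
      by (simp_all add: field_simps)
    ultimately show ?thesis
      unfolding m by (intro close_pointsI) (simp only: abs_divide, auto)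
  qed
  have excluded: False if "(a\<^sub>1, a\<^sub>2) \<in> A" "(b\<^sub>1, b\<^sub>2) \<in> B" "unit_dist (a\<^sub>1, a\<^sub>2) (b\<^sub>1, b\<^sub>2)"
    "\<bar>a\<^sub>1 + b\<^sub>1 - 2 * x - 1\<bar> = 1 \<and> \<bar>a\<^sub>2 + b\<^sub>2 - 2 * y\<bar> = 1 \<or> a\<^sub>1 + b\<^sub>1 = 2 * x + 1 \<and> \<bar>a\<^sub>2 + b\<^sub>2 - 2 * y\<bar> = 2"
    for a\<^sub>1 a\<^sub>2 b\<^sub>1 b\<^sub>2
  proof -
    have "((real_of_int a\<^sub>1 + real_of_int b\<^sub>1) / 2, (real_of_int a\<^sub>2 + real_of_int b\<^sub>2) / 2) \<in> interface A B"
      unfolding interface_iff using that(1-3) by blast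
    then show False using none near_m[OF that(4)] by blast
  qed
  have overlap: "\<exists>w. (w, y) \<in> V \<and> (w, z) \<in> V"
    if V: "lattice_connected V" "(u, z) \<in> V" "(v, y) \<in> V" "z = y + 1 \<or> z = y - 1" for V u v z
    using V(4)
  proof
    assume z: "z = y + 1"
    then have "y \<le> y" "y < z" by simp_all
    from vertical_edge[OF V(1,3,2) this] obtain w where "(w, y) \<in> V" "(w, y + 1) \<in> V" by blast
    then show ?thesis using z by blast
  next
    assume z: "z = y - 1"
    then have "z \<le> z" "z < y" by simp_all
    from vertical_edge[OF V(1,2,3) this] obtain w where "(w, z) \<in> V" "(w, z + 1) \<in> V" by blast
    then show ?thesis using z by auto
  qed
  \<comment> \<open>Otherwise \<open>B\<close> contains \<open>(x, z)\<close>, which forms with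
    \<open>(x, y)\<close> a contact at distance \<open>1 / sqrt 2\<close> from
    \<open>m\<close>.\<close>
  have B_right: "x < u" if z: "z = y + 1 \<or> z = y - 1" and u: "(u, z) \<in> B" for u z
  proof (rule ccontr)
    assume "\<not> x < u"
    obtain w where w: "(w, y) \<in> B" "(w, z) \<in> B" using overlap[OF d(9) u e(2) z] by blast
    then have "x < w" using order[OF e(1)] by blast
    then have "(x, z) \<in> B" using row_convexD[OF d(4) u w(2), of x] \<open>\<not> x < u\<close> by simp
    then show False
      using z by (intro excluded[OF e(1)]) (auto simp: unit_dist_cases)
  qed
  have A_left: "u < x + 1" if z: "z = y + 1 \<or> z = y - 1" and u: "(u, z) \<in> A" for u z
  proof (rule ccontr)
    assume "\<not> u < x + 1"
    obtain w where w: "(w, y) \<in> A" "(w, z) \<in> A" using overlap[OF d(8) u e(1) z] by blast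
    then have "w < x + 1" using order[OF _ e(2)] by blast
    then have "(x + 1, z) \<in> A" using row_convexD[OF d(2) w(2) u, of "x + 1"] \<open>\<not> u < x + 1\<close> by simp
    then show False
      using z by (intro excluded[OF _ e(2)]) (auto simp: unit_dist_cases)
  qed
  have not_shared: False if z: "z = y + 1 \<or> z = y - 1" and u: "(u, z) \<in> A" "(v, z) \<in> B" for u v z
  proof -
    from row_adjacent[OF pair u order[OF u]]
    obtain w where w: "u \<le> w" "w < v" "(w, z) \<in> A" "(w + 1, z) \<in> B" by blast
    have "w = x" using B_right[OF z w(4)] A_left[OF z w(3)] by simp
    then show False
      using z w by (intro excluded[OF w(3,4)]) (auto simp: unit_dist_cases)
  qed
  have "m \<in> interface A B"
    unfolding interface_iff using e by (intro exI[of _ x] exI[of _ y] exI[of _ "x + 1"]) (auto simp: m unit_dist_cases)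
  with ne obtain q where q: "q \<in> interface A B" "q \<noteq> m" by blast
  then obtain a\<^sub>1 a\<^sub>2 b\<^sub>1 b\<^sub>2 where ab: "(a\<^sub>1, a\<^sub>2) \<in> A" "(b\<^sub>1, b\<^sub>2) \<in> B" "unit_dist (a\<^sub>1, a\<^sub>2) (b\<^sub>1, b\<^sub>2)"
    and q': "q = ((real_of_int a\<^sub>1 + real_of_int b\<^sub>1) / 2, (real_of_int a\<^sub>2 + real_of_int b\<^sub>2) / 2)"
    unfolding interface_iff by blast
  have near: "b\<^sub>2 = a\<^sub>2 \<or> a\<^sub>1 = b\<^sub>1 \<and> (b\<^sub>2 = a\<^sub>2 + 1 \<or> b\<^sub>2 = a\<^sub>2 - 1)" using ab(3) by (auto simp: unit_dist_cases)
  \<comment> \<open>Both ends above row \<open>y\<close>, both below it, both in it, or exactly one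
    in it. In the third case the contact is the one defining \<open>m\<close>.\<close>
  consider "a\<^sub>2 > y" "b\<^sub>2 > y" | "a\<^sub>2 < y" "b\<^sub>2 < y" | "a\<^sub>2 = y" "b\<^sub>2 = y"
    | "a\<^sub>2 = y" "b\<^sub>2 = y + 1 \<or> b\<^sub>2 = y - 1" "a\<^sub>1 = b\<^sub>1" | "b\<^sub>2 = y" "a\<^sub>2 = y + 1 \<or> a\<^sub>2 = y - 1" "a\<^sub>1 = b\<^sub>1"
    using near by linarith
  then show False
  proof cases
    case 1
    then obtain u v where "(u, y + 1) \<in> A" "(v, y + 1) \<in> B"
      using connected_rows[OF d(8) e(1) ab(1), of "y + 1"] connected_rows[OF d(9) e(2) ab(2), of "y + 1"] by auto
    then show False using not_shared[of "y + 1"] by blast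
  next
    case 2
    then obtain u v where "(u, y - 1) \<in> A" "(v, y - 1) \<in> B"
      using connected_rows[OF d(8) ab(1) e(1), of "y - 1"] connected_rows[OF d(9) ab(2) e(2), of "y - 1"] by auto
    then show False using not_shared[of "y - 1"] by blast
  next
    case 3
    have "a\<^sub>1 < b\<^sub>1" "a\<^sub>1 < x + 1" "x < b\<^sub>1" using order ab(1,2) e 3 by blast+
    moreover have "\<bar>b\<^sub>1 - a\<^sub>1\<bar> = 1" using ab(3) 3 by (auto simp: unit_dist_cases)
    ultimately have "a\<^sub>1 = x" "b\<^sub>1 = x + 1" by linarith+
    with q(2) 3 show False by (simp add: q' m field_simps)
  next
    case 4
    then have "x < a\<^sub>1" using B_right ab(2) by blast
    moreover have "a\<^sub>1 < x + 1" using order ab(1) e(2) 4 by blast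
    ultimately show False by simp
  next
    case 5
    then have "a\<^sub>1 < x + 1" using A_left ab(1) by blast
    moreover have "x < a\<^sub>1" using order e(1) ab(2) 5 by blast
    ultimately show False by simp
  qed
qed

lemma interface_swap: "interface (prod.swap ` A) (prod.swap ` B) = prod.swap ` interface A B"
proof -
  have "(v, u) \<in> interface (prod.swap ` A) (prod.swap ` B) \<longleftrightarrow> (u, v) \<in> interface A B" for u v
    unfolding interface_iff swap_mem_image unit_dist_cases by (auto; metis)
  then show ?thesis by force
qed

lemma close_points_swap: "close_points (prod.swap x) (prod.swap y) \<longleftrightarrow> close_points x y"
  by (cases x; cases y) (simp add: close_points_def norm_Pair add.commute)

lemma interface_neighbour:
  assumes pair: "bubble_pair A B" and p: "p \<in> interface A B" and ne: "interface A B \<noteq> {p}"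
  shows "\<exists>q\<in>interface A B - {p}. norm (p - q) \<in> {1 / sqrt 2, 1}"
proof -
  obtain a\<^sub>1 a\<^sub>2 b\<^sub>1 b\<^sub>2 where ab: "(a\<^sub>1, a\<^sub>2) \<in> A" "(b\<^sub>1, b\<^sub>2) \<in> B" "unit_dist (a\<^sub>1, a\<^sub>2) (b\<^sub>1, b\<^sub>2)"
    and p': "p = ((real_of_int a\<^sub>1 + real_of_int b\<^sub>1) / 2, (real_of_int a\<^sub>2 + real_of_int b\<^sub>2) / 2)"
    using p unfolding interface_iff by blast
  note pair' = bubble_pair_commute[OF pair]
  have ne': "interface (prod.swap ` A) (prod.swap ` B) \<noteq> {prod.swap p}"
    using ne unfolding interface_swap by (metis image_insert image_empty inj_image_eq_iff inj_swap)
  have swap: "\<exists>q\<in>interface A B. close_points p q"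
    if "\<exists>q\<in>interface (prod.swap ` A) (prod.swap ` B). close_points (prod.swap p) q"
    using that unfolding interface_swap by (auto simp: close_points_swap simp del: swap_simp)
  consider "b\<^sub>1 = a\<^sub>1 + 1" "b\<^sub>2 = a\<^sub>2" | "a\<^sub>1 = b\<^sub>1 + 1" "b\<^sub>2 = a\<^sub>2" | "b\<^sub>2 = a\<^sub>2 + 1" "a\<^sub>1 = b\<^sub>1" | "a\<^sub>2 = b\<^sub>2 + 1" "a\<^sub>1 = b\<^sub>1"
    using ab(3) unfolding unit_dist_cases by linarith
  then have "\<exists>q\<in>interface A B. close_points p q"
  proof cases
    case 1
    then show ?thesis
      using ab ne by (intro interface_neighbour_row[OF pair, of a\<^sub>1 a\<^sub>2]) (auto simp: p' field_simps)
  next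
    case 2
    then have "\<exists>q\<in>interface B A. close_points p q"
      using ab ne by (intro interface_neighbour_row[OF pair', of b\<^sub>1 b\<^sub>2])
        (auto simp: p' field_simps interface_commute[of B A])
    then show ?thesis by (simp add: interface_commute[of B A])
  next
    case 3
    then show ?thesis
      using ab ne' by (intro swap interface_neighbour_row[OF bubble_pair_swap[OF pair], of a\<^sub>2 a\<^sub>1])
        (auto simp: p' field_simps swap_mem_image)
  next
    case 4
    then have "\<exists>q\<in>interface (prod.swap ` B) (prod.swap ` A). close_points (prod.swap p) q"
      using ab ne' by (intro interface_neighbour_row[OF bubble_pair_swap[OF pair'], of b\<^sub>2 b\<^sub>1])
        (auto simp: p' field_simps swap_mem_image interface_commute[of "prod.swap ` B"])
    then show ?thesis by (intro swap) (simp only: interface_commute[of "prod.swap ` B"])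
  qed
  then obtain q where "q \<in> interface A B" "close_points p q" by blast
  then show ?thesis using close_points_neq[of p q] unfolding close_points_def by blast
qed

section \<open>A monotone polyline through a finite chain\<close>

definition clamp_unit :: "real \<Rightarrow> real" where
  "clamp_unit x = max 0 (min 1 x)"

text \<open>Truncating each increment separately makes continuity and monotonicity of the polyline
  termwise statements.\<close>

definition polyline :: "nat \<Rightarrow> (nat \<Rightarrow> real \<times> real) \<Rightarrow> real \<Rightarrow> real \<times> real" where
  "polyline n p s = p 0 + (\<Sum>i<n. clamp_unit (real n * s - real i) *\<^sub>R (p (Suc i) - p i))"

lemma polyline_piece:
  assumes k: "k < n" and s: "real k \<le> real n * s" "real n * s \<le> real (Suc k)"
  shows "polyline n p s = p k + (real n * s - real k) *\<^sub>R (p (Suc k) - p k)"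
proof -
  let ?f = "\<lambda>i. clamp_unit (real n * s - real i) *\<^sub>R (p (Suc i) - p i)"
  have before: "?f i = p (Suc i) - p i" if "i < k" for i
    using that s(1) by (simp add: clamp_unit_def min_def max_def)
  have after: "?f i = 0" if "i > k" for i
    using that s(2) by (simp add: clamp_unit_def min_def max_def)
  have "{..<n} = {..<k} \<union> ({k} \<union> {k<..<n})" using k by auto
  then have "(\<Sum>i<n. ?f i) = (\<Sum>i<k. ?f i) + (?f k + (\<Sum>i\<in>{k<..<n}. ?f i))"
    by (simp only:) (subst sum.union_disjoint; force simp: sum.union_disjoint)
  also have "(\<Sum>i<k. ?f i) = p k - p 0" using before by (simp add: sum_lessThan_telescope)
  also have "(\<Sum>i\<in>{k<..<n}. ?f i) = 0" using after by (intro sum.neutral) auto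
  also have "?f k = (real n * s - real k) *\<^sub>R (p (Suc k) - p k)"
    using s by (simp add: clamp_unit_def min_def max_def)
  finally show ?thesis by (simp add: polyline_def)
qed

lemma piecewise_affine_polyline:
  assumes "n > 0"
  shows "piecewise_affine_path (polyline n p)"
  unfolding piecewise_affine_path_def
proof
  show "path (polyline n p)"
    unfolding path_def polyline_def[abs_def] clamp_unit_def by (intro continuous_intros)
  show "\<exists>(m::nat) t. t 0 = 0 \<and> t m = 1 \<and> (\<forall>i<m. t i < t (Suc i)) \<and>
      (\<forall>i<m. \<exists>a v. \<forall>s\<in>{t i..t (Suc i)}. polyline n p s = a + s *\<^sub>R v)"
  proof (intro exI[of _ n] exI[of _ "\<lambda>i. real i / real n"] conjI allI impI)
    fix i assume i: "i < n"
    show "\<exists>a v. \<forall>s\<in>{real i / real n..real (Suc i) / real n}. polyline n p s = a + s *\<^sub>R v"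
    proof (intro exI ballI)
      fix s assume "s \<in> {real i / real n..real (Suc i) / real n}"
      then have "real i \<le> real n * s" "real n * s \<le> real (Suc i)"
        using assms by (simp_all add: field_simps)
      then show "polyline n p s = (p i - real i *\<^sub>R (p (Suc i) - p i)) + s *\<^sub>R (real n *\<^sub>R (p (Suc i) - p i))"
        using polyline_piece[OF i] by (simp add: algebra_simps)
    qed
  qed (use assms in \<open>auto simp: divide_strict_right_mono\<close>)
qed

lemma polyline_vertex:
  assumes "k < n"
  shows "p k \<in> path_image (polyline n p)"
proof -
  have "polyline n p (real k / real n) = p k" using assms by (subst polyline_piece[of k]) auto
  moreover have "real k / real n \<in> {0..1}" using assms by simp
  ultimately show ?thesis unfolding path_image_def by (metis imageI)
qed

lemma clamp_unit_mono: "x \<le> y \<Longrightarrow> clamp_unit x \<le> clamp_unit y"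
  by (auto simp: clamp_unit_def min_def max_def)

lemma polyline_coordinate:
  assumes "linear L"
  shows "L (polyline n p s) = L (p 0) + (\<Sum>i<n. clamp_unit (real n * s - real i) * (L (p (Suc i)) - L (p i)) :: real)"
  using assms by (simp add: polyline_def linear_add linear_sum linear_scale linear_diff)

lemma polyline_mono:
  fixes L :: "real \<times> real \<Rightarrow> real"
  assumes "linear L" "\<And>i. i < n \<Longrightarrow> L (p i) \<le> L (p (Suc i))"
  shows "s \<le> t \<Longrightarrow> L (polyline n p s) \<le> L (polyline n p t)"
  unfolding polyline_coordinate[OF assms(1)]
  by (intro add_left_mono sum_mono mult_right_mono clamp_unit_mono diff_right_mono mult_left_mono)
     (use assms(2) in auto)

lemma chain_in_monotone_path:
  fixes S :: "(real \<times> real) set"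
  assumes "finite S" "\<sigma> \<in> {1, - 1 :: real}"
    and chain: "\<And>p q. p \<in> S \<Longrightarrow> q \<in> S \<Longrightarrow> fst p < fst q \<Longrightarrow> \<sigma> * snd p \<le> \<sigma> * snd q"
  shows "\<exists>\<iota>. piecewise_affine_path \<iota> \<and> monotone_on_unit (\<lambda>t. fst (\<iota> t)) \<and>
    monotone_on_unit (\<lambda>t. snd (\<iota> t)) \<and> S \<subseteq> path_image \<iota>"
proof -
  \<comment> \<open>On a chain, sorting by this sum sorts by both coordinates
    simultaneously.\<close>
  define key where "key p = fst p + \<sigma> * snd p" for p :: "real \<times> real"
  obtain xs where xs: "set xs = S" "sorted (map key xs)"
    using finite_list[OF assms(1)] by (metis set_sort sorted_sort_key)
  have order: "fst p \<le> fst q \<and> \<sigma> * snd p \<le> \<sigma> * snd q" if "p \<in> S" "q \<in> S" "key p \<le> key q" for p q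
    using chain[OF that(1,2)] chain[OF that(2,1)] that(3)
    by (cases "fst p" "fst q" rule: linorder_cases) (auto simp: key_def)
  \<comment> \<open>One more than the number of points: \<open>n\<close> is positive even for an
    empty interface, and every point gets an index below \<open>n\<close>, as
    \<open>polyline_vertex\<close> requires. Beyond the last point the polyline stands
    still.\<close>
  define n where "n = Suc (length xs)"
  define p where "p i = (if xs = [] then 0 else xs ! min i (length xs - 1))" for i
  have step: "fst (p i) \<le> fst (p (Suc i)) \<and> \<sigma> * snd (p i) \<le> \<sigma> * snd (p (Suc i))" for i
  proof (cases "xs = []")
    case False
    let ?i = "min i (length xs - 1)" and ?j = "min (Suc i) (length xs - 1)"
    have "?i \<le> ?j" "?j < length xs" using False by (auto simp: min_def)
    then have "key (xs ! ?i) \<le> key (xs ! ?j)"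
      using sorted_nth_mono[OF xs(2), of ?i ?j] by simp
    moreover have "xs ! ?i \<in> S" "xs ! ?j \<in> S"
      unfolding xs(1)[symmetric] using \<open>?i \<le> ?j\<close> \<open>?j < length xs\<close> by (intro nth_mem; linarith)+
    ultimately show ?thesis using order[of "xs ! ?i" "xs ! ?j"] False by (simp add: p_def)
  qed (simp add: p_def)
  have "linear (\<lambda>z :: real \<times> real. \<sigma> * snd z)" "linear (fst :: real \<times> real \<Rightarrow> real)"
    by (auto intro!: linearI simp: algebra_simps)
  then have mono: "fst (polyline n p s) \<le> fst (polyline n p t)"
    "\<sigma> * snd (polyline n p s) \<le> \<sigma> * snd (polyline n p t)" if "s \<le> t" for s t
    using polyline_mono[of fst n p s t] polyline_mono[of "\<lambda>z. \<sigma> * snd z" n p s t] step that by auto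
  have "monotone_on_unit (\<lambda>t. fst (polyline n p t))"
    using mono(1) by (auto simp: monotone_on_unit_def mono_on_def)
  moreover have "monotone_on_unit (\<lambda>t. snd (polyline n p t))"
    using mono(2) assms(2) by (auto simp: monotone_on_unit_def monotone_on_def)
  moreover have "S \<subseteq> path_image (polyline n p)"
  proof
    fix z assume "z \<in> S"
    then obtain i where "i < length xs" "xs ! i = z" using xs(1) by (metis in_set_conv_nth)
    then have "i < n" "p i = z" by (auto simp: n_def p_def)
    then show "z \<in> path_image (polyline n p)" using polyline_vertex by metis
  qed
  moreover have "piecewise_affine_path (polyline n p)"
    by (rule piecewise_affine_polyline) (simp add: n_def)
  ultimately show ?thesis by blast
qed

section \<open>Equal cardinalities: the minimal perimeter\<close>

lemma height_energy_le:
  assumes "1 \<le> h" "N \<le> h * L"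
  shows "height_energy \<beta> N h \<le> 4 * real L + 2 * real h * (2 - \<beta>)"
proof -
  have "real N \<le> real h * real L" using assms(2) by (simp flip: of_nat_mult)
  then have "real N / real h \<le> real L" using assms(1) by (simp add: divide_simps mult.commute)
  then have "\<lceil>real N / real h\<rceil> \<le> int L" by (simp add: ceiling_le_iff)
  then have "real_of_int \<lceil>real N / real h\<rceil> \<le> real L" by linarith
  then show ?thesis by (simp add: height_energy_def)
qed

text \<open>The hypothesis says \<open>L - 1 < N / h\<close> without truncated subtraction, that is,
  \<open>L\<close> is at most the ceiling.\<close>

lemma height_energy_ge:
  assumes "1 \<le> h" "h * L < N + h"
  shows "4 * real L + 2 * real h * (2 - \<beta>) \<le> height_energy \<beta> N h"
proof -
  have "real h * real L < real N + real h" using assms(2) by (simp flip: of_nat_mult of_nat_add)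
  then have "real L - 1 < real N / real h" using assms(1) by (simp add: field_simps)
  then have "int L \<le> \<lceil>real N / real h\<rceil>" by linarith
  then have "real L \<le> real_of_int \<lceil>real N / real h\<rceil>" by linarith
  then show ?thesis by (simp add: height_energy_def)
qed

lemma realizable_commute: "realizable M N ra ca rb cb p q \<longleftrightarrow> realizable N M rb cb ra ca p q"
  by (auto simp: realizable_def ac_simps)

lemma bubble_cost_commute: "bubble_cost \<beta> ra ca rb cb p q = bubble_cost \<beta> rb cb ra ca p q"
  by (simp add: bubble_cost_def)

text \<open>Since \<open>2 * p \<le> ra + rb\<close>, twice the cost is at least the sum of the
  height energies of \<open>ra\<close> and \<open>rb\<close>, so the smaller of these is at most the
  cost.\<close>

lemma cost_ge_no_shared_cols:
  assumes \<beta>: "0 < \<beta>" and N: "1 \<le> N" and real: "realizable N N ra ca rb cb p 0"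
  shows "\<exists>h\<ge>1. height_energy \<beta> N h \<le> bubble_cost \<beta> ra ca rb cb p 0"
proof -
  note r = real[unfolded realizable_def]
  have pos: "1 \<le> ra" "1 \<le> rb" using r N by (auto simp: Suc_le_eq intro: Nat.gr0I)
  have "height_energy \<beta> N ra \<le> 4 * real ca + 2 * real ra * (2 - \<beta>)"
    "height_energy \<beta> N rb \<le> 4 * real cb + 2 * real rb * (2 - \<beta>)"
    using r pos by (auto intro: height_energy_le)
  moreover have "\<beta> * (2 * real p) \<le> \<beta> * (real ra + real rb)"
    using r \<beta> by (intro mult_left_mono) auto
  ultimately have "height_energy \<beta> N ra + height_energy \<beta> N rb \<le> 2 * bubble_cost \<beta> ra ca rb cb p 0"
    by (simp add: bubble_cost_def algebra_simps)
  then have "height_energy \<beta> N ra \<le> bubble_cost \<beta> ra ca rb cb p 0 \<or> height_energy \<beta> N rb \<le> bubble_cost \<beta> ra ca rb cb p 0"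
    by linarith
  then show ?thesis using pos by blast
qed

text \<open>As long as some columns are shared, the parameters either yield
  a competitor height directly or can be changed, at no cost, so that \<open>q\<close> drops (or \<open>q\<close> stays and the
  total height drops). The assumption \<open>\<beta> \<le> 1 / 2\<close> enters because deleting one column pays for two lost
  shared columns.\<close>

lemma cost_descent_step:
  assumes \<beta>: "0 < \<beta>" "\<beta> \<le> 1 / 2" and N: "1 \<le> N"
    and real: "realizable N N a c b y p q" and q: "1 \<le> q" "q \<le> p" and ab: "a \<le> b"
  shows "(\<exists>h\<ge>1. height_energy \<beta> N h \<le> bubble_cost \<beta> a c b y p q) \<or>
    (\<exists>a' c' b' y' p' q'. realizable N N a' c' b' y' p' q' \<and> q' \<le> p' \<and>
       bubble_cost \<beta> a' c' b' y' p' q' \<le> bubble_cost \<beta> a c b y p q \<and> (q' < q \<or> q' = q \<and> a' + b' < a + b))"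
    (is "_ \<or> ?descent")
proof -
  have r: "N \<le> a * c" "N \<le> b * y" "N + N + p * q \<le> a * c + b * y" "p \<le> a" "p \<le> b" "q \<le> c" "q \<le> y"
    using real by (auto simp: realizable_def)
  have descent: ?descent if "realizable N N a' c' b' y' p' q'" "q' \<le> p'"
    "bubble_cost \<beta> a' c' b' y' p' q' \<le> bubble_cost \<beta> a c b y p q" "q' < q \<or> q' = q \<and> a' + b' < a + b"
    for a' c' b' y' p' q' using that by blast
  obtain k where k: "q = Suc k" using q(1) by (cases q) auto
  consider "p < a" | "p = a" "a < b" "y < b" | "p = a" "a < b" "b \<le> y" | "p = a" "a = b"
    using r(4) ab by linarith
  then show ?thesis
  proof cases
    case 1
    \<comment> \<open>Trading a shared column for a shared row keeps the cost and does not enlarge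
      the overlap, because \<open>q \<le> p\<close>.\<close>
    have "(p + 1) * k \<le> p * q" using q(2) by (simp add: k)
    then have "realizable N N a c b y (p + 1) k"
      unfolding realizable_def using r 1 k ab by linarith
    note R = this
    show ?thesis by (rule disjI2, rule descent[OF R]) (use q in \<open>auto simp: k bubble_cost_def algebra_simps\<close>)
  next
    case 2
    obtain m where m: "b = Suc m" using 2(2) by (cases b) auto
    \<comment> \<open>The second box is too tall: exchanging a row that is not shared for a column
      keeps the cost and loses no area, because \<open>y < b\<close>.\<close>
    have "b * y \<le> m * (y + 1)" using 2 by (simp add: m)
    then have "realizable N N a c m (y + 1) p q"
      unfolding realizable_def using r 2 m by linarith
    note R = this
    show ?thesis by (rule disjI2, rule descent[OF R]) (use q in \<open>auto simp: m bubble_cost_def algebra_simps\<close>)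
  next
    case 3
    obtain d where d: "c = Suc d" using r(6) k by (cases c) auto
    show ?thesis
    proof (cases "N \<le> (a + 1) * d")
      case True
      have "k \<le> d" using r(6) by (simp add: k d)
      then obtain e where e: "d = k + e" by (metis le_Suc_ex)
      \<comment> \<open>The first box exchanges a shared column for a row, shared as well since
        \<open>a < b\<close>. Its part outside the overlap grows from \<open>a * (c - q)\<close> to
        \<open>(a + 1) * (c - q)\<close>.\<close>
      have "N + N + (a + 1) * k \<le> (a + 1) * d + b * y"
        using r(3) unfolding \<open>p = a\<close> d k e by (simp add: algebra_simps)
      then have "realizable N N (a + 1) d b y (a + 1) k"
        unfolding realizable_def using r 3 True k d by linarith
      note R = this
      show ?thesis by (rule disjI2, rule descent[OF R]) (use q 3 in \<open>auto simp: k d bubble_cost_def algebra_simps\<close>)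
    next
      case False
      then have "c \<le> a" using r(1) by (simp add: d)
      have Nab: "N \<le> b * z" if "a \<le> z" for z
      proof -
        have "a * c \<le> b * z" using \<open>c \<le> a\<close> that ab by (intro mult_le_mono) auto
        with r(1) show ?thesis by linarith
      qed
      \<comment> \<open>Half of \<open>q\<close>, rounded up: deleting \<open>j\<close> columns of
        the second box pays for giving up all shared columns, since
        \<open>\<beta> \<le> 1 / 2\<close>.\<close>
      define j where "j = (q + 1) div 2"
      have j: "q \<le> 2 * j" "2 * j \<le> q + 1" "j \<le> q" using q(1) by (auto simp: j_def)
      show ?thesis
      proof (cases "N \<le> b * (y - j)")
        case True
        then have "realizable N N a c b (y - j) p 0" unfolding realizable_def using r by linarith
        moreover have "bubble_cost \<beta> a c b (y - j) p 0 \<le> bubble_cost \<beta> a c b y p q"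
        proof -
          have "\<beta> * real q \<le> (1 / 2) * real q" using \<beta> by (intro mult_right_mono) auto
          also have "\<dots> \<le> real j" using j(1) by simp
          finally show ?thesis using j r(7) by (simp add: bubble_cost_def of_nat_diff algebra_simps)
        qed
        ultimately show ?thesis using descent[of a c b "y - j" p 0] q by auto
      next
        case False
        then have "\<not> a \<le> y - j" using Nab by blast
        \<comment> \<open>From \<open>y - j < a\<close> one gets
          \<open>b \<le> y < a + j \<le> a + c \<le> 2 * a\<close>.\<close>
        then have "2 \<le> q" "b \<le> 2 * a" using 3 j r(6) \<open>c \<le> a\<close> by linarith+
        obtain i where i: "q = i + 2" using \<open>2 \<le> q\<close> by (metis le_add_diff_inverse2)
        obtain z where z: "y = Suc z" using r(7) k by (cases y) auto
        \<comment> \<open>One column of the second box and two shared columns disappear; the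
          \<open>b\<close> cells lost are made up by the overlap, smaller by
          \<open>2 * a\<close>.\<close>
        have "N + N + a * i \<le> a * c + b * z"
          using r(3) \<open>b \<le> 2 * a\<close> unfolding \<open>p = a\<close> i z by (simp add: algebra_simps)
        moreover have "N \<le> b * z" using Nab 3 z by simp
        ultimately have "realizable N N a c b z p i"
          unfolding realizable_def using r 3 i z by auto
        note R = this
        show ?thesis by (rule disjI2, rule descent[OF R]) (use q \<beta> in \<open>auto simp: i z bubble_cost_def algebra_simps\<close>)
      qed
    qed
  next
    case 4
    have "a \<ge> 1" using r(1) N by (auto simp: Suc_le_eq intro: Nat.gr0I)
    define l where "l = (N - 1) div a"
    define d where "d = (N - 1) mod a + 1"
    have Nl: "N = a * l + d" "1 \<le> d" "d \<le> a"
      using N \<open>a \<ge> 1\<close> by (simp_all add: l_def d_def Suc_le_eq)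
    have "l < c" "l < y"
    proof -
      have "N \<le> a * c" "N \<le> a * y" using r(1,2) 4 by simp_all
      then have "a * l < a * c" "a * l < a * y" using Nl(1,2) by linarith+
      then show "l < c" "l < y" by simp_all
    qed
    then have "l + 1 \<le> c" "l + 1 \<le> y" by simp_all
    then obtain u v where uv: "c = l + 1 + u" "y = l + 1 + v" by (metis le_Suc_ex)
    show ?thesis
    proof (cases "q \<le> 2 * (u + v)")
      case True
      have "realizable N N a (l + 1) a (l + 1) a 0"
        unfolding realizable_def using Nl by simp
      moreover have "bubble_cost \<beta> a (l + 1) a (l + 1) a 0 \<le> bubble_cost \<beta> a c b y p q"
      proof -
        have "\<beta> * real q \<le> (1 / 2) * real q" using \<beta> by (intro mult_right_mono) auto
        also have "real q \<le> real (2 * (u + v))" using True by (simp only: of_nat_le_iff)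
        then have "(1 / 2) * real q \<le> real u + real v" by simp
        finally show ?thesis using 4 by (simp add: bubble_cost_def uv algebra_simps)
      qed
      ultimately show ?thesis using descent[of a "l + 1" a "l + 1" a 0] q by auto
    next
      case False
      have area: "2 * d + a * q \<le> a * (u + v + 2)"
        using r(3) unfolding 4(2)[symmetric] 4(1) Nl(1) uv by (simp add: algebra_simps)
      then have "a * q < a * (u + v + 2)" using Nl(2) by linarith
      then have "q < u + v + 2" by (simp only: mult_less_cancel1)
      \<comment> \<open>The area gives \<open>q \<le> u + v + 1\<close>, which together with
        \<open>q > 2 * (u + v)\<close> leaves a single case.\<close>
      then have *: "u = 0" "v = 0" "q = 1" using False q(1) by presburger+
      have "2 * d \<le> a" using area by (simp add: *)
      have cost: "bubble_cost \<beta> a c b y p q = 4 * real a + 4 * real l + 4 - 2 * \<beta> * real a - 2 * \<beta>"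
        using 4 by (simp add: bubble_cost_def uv * algebra_simps)
      show ?thesis
      proof (cases "d \<le> l")
        case True
        \<comment> \<open>The last \<open>d\<close> sites fit into an additional row of length
          \<open>l\<close>; the resulting energy equals the cost exactly.\<close>
        then have "N \<le> (a + 1) * l" using Nl by simp
        then have "height_energy \<beta> N (a + 1) \<le> 4 * real l + 2 * real (a + 1) * (2 - \<beta>)"
          by (intro height_energy_le) auto
        also have "\<dots> = bubble_cost \<beta> a c b y p q" by (simp add: cost algebra_simps)
        finally show ?thesis by (intro disjI1 exI[of _ "a + 1"]) auto
      next
        case False
        then obtain m where m: "a = m + 1" "1 \<le> m" using \<open>2 * d \<le> a\<close> Nl(2) by (intro that[of "a - 1"]) auto
        \<comment> \<open>With \<open>l < d\<close> and \<open>2 * d \<le> a\<close>, the last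
          column has room for a whole row, so the height can be reduced by one.\<close>
        have "N \<le> m * (l + 1)" using Nl(1) \<open>2 * d \<le> a\<close> False m by (simp add: algebra_simps)
        then have "height_energy \<beta> N m \<le> 4 * real (l + 1) + 2 * real m * (2 - \<beta>)"
          using m by (intro height_energy_le) auto
        also have "\<dots> \<le> bubble_cost \<beta> a c b y p q" using \<beta> unfolding cost by (simp add: m(1) algebra_simps)
        finally show ?thesis using m by blast
      qed
    qed
  qed
qed

text \<open>Lexicographic induction on \<open>q\<close> and the total height, matching the two ways
  in which a descent step may progress. Exchanging the boxes allows the first to be the lower
  one.\<close>

lemma cost_ge_height_energy:
  assumes \<beta>: "0 < \<beta>" "\<beta> \<le> 1 / 2" and N: "1 \<le> N"
  shows "realizable N N ra ca rb cb p q \<Longrightarrow> q \<le> p \<Longrightarrow>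
    \<exists>h\<ge>1. height_energy \<beta> N h \<le> bubble_cost \<beta> ra ca rb cb p q"
proof (induction q arbitrary: ra ca rb cb p rule: less_induct)
  case (less q)
  note outer = less.IH
  show ?case using less.prems
  proof (induction "ra + rb" arbitrary: ra ca rb cb p rule: less_induct)
    case less
    have main: "\<exists>h\<ge>1. height_energy \<beta> N h \<le> bubble_cost \<beta> a c b y p q"
      if "realizable N N a c b y p q" "a \<le> b" "a + b = ra + rb" for a c b y
    proof (cases "q = 0")
      case True
      then show ?thesis using cost_ge_no_shared_cols[OF \<beta>(1) N] that by simp
    next
      case False
      with cost_descent_step[OF \<beta> N that(1) _ less.prems(2) that(2)]
      consider "\<exists>h\<ge>1. height_energy \<beta> N h \<le> bubble_cost \<beta> a c b y p q"
        | a' c' b' y' p' q' where "realizable N N a' c' b' y' p' q'" "q' \<le> p'"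
          "bubble_cost \<beta> a' c' b' y' p' q' \<le> bubble_cost \<beta> a c b y p q" "q' < q \<or> q' = q \<and> a' + b' < a + b"
        by force
      then show ?thesis
      proof cases
        case 2
        then have "\<exists>h\<ge>1. height_energy \<beta> N h \<le> bubble_cost \<beta> a' c' b' y' p' q'"
          using outer[of q' a' c' b' y' p'] less.hyps[of a' b' c' y' p'] that(3) by auto
        then show ?thesis using 2(3) order_trans by blast
      qed
    qed
    show ?case
    proof (cases "ra \<le> rb")
      case True
      then show ?thesis using main less.prems(1) by blast
    next
      case False
      then have "\<exists>h\<ge>1. height_energy \<beta> N h \<le> bubble_cost \<beta> rb cb ra ca p q"
        using main[of rb cb ra ca] less.prems(1) realizable_commute by auto
      then show ?thesis using bubble_cost_commute by metis
    qed
  qed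
qed

lemma realizable_transpose: "realizable M N ra ca rb cb p q \<longleftrightarrow> realizable M N ca ra cb rb q p"
  by (auto simp: realizable_def mult.commute)

lemma bubble_cost_transpose: "bubble_cost \<beta> ra ca rb cb p q = bubble_cost \<beta> ca ra cb rb q p"
  by (simp add: bubble_cost_def)

lemma minimal_height_energy_le_cost:
  assumes "0 < \<beta>" "\<beta> \<le> 1 / 2" "1 \<le> N" "realizable N N ra ca rb cb p q"
  shows "\<exists>h\<ge>1. height_energy \<beta> N h \<le> bubble_cost \<beta> ra ca rb cb p q"
proof (cases "q \<le> p")
  case True
  then show ?thesis using cost_ge_height_energy assms by blast
next
  case False
  then have "\<exists>h\<ge>1. height_energy \<beta> N h \<le> bubble_cost \<beta> ca ra cb rb q p"
    using cost_ge_height_energy[of \<beta> N ca ra cb rb q p] assms realizable_transpose by auto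
  then show ?thesis using bubble_cost_transpose by metis
qed

section \<open>Optimal heights and the explicit pair\<close>

lemma optimal_height_iff:
  "optimal_height \<beta> N h \<longleftrightarrow> 1 \<le> h \<and> (\<forall>h'\<ge>1. height_energy \<beta> N h \<le> height_energy \<beta> N h')"
  by (auto simp: optimal_height_def is_arg_min_linorder)

text \<open>From \<open>h = N\<close> on the ceiling is 1 and the energy only grows, so the search
  is finite.\<close>

lemma optimal_height_exists:
  assumes "\<beta> < 1" "1 \<le> N"
  shows "\<exists>h. optimal_height \<beta> N h"
proof -
  obtain h where h: "h \<in> {1..N}" "\<And>h'. h' \<in> {1..N} \<Longrightarrow> height_energy \<beta> N h \<le> height_energy \<beta> N h'"
    using arg_min_if_finite(1)[of "{1..N}" "height_energy \<beta> N"] arg_min_least[of "{1..N}" _ "height_energy \<beta> N"] assms(2)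
    by (metis atLeastatMost_empty_iff2 finite_atLeastAtMost not_le)
  have "height_energy \<beta> N h \<le> height_energy \<beta> N h'" if "1 \<le> h'" for h'
  proof (cases "h' \<le> N")
    case False
    have "height_energy \<beta> N h \<le> height_energy \<beta> N N" using h(2) assms(2) by simp
    also have "\<dots> \<le> 4 * real 1 + 2 * real N * (2 - \<beta>)" using assms(2) by (intro height_energy_le) auto
    also have "\<dots> \<le> 4 * real 1 + 2 * real h' * (2 - \<beta>)"
      using False assms(1) by (intro add_left_mono mult_right_mono) auto
    also have "\<dots> \<le> height_energy \<beta> N h'" using that assms(2) by (intro height_energy_ge) auto
    finally show ?thesis .
  qed (use h that in auto)
  with h(1) show ?thesis by (auto simp: optimal_height_iff)
qed

lemma model_A_eq: "model_A h l r = {- int l + 1..0} \<times> {1..int h} \<union> {- int l} \<times> {1..int r}"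
  and model_B_eq: "model_B h l r = {1..int l} \<times> {1..int h} \<union> {int l + 1} \<times> {1..int r}"
  by (auto simp: model_A_def model_B_def)

lemma card_model: "card (model_A h l r) = h * l + r" "card (model_B h l r) = h * l + r"
  unfolding model_A_eq model_B_eq
  by (subst card_Un_disjoint; auto simp: card_cartesian_product)+

lemma admissible_model: "admissible (h * l + r) (h * l + r) (model_A h l r) (model_B h l r)"
proof -
  have "finite (model_A h l r)" "finite (model_B h l r)" by (simp_all add: model_A_eq model_B_eq)
  moreover have "model_A h l r \<inter> model_B h l r = {}" by (auto simp: model_A_def model_B_def)
  ultimately show ?thesis by (simp add: admissible_def card_model)
qed

lemma perimeter_model_le:
  assumes \<beta>: "0 < \<beta>" "\<beta> < 1" and "r < h"
  shows "perimeter \<beta> (model_A h l r) (model_B h l r) \<le> height_energy \<beta> (h * l + r) h"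
proof -
  let ?A = "model_A h l r" and ?B = "model_B h l r"
  \<comment> \<open>\<open>s\<close> and \<open>w\<close> bound the height and the width of each
    half. The degenerate cases are a lone partial column (\<open>l = 0\<close>) and no partial
    column (\<open>r = 0\<close>).\<close>
  define s where "s = (if l = 0 then r else h)"
  define w where "w = (if r = 0 then l else l + 1)"
  have "row_convex ?A" "row_convex ?B" "row_convex (?A \<union> ?B)"
    unfolding row_convex_def using assms(3) by (auto simp: model_A_def model_B_def)
  moreover have "col_convex ?A" "col_convex ?B" "col_convex (?A \<union> ?B)"
    unfolding col_convex_def using assms(3) by (auto simp: model_A_def model_B_def)
  ultimately have conv: "hv_convex ?A" "hv_convex ?B" "hv_convex (?A \<union> ?B)" by (simp_all add: hv_convex_def)
  have "snd ` ?A \<subseteq> {1..int s}" "snd ` ?B \<subseteq> {1..int s}" "snd ` (?A \<union> ?B) \<subseteq> {1..int s}"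
    using assms by (auto simp: model_A_def model_B_def s_def split: if_splits)
  from this[THEN card_mono[OF finite_atLeastAtMost]]
  have rows: "row_count ?A \<le> s" "row_count ?B \<le> s" "row_count (?A \<union> ?B) \<le> s" by simp_all
  have "fst ` ?A \<subseteq> {- int w + 1..0}" "fst ` ?B \<subseteq> {1..int w}" "fst ` (?A \<union> ?B) \<subseteq> {- int w + 1..int w}"
    using assms by (auto simp: model_A_def model_B_def w_def split: if_splits)
  from this[THEN card_mono[OF finite_atLeastAtMost_int]]
  have cols: "col_count ?A \<le> w" "col_count ?B \<le> w" "col_count (?A \<union> ?B) \<le> 2 * w" by simp_all
  have "perimeter \<beta> ?A ?B \<le> bubble_cost \<beta> s w s w s 0"
    using admissible_model[of h l r] rows cols by (intro perimeter_le_cost[OF \<beta> _ _ _ conv]) (auto simp: admissible_def)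
  also have "\<dots> = 4 * real w + 2 * real s * (2 - \<beta>)" by (simp add: bubble_cost_def algebra_simps)
  also have "\<dots> \<le> 4 * real w + 2 * real h * (2 - \<beta>)"
    using assms by (intro add_left_mono mult_right_mono) (auto simp: s_def)
  also have "\<dots> \<le> height_energy \<beta> (h * l + r) h"
    using assms by (intro height_energy_ge) (auto simp: w_def)
  finally show ?thesis .
qed

lemma equal_case:
  assumes \<beta>: "0 < \<beta>" "\<beta> \<le> 1 / 2" and N: "1 \<le> N" and h: "optimal_height \<beta> N h"
  shows "admissible N N A B \<Longrightarrow> height_energy \<beta> N h \<le> perimeter \<beta> A B"
    and "solves_double_bubble \<beta> N N A B \<Longrightarrow> perimeter \<beta> A B = height_energy \<beta> N h"
    and "r < h \<Longrightarrow> N = h * l + r \<Longrightarrow> solves_double_bubble \<beta> N N (model_A h l r) (model_B h l r)"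
proof -
  have \<beta>1: "\<beta> < 1" using \<beta> by simp
  show lower: "height_energy \<beta> N h \<le> perimeter \<beta> A B" if "admissible N N A B" for A B
  proof -
    have AB: "finite A" "finite B" "A \<inter> B = {}" "card A = N" "card B = N"
      using that by (auto simp: admissible_def)
    obtain h' where "h' \<ge> 1" "height_energy \<beta> N h' \<le> cost_of \<beta> A B"
      using minimal_height_energy_le_cost[OF \<beta> N] realizable_of_sets[OF AB(1-3)] AB(4,5)
      unfolding cost_of_def by metis
    with h perimeter_ge_cost(1)[OF \<beta>(1) \<beta>1 AB(1-3)] show ?thesis
      unfolding optimal_height_iff by force
  qed
  have model: "admissible N N (model_A h l r) (model_B h l r)"
    "perimeter \<beta> (model_A h l r) (model_B h l r) \<le> height_energy \<beta> N h" if "r < h" "N = h * l + r" for l r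
    using admissible_model perimeter_model_le[OF \<beta>(1) \<beta>1] that by auto
  show "solves_double_bubble \<beta> N N (model_A h l r) (model_B h l r)" if "r < h" "N = h * l + r"
    using model[OF that] lower unfolding solves_double_bubble_def is_arg_min_linorder
    by (auto intro: order_trans)
  show "perimeter \<beta> A B = height_energy \<beta> N h" if sol: "solves_double_bubble \<beta> N N A B"
  proof -
    have "N mod h < h" "N = h * (N div h) + N mod h" using h by (simp_all add: optimal_height_iff)
    from model[OF this] sol have "perimeter \<beta> A B \<le> height_energy \<beta> N h"
      unfolding solves_double_bubble_def is_arg_min_linorder by fastforce
    moreover have "admissible N N A B"
      using sol by (auto simp: solves_double_bubble_def is_arg_min_linorder)
    ultimately show ?thesis using lower by force
  qed
qed

section \<open>Fluctuations\<close>

lemma connected_snd_interval: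
  assumes "lattice_connected V" "finite V" "V \<noteq> {}"
  shows "snd ` V = {Min (snd ` V)..Max (snd ` V)}"
proof (intro equalityI subsetI)
  fix t assume t: "t \<in> {Min (snd ` V)..Max (snd ` V)}"
  have "Min (snd ` V) \<in> snd ` V" "Max (snd ` V) \<in> snd ` V" using assms(2,3) by simp_all
  then obtain a b where "(a, Min (snd ` V)) \<in> V" "(b, Max (snd ` V)) \<in> V"
    by (elim imageE) (metis prod.collapse)
  then obtain x where "(x, t) \<in> V" using connected_rows[OF assms(1), of a _ b _ t] t by auto
  then show "t \<in> snd ` V" by force
qed (use assms in auto)

lemma connected_fst_interval:
  assumes "lattice_connected V" "finite V" "V \<noteq> {}"
  shows "fst ` V = {Min (fst ` V)..Max (fst ` V)}"
proof -
  have "lattice_connected (prod.swap ` V)"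
    using assms(1) by (rule lattice_connected_image) (simp add: unit_dist_swap)
  then show ?thesis using connected_snd_interval[of "prod.swap ` V"] assms by (simp add: snd_swap_image)
qed

text \<open>For sets of equal size both differences have the same cardinality, so covering one of
  them suffices.\<close>

lemma card_sym_diff_le:
  assumes "finite A" "finite B" "card A = card B" "A - B \<subseteq> E" "finite E" "card E \<le> k"
  shows "card (sym_diff A B) \<le> 2 * k"
proof -
  have "card (A - B) \<le> k" using card_mono[OF assms(5,4)] assms(6) by linarith
  moreover have "card (A - B) + card (A \<inter> B) = card (B - A) + card (A \<inter> B)"
    using assms(1-3) by (metis card_Int_Diff Int_commute add.commute)
  moreover have "card (sym_diff A B) \<le> card (A - B) + card (B - A)" by (rule card_Un_le)
  ultimately show ?thesis by linarith
qed

text \<open>The model is moved so that its interface lies at the right end of \<open>A\<close> and its bottom row at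
  the bottom row of \<open>A\<close>. The bounds are natural numbers with truncated subtraction.\<close>

lemma model_distance:
  assumes pair: "bubble_pair A B" and conn: "lattice_connected (A \<union> B)"
    and fin: "finite A" "finite B" and ne: "A \<noteq> {}" "B \<noteq> {}"
    and card: "card A = h * l + r" "card B = h * l + r" and "r < h"
    and first: "Min (fst ` A) \<le> Min (fst ` B)"
  shows "\<exists>T. lattice_isometry T \<and>
    card (sym_diff A (T ` model_A h l r)) + card (sym_diff B (T ` model_B h l r)) \<le>
    2 * (h + (col_count A - (l + 1)) * row_count A + (row_count A - h) * col_count A) +
    2 * (h + shared_cols A B * row_count B + (col_count B - (l + 1)) * row_count B +
         (row_count B - shared_rows A B) * col_count B + (row_count A - h) * col_count B)"
proof -
  define u\<^sub>0 u v v\<^sub>1 w where defs: "u\<^sub>0 = Min (fst ` A)" "u = Max (fst ` A)" "v = Min (snd ` A) - 1"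
    "v\<^sub>1 = Max (snd ` A)" "w = Min (fst ` B)"
  note d = bubble_pairD[OF pair]
  have fA: "fst ` A = {u\<^sub>0..u}" unfolding defs by (rule connected_fst_interval[OF d(8) fin(1) ne(1)])
  have "v + 1 = Min (snd ` A)" by (simp add: defs)
  then have sA: "snd ` A = {v + 1..v\<^sub>1}"
    unfolding defs(4) by (simp only:) (rule connected_snd_interval[OF d(8) fin(1) ne(1)])
  have "fst ` B = {w..Max (fst ` B)}" unfolding defs by (rule connected_fst_interval[OF d(9) fin(2) ne(2)])
  then obtain w' where fB: "fst ` B = {w..w'}" by blast
  have mem: "u \<in> fst ` A" "w \<in> fst ` B" using fin ne by (simp_all add: defs)
  \<comment> \<open>A connected union leaves no empty column between \<open>A\<close> and
    \<open>B\<close>.\<close>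
  have "w \<le> u + 1"
  proof (rule ccontr)
    assume "\<not> w \<le> u + 1"
    obtain a b where ab: "fst ` (A \<union> B) = {a..b}"
      using connected_fst_interval[OF conn] fin ne by blast
    have "u \<in> fst ` (A \<union> B)" "w \<in> fst ` (A \<union> B)" unfolding image_Un using mem by blast+
    then have "u + 1 \<in> fst ` (A \<union> B)" using \<open>\<not> w \<le> u + 1\<close> unfolding ab by simp
    then have "u + 1 \<in> {u\<^sub>0..u} \<union> {w..w'}" by (simp only: image_Un fA fB)
    with \<open>\<not> w \<le> u + 1\<close> show False by auto
  qed
  have "u\<^sub>0 \<le> w" using first by (simp add: defs)
  have cA: "col_count A = nat (u - u\<^sub>0 + 1)" and rA: "row_count A = nat (v\<^sub>1 - v)" and cB: "col_count B = nat (w' - w + 1)"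
    unfolding fA sA fB by simp_all
  define T :: "site \<Rightarrow> site" where "T = (\<lambda>x. x + (u, v))"
  have T: "lattice_isometry T" unfolding T_def by (rule translation)
  have inj: "inj_on T S" for S by (auto simp: T_def inj_on_def)
  have finM: "finite (model_A h l r)" "finite (model_B h l r)" using admissible_model[of h l r] by (auto simp: admissible_def)
  have T_iff: "(x, y) \<in> T ` X \<longleftrightarrow> (x - u, y - v) \<in> X" for x y X
  proof
    assume "(x - u, y - v) \<in> X"
    moreover have "(x, y) = T (x - u, y - v)" by (simp add: T_def)
    ultimately show "(x, y) \<in> T ` X" by (metis imageI)
  qed (auto simp: T_def)
  have TA: "(x, y) \<in> T ` model_A h l r"
    if "u - int l + 1 \<le> x" "x \<le> u" "v + 1 \<le> y" "y \<le> v + int h" for x y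
    unfolding T_iff using that by (simp add: model_A_def)
  have TB: "(x, y) \<in> T ` model_B h l r"
    if "u + 1 \<le> x" "x \<le> u + int l" "v + 1 \<le> y" "y \<le> v + int h" for x y
    unfolding T_iff using that by (simp add: model_B_def)
  \<comment> \<open>Sites of \<open>A\<close> missed by the model lie in its partial column, in
    columns further left, or in rows above height \<open>h\<close>.\<close>
  let ?D1 = "{u - int l} \<times> {v + 1..v + int h}" and ?D2 = "{u\<^sub>0..u - int l - 1} \<times> snd ` A"
    and ?D3 = "fst ` A \<times> {v + int h + 1..v\<^sub>1}"
  have "A - T ` model_A h l r \<subseteq> ?D1 \<union> (?D2 \<union> ?D3)"
  proof
    fix z assume z: "z \<in> A - T ` model_A h l r"
    obtain x y where xy: "z = (x, y)" by fastforce
    have x: "x \<in> fst ` A" and y: "y \<in> snd ` A" using z by (force simp: xy)+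
    then have bounds: "u\<^sub>0 \<le> x" "x \<le> u" "v + 1 \<le> y" "y \<le> v\<^sub>1" unfolding fA sA by simp_all
    consider "x \<le> u - int l - 1" | "y \<ge> v + int h + 1" | "x = u - int l" "y \<le> v + int h"
      using TA[of x y] z bounds unfolding xy by fastforce
    then show "z \<in> ?D1 \<union> (?D2 \<union> ?D3)"
      by cases (use x y bounds in \<open>simp_all add: xy\<close>)
  qed
  moreover have "card (?D1 \<union> (?D2 \<union> ?D3)) \<le> h + (col_count A - (l + 1)) * row_count A + (row_count A - h) * col_count A"
  proof -
    have "card {u\<^sub>0..u - int l - 1} = col_count A - (l + 1)" "card {v + int h + 1..v\<^sub>1} = row_count A - h"
      unfolding cA rA by simp_all
    then have "card ?D2 = (col_count A - (l + 1)) * row_count A" "card ?D3 = (row_count A - h) * col_count A"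
      by (simp_all only: card_cartesian_product mult.commute)
    moreover have "card ?D1 = h" by (simp add: card_cartesian_product)
    ultimately show ?thesis using card_Un_le[of ?D1 "?D2 \<union> ?D3"] card_Un_le[of ?D2 ?D3] by linarith
  qed
  ultimately have distA: "card (sym_diff A (T ` model_A h l r)) \<le>
      2 * (h + (col_count A - (l + 1)) * row_count A + (row_count A - h) * col_count A)"
    using fin finM card card_model by (intro card_sym_diff_le[of _ _ "?D1 \<union> (?D2 \<union> ?D3)"]) (auto simp: card_image[OF inj])
  \<comment> \<open>For \<open>B\<close>: the partial column, the columns shared with
    \<open>A\<close>, columns beyond the model, rows not met by \<open>A\<close>, and rows of
    \<open>A\<close> above height \<open>h\<close>.\<close>
  let ?E1 = "{u + int l + 1} \<times> {v + 1..v + int h}" and ?E2 = "(fst ` A \<inter> fst ` B) \<times> snd ` B"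
    and ?E3 = "{u + int l + 2..w'} \<times> snd ` B" and ?E4 = "fst ` B \<times> (snd ` B - snd ` A)"
    and ?E5 = "fst ` B \<times> {v + int h + 1..v\<^sub>1}"
  have "B - T ` model_B h l r \<subseteq> ?E1 \<union> (?E2 \<union> (?E3 \<union> (?E4 \<union> ?E5)))"
  proof
    fix z assume z: "z \<in> B - T ` model_B h l r"
    obtain x y where xy: "z = (x, y)" by fastforce
    have x: "x \<in> fst ` B" and y: "y \<in> snd ` B" using z by (force simp: xy)+
    then have bounds: "w \<le> x" "x \<le> w'" unfolding fB by simp_all
    consider "x \<in> fst ` A" | "x \<ge> u + int l + 2" | "y \<notin> snd ` A" | "y \<in> snd ` A" "y \<ge> v + int h + 1"
      | "x \<notin> fst ` A" "x \<le> u + int l + 1" "y \<in> snd ` A" "y \<le> v + int h"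
      by linarith
    then show "z \<in> ?E1 \<union> (?E2 \<union> (?E3 \<union> (?E4 \<union> ?E5)))"
    proof cases
      case 4
      then show ?thesis using x unfolding sA by (simp add: xy)
    next
      case 5
      then have "u < x" "v + 1 \<le> y" using bounds \<open>u\<^sub>0 \<le> w\<close> unfolding fA sA by auto
      then have "x = u + int l + 1" using TB[of x y] z 5(2,4) unfolding xy by fastforce
      then show ?thesis using \<open>v + 1 \<le> y\<close> 5(4) by (simp add: xy)
    qed (use x y bounds in \<open>simp_all add: xy\<close>)
  qed
  moreover have "card (?E1 \<union> (?E2 \<union> (?E3 \<union> (?E4 \<union> ?E5)))) \<le> h + shared_cols A B * row_count B +
      (col_count B - (l + 1)) * row_count B + (row_count B - shared_rows A B) * col_count B + (row_count A - h) * col_count B"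
  proof -
    have "card {u + int l + 2..w'} \<le> col_count B - (l + 1)" using \<open>w \<le> u + 1\<close> unfolding cB by simp
    then have "card ?E3 \<le> (col_count B - (l + 1)) * row_count B"
      by (simp only: card_cartesian_product mult_le_mono1)
    moreover have "card {v + int h + 1..v\<^sub>1} = row_count A - h" unfolding rA by simp
    then have "card ?E5 = (row_count A - h) * col_count B"
      by (simp only: card_cartesian_product mult.commute)
    moreover have "card (snd ` B - snd ` A) = row_count B - shared_rows A B"
      using fin by (simp add: card_Diff_subset_Int Int_commute)
    then have "card ?E4 = (row_count B - shared_rows A B) * col_count B"
      by (simp only: card_cartesian_product mult.commute)
    moreover have "card ?E2 = shared_cols A B * row_count B" by (simp only: card_cartesian_product)
    moreover have "card ?E1 = h" by (simp add: card_cartesian_product)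
    ultimately show ?thesis
      using card_Un_le[of ?E1 "?E2 \<union> (?E3 \<union> (?E4 \<union> ?E5))"] card_Un_le[of ?E2 "?E3 \<union> (?E4 \<union> ?E5)"]
        card_Un_le[of ?E3 "?E4 \<union> ?E5"] card_Un_le[of ?E4 ?E5]
      by linarith
  qed
  ultimately have distB: "card (sym_diff B (T ` model_B h l r)) \<le> 2 * (h + shared_cols A B * row_count B +
      (col_count B - (l + 1)) * row_count B + (row_count B - shared_rows A B) * col_count B + (row_count A - h) * col_count B)"
    using fin finM card card_model
    by (intro card_sym_diff_le[of _ _ "?E1 \<union> (?E2 \<union> (?E3 \<union> (?E4 \<union> ?E5)))"]) (auto simp: card_image[OF inj])
  show ?thesis using T distA distB by (intro exI[of _ T] conjI add_mono)
qed

lemma isometry_exchanging_models: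
  "\<exists>S. lattice_isometry S \<and> S ` model_A h l r = model_B h l r \<and> S ` model_B h l r = model_A h l r"
proof (intro exI conjI)
  \<comment> \<open>The reflection in the vertical line through the interface, at abscissa
    1/2.\<close>
  let ?S = "(\<lambda>x. x + (1, 0)) \<circ> (\<lambda>(x\<^sub>1, x\<^sub>2). (- x\<^sub>1, x\<^sub>2)) :: site \<Rightarrow> site"
  show "lattice_isometry ?S" by (intro composition translation reflection2)
  have *: "(x, y) \<in> ?S ` X \<longleftrightarrow> (1 - x, y) \<in> X" for x y X
  proof
    assume "(1 - x, y) \<in> X"
    moreover have "(x, y) = ?S (1 - x, y)" by simp
    ultimately show "(x, y) \<in> ?S ` X" by (metis imageI)
  qed auto
  show "?S ` model_A h l r = model_B h l r" "?S ` model_B h l r = model_A h l r"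
    unfolding set_eq_iff split_paired_All * by (auto simp: model_A_def model_B_def)
qed

lemma lattice_isometry_swap: "lattice_isometry prod.swap"
proof -
  have "prod.swap = (\<lambda>(x\<^sub>1, x\<^sub>2). (- x\<^sub>1, x\<^sub>2)) \<circ> (\<lambda>(x\<^sub>1, x\<^sub>2). (- x\<^sub>2, x\<^sub>1) :: site)"
    by (auto simp: fun_eq_iff)
  then show ?thesis using composition[OF reflection2 rotation] by simp
qed

section \<open>Quantitative stability of the cost\<close>

lemma overlap_gain:
  fixes \<beta> e p q :: real
  assumes "0 < \<beta>" "\<beta> \<le> 1 / 2" "0 \<le> e" "0 \<le> q" "q \<le> p"
  shows "(\<beta> / 6) * (e + q) * (p + e) \<le> \<beta> * e * (p + e) - 2 * \<beta> * q * (p + e) + 2 * p * q"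
proof -
  \<comment> \<open>In the application \<open>p + e\<close> is the larger height, \<open>e\<close>
    its unshared part. The area \<open>p * q\<close> wasted by the overlap outweighs the reward for
    \<open>q\<close> shared columns, with a margin controlling \<open>e + q\<close>; the factor
    \<open>1 / 6\<close> is convenient, not sharp. The products listed here certify the
    inequality.\<close>
  have "0 \<le> \<beta> * (e - q)\<^sup>2" "0 \<le> \<beta> * (e - 2 * q)\<^sup>2" "0 \<le> \<beta> * (q * (p - q))"
    "0 \<le> \<beta> * (e * (p - q))" "0 \<le> (1 - 2 * \<beta>) * (p * q)" "0 \<le> \<beta> * (e * p)" "0 \<le> p * q"
    using assms by simp_all
  then have *: "0 \<le> \<beta> * (e * e) - 2 * (\<beta> * (e * q)) + \<beta> * (q * q)"
    "0 \<le> \<beta> * (e * e) - 4 * (\<beta> * (e * q)) + 4 * (\<beta> * (q * q))"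
    "0 \<le> \<beta> * (p * q) - \<beta> * (q * q)" "0 \<le> \<beta> * (e * p) - \<beta> * (e * q)"
    "0 \<le> p * q - 2 * (\<beta> * (p * q))" "0 \<le> \<beta> * (e * p)" "0 \<le> p * q"
    by (simp_all add: power2_eq_square algebra_simps)
  have "\<beta> * e * (p + e) - 2 * \<beta> * q * (p + e) + 2 * p * q - (\<beta> / 6) * (e + q) * (p + e) =
      (5 / 6) * (\<beta> * (e * p)) + (5 / 6) * (\<beta> * (e * e)) - (13 / 6) * (\<beta> * (p * q))
      - (13 / 6) * (\<beta> * (e * q)) + 2 * (p * q)"
    by (simp add: field_simps)
  with * show ?thesis by linarith
qed

text \<open>Excess of the cost over its continuous lower bound, which is attained at two adjacent
  rectangles of height \<open>h\<^sub>0\<close>.\<close>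

lemma cost_stability:
  fixes \<beta> a b c y p q n h\<^sub>0 :: real
  assumes \<beta>: "0 < \<beta>" "\<beta> \<le> 1 / 2" and pos: "0 < a" "0 < b" and h\<^sub>0: "(2 - \<beta>) * h\<^sub>0\<^sup>2 = 2 * n"
    and area: "n \<le> a * c" "n \<le> b * y" "2 * n + p * q \<le> a * c + b * y"
    and pq: "p \<le> a" "p \<le> b" "0 \<le> q" "q \<le> p"
    and cost: "2 * (a + c + b + y) - 2 * \<beta> * (p + q) \<le> 4 * (2 - \<beta>) * h\<^sub>0 + 8"
  shows "q \<le> 48 / \<beta>" "a - p \<le> 48 / \<beta>" "b - p \<le> 48 / \<beta>"
    and "(a - h\<^sub>0)\<^sup>2 \<le> 8 * a" "(b - h\<^sub>0)\<^sup>2 \<le> 8 * b"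
    and "c - n / a \<le> 4 + 48 / \<beta>" "y - n / b \<le> 4 + 48 / \<beta>"
proof -
  \<comment> \<open>Widths in excess of what \<open>n\<close> cells need at heights \<open>a\<close>
    and \<open>b\<close>.\<close>
  define s t where "s = c - n / a" and "t = y - n / b"
  have st: "0 \<le> s" "0 \<le> t" "a * s = a * c - n" "b * t = b * y - n"
    using area pos by (simp_all add: s_def t_def field_simps)
  \<comment> \<open>Completing the square around \<open>h\<^sub>0\<close>, the minimizer of the
    left-hand side.\<close>
  have rest: "(2 - \<beta>) * x + 2 * n / x = 2 * (2 - \<beta>) * h\<^sub>0 + (2 - \<beta>) * (x - h\<^sub>0)\<^sup>2 / x" if "0 < x" for x
    unfolding h\<^sub>0[symmetric] using that by (simp add: field_simps power2_eq_square)
  define R where "R x = (2 - \<beta>) * (x - h\<^sub>0)\<^sup>2 / x" for x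
  have R: "0 \<le> R x" "(x - h\<^sub>0)\<^sup>2 \<le> x * R x" if "0 < x" for x
  proof -
    show "0 \<le> R x" using \<beta> that by (simp add: R_def)
    have "1 * (x - h\<^sub>0)\<^sup>2 \<le> (2 - \<beta>) * (x - h\<^sub>0)\<^sup>2" using \<beta> by (intro mult_right_mono) auto
    then show "(x - h\<^sub>0)\<^sup>2 \<le> x * R x" using that by (simp add: R_def)
  qed
  have total: "R a + R b + \<beta> * (a - p) + \<beta> * (b - p) - 2 * (\<beta> * q) + 2 * s + 2 * t \<le> 8"
    using cost rest[OF pos(1)] rest[OF pos(2)] unfolding R_def s_def t_def by (simp add: algebra_simps)
  define M where "M = max a b"
  have M: "a \<le> M" "b \<le> M" "0 < M" "p \<le> M" using pos pq by (auto simp: M_def)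
  \<comment> \<open>The overlap has to be compensated by the excess widths.\<close>
  have "p * q \<le> a * s + b * t" using area(3) st by linarith
  also have "\<dots> \<le> M * s + M * t" using M st by (intro add_mono mult_right_mono) auto
  finally have pq_le: "p * q \<le> M * (s + t)" by (simp add: algebra_simps)
  have "(\<beta> / 6) * ((M - p) + q) * M \<le> \<beta> * (M - p) * M - 2 * \<beta> * q * M + 2 * p * q"
    using overlap_gain[OF \<beta>, of "M - p" q p] pq M by simp
  also have "\<dots> \<le> \<beta> * (M - p) * M - 2 * \<beta> * q * M + 2 * (M * (s + t))" using pq_le by simp
  also have "\<dots> = (\<beta> * (M - p) - 2 * \<beta> * q + 2 * (s + t)) * M" by (simp add: algebra_simps)
  finally have gain: "(\<beta> / 6) * ((M - p) + q) \<le> \<beta> * (M - p) - 2 * \<beta> * q + 2 * (s + t)"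
    using M(3) by (simp only: mult_le_cancel_right_pos)
  have "\<beta> * (M - p) \<le> \<beta> * (a - p) + \<beta> * (b - p)"
    using \<beta> pq by (auto simp: M_def max_def)
  with total gain have bound: "R a + R b + (\<beta> / 6) * ((M - p) + q) \<le> 8" by (simp add: algebra_simps)
  have "0 \<le> (\<beta> / 6) * ((M - p) + q)" using \<beta> M pq by simp
  with bound R(1)[OF pos(1)] R(1)[OF pos(2)] have "R a \<le> 8" "R b \<le> 8" "(\<beta> / 6) * ((M - p) + q) \<le> 8"
    by linarith+
  \<comment> \<open>The constant \<open>48 / \<beta>\<close> is the excess 8 divided by the margin
    \<open>\<beta> / 6\<close>.\<close>
  then have Mpq: "(M - p) + q \<le> 48 / \<beta>" using \<beta> by (simp add: field_simps)
  then show q: "q \<le> 48 / \<beta>" and "a - p \<le> 48 / \<beta>" "b - p \<le> 48 / \<beta>" using M pq by linarith+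
  have "a * R a \<le> a * 8" "b * R b \<le> b * 8" using \<open>R a \<le> 8\<close> \<open>R b \<le> 8\<close> pos by simp_all
  then show "(a - h\<^sub>0)\<^sup>2 \<le> 8 * a" "(b - h\<^sub>0)\<^sup>2 \<le> 8 * b" using R(2)[OF pos(1)] R(2)[OF pos(2)] by linarith+
  have "\<beta> * q \<le> (1 / 2) * q" using \<beta> pq by (intro mult_right_mono) auto
  moreover have "0 \<le> \<beta> * (a - p)" "0 \<le> \<beta> * (b - p)" using \<beta> pq by simp_all
  ultimately have "s \<le> 4 + 48 / \<beta>" "t \<le> 4 + 48 / \<beta>"
    using total R(1)[OF pos(1)] R(1)[OF pos(2)] st(1,2) q \<open>0 \<le> q\<close> by linarith+
  then show "c - n / a \<le> 4 + 48 / \<beta>" "y - n / b \<le> 4 + 48 / \<beta>" by (simp_all add: s_def t_def)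
qed

text \<open>\<open>h\<^sub>0\<close> minimizes the height energy without the ceiling,
  \<open>4 * N / h + 2 * h * (2 - \<beta>)\<close> over real \<open>h > 0\<close>; it is comparable
  to the square root of \<open>N\<close>.\<close>

lemma ideal_height:
  assumes \<beta>: "0 < \<beta>" "\<beta> < 1" and N: "1 \<le> N" and h\<^sub>0_def: "h\<^sub>0 = sqrt (2 * real N / (2 - \<beta>))"
  shows "(2 - \<beta>) * h\<^sub>0\<^sup>2 = 2 * real N" "sqrt (real N) \<le> h\<^sub>0" "h\<^sub>0 \<le> 2 * sqrt (real N)" "1 \<le> sqrt (real N)"
proof -
  show sq: "(2 - \<beta>) * h\<^sub>0\<^sup>2 = 2 * real N" using assms by (simp add: h\<^sub>0_def)
  show "1 \<le> sqrt (real N)" using N by simp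
  have "real N * (2 - \<beta>) \<le> real N * 2" using \<beta> by (intro mult_left_mono) auto
  then have "real N \<le> 2 * real N / (2 - \<beta>)" using \<beta> by (simp add: field_simps)
  then show "sqrt (real N) \<le> h\<^sub>0" unfolding h\<^sub>0_def by (rule real_sqrt_le_mono)
  have "4 * real N * (2 - \<beta>) \<ge> 4 * real N * 1" using \<beta> by (intro mult_left_mono) auto
  then have "2 * real N / (2 - \<beta>) \<le> 4 * real N" using \<beta> N by (simp add: field_simps)
  then have "h\<^sub>0 \<le> sqrt (4 * real N)" unfolding h\<^sub>0_def by (rule real_sqrt_le_mono)
  then show "h\<^sub>0 \<le> 2 * sqrt (real N)" by (simp add: real_sqrt_mult)
qed

lemma optimal_height_energy_bounds:
  assumes \<beta>: "0 < \<beta>" "\<beta> < 1" and N: "1 \<le> N" and h: "optimal_height \<beta> N h"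
    and h\<^sub>0_def: "h\<^sub>0 = sqrt (2 * real N / (2 - \<beta>))"
  shows "height_energy \<beta> N h \<le> 4 * (2 - \<beta>) * h\<^sub>0 + 8" "(real h - h\<^sub>0)\<^sup>2 \<le> 8 * real h"
proof -
  note h\<^sub>0 = ideal_height[OF \<beta> N h\<^sub>0_def]
  have "1 \<le> h\<^sub>0" "0 < h\<^sub>0" using h\<^sub>0(2,4) by linarith+
  have Nh: "real N / h\<^sub>0 = (2 - \<beta>) * h\<^sub>0 / 2"
    using h\<^sub>0(1) \<open>0 < h\<^sub>0\<close> by (simp add: field_simps power2_eq_square)
  \<comment> \<open>Rounding the ideal height up costs at most \<open>2 * (2 - \<beta>)\<close> and
    the ceiling at most 4; this is the origin of the 8.\<close>
  define m where "m = nat \<lceil>h\<^sub>0\<rceil>"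
  have m: "h\<^sub>0 \<le> real m" "real m \<le> h\<^sub>0 + 1" "1 \<le> m" using \<open>1 \<le> h\<^sub>0\<close> unfolding m_def by linarith+
  have "height_energy \<beta> N h \<le> height_energy \<beta> N m" using h m(3) by (simp add: optimal_height_iff)
  also have "\<dots> \<le> 4 * (real N / h\<^sub>0 + 1) + 2 * (h\<^sub>0 + 1) * (2 - \<beta>)"
  proof -
    have "real N / real m \<le> real N / h\<^sub>0" using m \<open>0 < h\<^sub>0\<close> by (intro divide_left_mono) auto
    then have "real_of_int \<lceil>real N / real m\<rceil> \<le> real N / h\<^sub>0 + 1" by linarith
    moreover have "2 * real m * (2 - \<beta>) \<le> 2 * (h\<^sub>0 + 1) * (2 - \<beta>)" using m \<beta> by (intro mult_right_mono) auto
    ultimately show ?thesis unfolding height_energy_def by (intro add_mono mult_left_mono) auto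
  qed
  also have "\<dots> \<le> 4 * (2 - \<beta>) * h\<^sub>0 + 8" using \<beta> unfolding Nh by (simp add: field_simps)
  finally show upper: "height_energy \<beta> N h \<le> 4 * (2 - \<beta>) * h\<^sub>0 + 8" .
  have pos: "0 < real h" using h by (simp add: optimal_height_iff)
  have "4 * (2 - \<beta>) * h\<^sub>0 + 2 * (2 - \<beta>) * (real h - h\<^sub>0)\<^sup>2 / real h = 4 * (real N / real h) + 2 * real h * (2 - \<beta>)"
  proof -
    have N_eq: "real N = (2 - \<beta>) * h\<^sub>0\<^sup>2 / 2" using h\<^sub>0(1) by simp
    show ?thesis unfolding N_eq using pos by (simp add: field_simps power2_eq_square)
  qed
  also have "\<dots> \<le> height_energy \<beta> N h" unfolding height_energy_def
    by (intro add_right_mono mult_left_mono le_of_int_ceiling) simp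
  finally have "2 * (2 - \<beta>) * (real h - h\<^sub>0)\<^sup>2 / real h \<le> 8" using upper by linarith
  then have "2 * (2 - \<beta>) * (real h - h\<^sub>0)\<^sup>2 \<le> 8 * real h" using pos by (simp add: field_simps)
  moreover have "1 * (real h - h\<^sub>0)\<^sup>2 \<le> 2 * (2 - \<beta>) * (real h - h\<^sub>0)\<^sup>2" using \<beta> by (intro mult_right_mono) auto
  ultimately show "(real h - h\<^sub>0)\<^sup>2 \<le> 8 * real h" by linarith
qed

text \<open>If \<open>x\<close> were more than \<open>34 * h\<^sub>0\<close>, then
  \<open>x - h\<^sub>0\<close> would be at least \<open>x / 2\<close>, forcing
  \<open>x \<le> 32\<close>; similarly from below. Then \<open>8 * x \<le> 8 * 68 * S\<close>, which
  is rounded up to \<open>576 * S\<close>, that is \<open>24 * 24 * S\<close>.\<close>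

lemma close_to_ideal_height:
  fixes x h\<^sub>0 S :: real
  assumes "0 < x" "(x - h\<^sub>0)\<^sup>2 \<le> 8 * x" "S \<le> h\<^sub>0" "h\<^sub>0 \<le> 2 * S" "1 \<le> S"
  shows "x \<le> 68 * S" "S \<le> 32 * x" "\<bar>x - h\<^sub>0\<bar> \<le> 24 * sqrt S"
proof -
  have "x \<le> 34 * h\<^sub>0"
  proof (rule ccontr)
    assume *: "\<not> x \<le> 34 * h\<^sub>0"
    then have "(x / 2)\<^sup>2 \<le> (x - h\<^sub>0)\<^sup>2" using assms by (intro power_mono) auto
    then have "x * x \<le> 32 * x" using assms(2) by (simp add: power2_eq_square)
    then have "x \<le> 32" using assms(1) by simp
    with * assms show False by linarith
  qed
  then show x: "x \<le> 68 * S" using assms by linarith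
  have "h\<^sub>0 \<le> 32 * x"
  proof (rule ccontr)
    assume *: "\<not> h\<^sub>0 \<le> 32 * x"
    then have "(h\<^sub>0 / 2)\<^sup>2 \<le> (h\<^sub>0 - x)\<^sup>2" using assms by (intro power_mono) auto
    then have "h\<^sub>0 * h\<^sub>0 \<le> 32 * x" using assms(2) by (simp add: power2_eq_square algebra_simps)
    moreover have "h\<^sub>0 * 1 \<le> h\<^sub>0 * h\<^sub>0" using assms by (intro mult_left_mono) auto
    ultimately show False using * by linarith
  qed
  then show "S \<le> 32 * x" using assms by linarith
  have "(x - h\<^sub>0)\<^sup>2 \<le> 576 * S" using assms(2,5) x by linarith
  also have "\<dots> = (24 * sqrt S)\<^sup>2" using assms(5) by (simp add: power_mult_distrib)
  finally have "\<bar>x - h\<^sub>0\<bar> \<le> \<bar>24 * sqrt S\<bar>" by (simp only: abs_le_square_iff)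
  then show "\<bar>x - h\<^sub>0\<bar> \<le> 24 * sqrt S" using assms(5) by simp
qed

text \<open>All side lengths are of order \<open>S\<close>, and each error region is a strip whose
  thickness is at most 1 or bounded in terms of \<open>K\<close> and \<open>\<delta>\<close>. The
  factor \<open>1 + \<delta>\<close> absorbs the terms with and without
  \<open>\<delta>\<close>.\<close>

lemma model_distance_bound:
  fixes h l r ra ca rb cb p q N :: nat and K \<delta> S :: real
  assumes N: "N = h * l + r" "r < h" and S: "S * S = real N" "1 \<le> S" and K: "0 \<le> K" and \<delta>: "0 \<le> \<delta>"
    and rows: "real h \<le> 68 * S" "real ra \<le> 68 * S" "real rb \<le> 68 * S"
      "S \<le> 32 * real h" "S \<le> 32 * real ra" "S \<le> 32 * real rb"
    and cols: "real ca - real N / real ra \<le> 4 + K" "real cb - real N / real rb \<le> 4 + K"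
    and pq: "p \<le> rb" "real rb - real p \<le> K" "real q \<le> K"
    and diff: "\<bar>real ra - real h\<bar> \<le> \<delta>" "\<bar>real rb - real h\<bar> \<le> \<delta>"
  shows "real (2 * (h + (ca - (l + 1)) * ra + (ra - h) * ca) +
      2 * (h + q * rb + (cb - (l + 1)) * rb + (rb - p) * cb + (ra - h) * cb))
    \<le> (272 + 272 * (4 + K + 1024) + 4 * (36 + K) + 136 * K + 2 * K * (36 + K)) * ((1 + \<delta>) * S)"
proof -
  have pos: "0 < real h" "0 < real ra" "0 < real rb" using rows S by linarith+
  have ratio: "real N / x \<le> 32 * S" if "S \<le> 32 * x" "0 < x" for x
  proof -
    have "S * S \<le> 32 * x * S" using that S by (intro mult_right_mono) auto
    then show ?thesis using that S(1) by (simp add: field_simps)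
  qed
  have col_le: "real c \<le> (36 + K) * S" if "real c - real N / x \<le> 4 + K" "S \<le> 32 * x" "0 < x" for c x
  proof -
    have "(4 + K) * 1 \<le> (4 + K) * S" using K S by (intro mult_left_mono) auto
    then show ?thesis using that ratio[OF that(2,3)] by (simp add: algebra_simps)
  qed
  have ca: "real ca \<le> (36 + K) * S" and cb: "real cb \<le> (36 + K) * S"
    using col_le cols rows pos by blast+
  \<comment> \<open>A height error \<open>\<delta>\<close> changes the quotient of \<open>N\<close>
    by the height by at most \<open>1024 * \<delta>\<close>, as \<open>N / x \<le> 32 * S\<close>
    and \<open>S \<le> 32 * h\<close>.\<close>
  have excess: "real (c - (l + 1)) \<le> 4 + K + 1024 * \<delta>"
    if "real c - real N / x \<le> 4 + K" "S \<le> 32 * x" "0 < x" "\<bar>x - real h\<bar> \<le> \<delta>" for c x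
  proof -
    have "real N \<le> real h * (real l + 1)"
      using N by (simp add: algebra_simps)
    then have "real N / real h \<le> real l + 1" using pos by (simp add: field_simps)
    moreover have "real N / x - real N / real h \<le> 1024 * \<delta>"
    proof -
      have "real N / x - real N / real h = real N / x / real h * (real h - x)"
        using pos that by (simp add: field_simps)
      also have "\<dots> \<le> real N / x / real h * \<delta>" using pos that by (intro mult_left_mono) auto
      also have "\<dots> \<le> 1024 * \<delta>"
      proof (rule mult_right_mono[OF _ \<delta>])
        have "real N / x \<le> 32 * S" using ratio that by blast
        also have "\<dots> \<le> 1024 * real h" using rows by simp
        finally show "real N / x / real h \<le> 1024" using pos by (simp only: pos_divide_le_eq)
      qed
      finally show ?thesis .
    qed
    moreover have "0 \<le> 4 + K + 1024 * \<delta>" using K \<delta> by simp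
    ultimately show ?thesis using that(1) by (cases "l + 1 \<le> c") (auto simp: of_nat_diff)
  qed
  have ea: "real (ca - (l + 1)) \<le> 4 + K + 1024 * \<delta>" and eb: "real (cb - (l + 1)) \<le> 4 + K + 1024 * \<delta>"
    using excess cols rows pos diff by blast+
  have ra_h: "real (ra - h) \<le> \<delta>" using diff(1) \<delta> by (cases "h \<le> ra") (auto simp: of_nat_diff)
  have rb_p: "real (rb - p) \<le> K" using pq by (simp add: of_nat_diff)
  have prods: "real (ca - (l + 1)) * real ra \<le> (4 + K + 1024 * \<delta>) * (68 * S)"
    "real (ra - h) * real ca \<le> \<delta> * ((36 + K) * S)" "real q * real rb \<le> K * (68 * S)"
    "real (cb - (l + 1)) * real rb \<le> (4 + K + 1024 * \<delta>) * (68 * S)"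
    "real (rb - p) * real cb \<le> K * ((36 + K) * S)" "real (ra - h) * real cb \<le> \<delta> * ((36 + K) * S)"
    by (intro mult_mono; use ea eb ra_h rb_p ca cb rows pq K \<delta> S in simp)+
  have S\<delta>: "0 \<le> \<delta> * S" "0 \<le> K * S" "0 \<le> K * (\<delta> * S)" "0 \<le> K * (K * (\<delta> * S))" using K \<delta> S by simp_all
  have "real (2 * (h + (ca - (l + 1)) * ra + (ra - h) * ca) +
      2 * (h + q * rb + (cb - (l + 1)) * rb + (rb - p) * cb + (ra - h) * cb))
    = 4 * real h + 2 * (real (ca - (l + 1)) * real ra) + 2 * (real (ra - h) * real ca) + 2 * (real q * real rb)
      + 2 * (real (cb - (l + 1)) * real rb) + 2 * (real (rb - p) * real cb) + 2 * (real (ra - h) * real cb)"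
    unfolding of_nat_add of_nat_mult of_nat_numeral by (simp only: distrib_left)
  also have "\<dots> \<le> 4 * (68 * S) + 2 * ((4 + K + 1024 * \<delta>) * (68 * S)) + 2 * (\<delta> * ((36 + K) * S)) + 2 * (K * (68 * S))
      + 2 * ((4 + K + 1024 * \<delta>) * (68 * S)) + 2 * (K * ((36 + K) * S)) + 2 * (\<delta> * ((36 + K) * S))"
    using prods rows(1) by linarith
  also have "\<dots> \<le> (272 + 272 * (4 + K + 1024) + 4 * (36 + K) + 136 * K + 2 * K * (36 + K)) * ((1 + \<delta>) * S)"
    using S\<delta> S K by (simp add: algebra_simps)
  finally show ?thesis .
qed

section \<open>Irrational \<beta>: comparing coefficients\<close>

lemma irrational_multiple:
  assumes "\<beta> \<notin> \<rat>" "real_of_int x = \<beta> * real_of_int y"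
  shows "y = 0"
proof (rule ccontr)
  assume "y \<noteq> 0"
  then have "\<beta> = real_of_int x / real_of_int y" using assms(2) by (simp add: field_simps)
  then show False using assms(1) by simp
qed

lemma irrational_optimal_height_unique:
  assumes "\<beta> \<notin> \<rat>" "optimal_height \<beta> N h" "optimal_height \<beta> N h'"
  shows "h = h'"
proof -
  have "height_energy \<beta> N h = height_energy \<beta> N h'"
    using assms(2,3) by (force simp: optimal_height_iff)
  then have "real_of_int (4 * \<lceil>real N / real h\<rceil> + 4 * int h - 4 * \<lceil>real N / real h'\<rceil> - 4 * int h')
      = \<beta> * real_of_int (2 * int h - 2 * int h')"
    by (simp add: height_energy_def algebra_simps)
  from irrational_multiple[OF assms(1) this] show ?thesis by simp
qed

text \<open>Both values have the form integer plus \<open>\<beta>\<close> times integer, so their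
  coefficients of \<open>\<beta>\<close> agree.\<close>

lemma irrational_shared_lines:
  assumes "\<beta> \<notin> \<rat>" "bubble_cost \<beta> ra ca rb cb p q = height_energy \<beta> N h"
  shows "p + q = h"
proof -
  have "real_of_int (2 * int (ra + ca + rb + cb) - 4 * \<lceil>real N / real h\<rceil> - 4 * int h)
      = \<beta> * real_of_int (2 * int (p + q) - 2 * int h)"
    using assms(2) by (simp add: bubble_cost_def height_energy_def algebra_simps)
  from irrational_multiple[OF assms(1) this] show ?thesis by simp
qed

text \<open>\<open>K\<close> is the stability constant of \<open>cost_stability\<close>; the last
  factor absorbs \<open>1 + \<delta>\<close> for rational and irrational \<open>\<beta>\<close>
  alike.\<close>

definition fluctuation_const :: "real \<Rightarrow> real" where
  "fluctuation_const \<beta> = (let K = 48 / \<beta> in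
     (272 + 272 * (4 + K + 1024) + 4 * (36 + K) + 136 * K + 2 * K * (36 + K)) * (49 * (1 + K)))"

lemma sqrt_sqrt_powr: "1 \<le> N \<Longrightarrow> sqrt (sqrt (real N)) = real N powr (1 / 4)"
  by (simp add: powr_powr flip: powr_half_sqrt)

lemma fluctuation_rows:
  assumes \<beta>: "0 < \<beta>" "\<beta> \<le> 1 / 2" and N: "1 \<le> N" and h: "optimal_height \<beta> N h"
    and split: "N = h * l + r" "r < h"
    and pair: "bubble_pair A B" and conn: "lattice_connected (A \<union> B)"
    and fin: "finite A" "finite B" and card: "card A = N" "card B = N"
    and cost: "cost_of \<beta> A B = height_energy \<beta> N h"
    and shared: "shared_cols A B \<le> shared_rows A B"
  shows "\<exists>T. lattice_isometry T \<and>
    real (card (sym_diff A (T ` model_A h l r)) + card (sym_diff B (T ` model_B h l r)))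
      \<le> fluctuation_const \<beta> * real N powr (if \<beta> \<in> \<rat> then 3 / 4 else 1 / 2)"
proof -
  define ra ca rb cb p q where params: "ra = row_count A" "ca = col_count A" "rb = row_count B"
    "cb = col_count B" "p = shared_rows A B" "q = shared_cols A B"
  define K where "K = 48 / \<beta>"
  define C where "C = 272 + 272 * (4 + K + 1024) + 4 * (36 + K) + 136 * K + 2 * K * (36 + K)"
  define S where "S = sqrt (real N)"
  define h\<^sub>0 where "h\<^sub>0 = sqrt (2 * real N / (2 - \<beta>))"
  have \<beta>1: "\<beta> < 1" using \<beta> by simp
  have K: "0 \<le> K" using \<beta> by (simp add: K_def)
  have C: "0 \<le> C" using K by (simp add: C_def)
  note ideal = ideal_height[OF \<beta>(1) \<beta>1 N h\<^sub>0_def, folded S_def]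
  note opt = optimal_height_energy_bounds[OF \<beta>(1) \<beta>1 N h h\<^sub>0_def]
  have S: "S * S = real N" "1 \<le> S" using ideal(4) by (simp_all add: S_def)
  have real: "realizable N N ra ca rb cb p q"
    using realizable_of_sets[OF fin] bubble_pairD(1)[OF pair] card unfolding params by simp
  have cost': "bubble_cost \<beta> ra ca rb cb p q = height_energy \<beta> N h"
    using cost unfolding cost_of_def params .
  have area: "real N \<le> real ra * real ca" "real N \<le> real rb * real cb"
    "2 * real N + real p * real q \<le> real ra * real ca + real rb * real cb"
  proof -
    have "N \<le> ra * ca" "N \<le> rb * cb" "N + N + p * q \<le> ra * ca + rb * cb"
      using real by (simp_all add: realizable_def)
    from this[THEN of_nat_mono[where 'a = real]]
    show "real N \<le> real ra * real ca" "real N \<le> real rb * real cb"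
      "2 * real N + real p * real q \<le> real ra * real ca + real rb * real cb" by simp_all
  qed
  have pos: "0 < real ra" "0 < real rb" "0 < real h"
    using real N h by (auto simp: realizable_def optimal_height_iff intro: Nat.gr0I)
  have pq: "real p \<le> real ra" "real p \<le> real rb" "0 \<le> real q" "real q \<le> real p"
    using real shared by (simp_all add: realizable_def params)
  have "2 * (real ra + real ca + real rb + real cb) - 2 * \<beta> * (real p + real q) \<le> 4 * (2 - \<beta>) * h\<^sub>0 + 8"
    using cost' opt(1) by (simp add: bubble_cost_def)
  note stab = cost_stability[OF \<beta> pos(1,2) ideal(1) area pq this, folded K_def]
  note near_h = close_to_ideal_height[OF pos(3) opt(2) ideal(2,3,4)]
  note near_a = close_to_ideal_height[OF pos(1) stab(4) ideal(2,3,4)]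
  note near_b = close_to_ideal_height[OF pos(2) stab(5) ideal(2,3,4)]
  \<comment> \<open>For rational \<open>\<beta>\<close> the heights are compared through
    \<open>h\<^sub>0\<close>, with error \<open>24 * sqrt S\<close> on each side. For irrational
    \<open>\<beta>\<close> one has \<open>ra - h = (ra - p) - q\<close>, a difference of two numbers
    between 0 and \<open>K\<close>.\<close>
  define \<delta> where "\<delta> = (if \<beta> \<in> \<rat> then 48 * sqrt S else K)"
  have \<delta>: "0 \<le> \<delta>" using K S by (simp add: \<delta>_def)
  have diff: "\<bar>real ra - real h\<bar> \<le> \<delta>" "\<bar>real rb - real h\<bar> \<le> \<delta>"
  proof -
    have "\<bar>real ra - real h\<bar> \<le> K \<and> \<bar>real rb - real h\<bar> \<le> K" if "\<beta> \<notin> \<rat>"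
    proof -
      have "real h = real p + real q" using irrational_shared_lines[OF that cost'] by simp
      then show ?thesis using stab(1-3) pq by (simp add: abs_le_iff)
    qed
    moreover have "\<bar>real ra - real h\<bar> \<le> 48 * sqrt S \<and> \<bar>real rb - real h\<bar> \<le> 48 * sqrt S"
      using near_h(3) near_a(3) near_b(3) by linarith
    ultimately show "\<bar>real ra - real h\<bar> \<le> \<delta>" "\<bar>real rb - real h\<bar> \<le> \<delta>" by (auto simp: \<delta>_def)
  qed
  have scale: "C * ((1 + \<delta>) * S) \<le> fluctuation_const \<beta> * real N powr (if \<beta> \<in> \<rat> then 3 / 4 else 1 / 2)"
  proof -
    define E where "E = real N powr (if \<beta> \<in> \<rat> then 3 / 4 else 1 / 2)"
    have "(1 + \<delta>) * S \<le> 49 * (1 + K) * E"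
    proof (cases "\<beta> \<in> \<rat>")
      case True
      have "sqrt S * S = real N powr (1 / 4) * real N powr (1 / 2)"
        using sqrt_sqrt_powr[OF N] by (simp add: S_def powr_half_sqrt)
      also have "\<dots> = E" using N True by (simp add: E_def flip: powr_add)
      finally have E: "sqrt S * S = E" .
      have "1 * S \<le> sqrt S * S" using S by (intro mult_right_mono) auto
      then have "(1 + \<delta>) * S \<le> 49 * E" using True E by (simp add: \<delta>_def algebra_simps)
      also have "\<dots> \<le> 49 * E + 49 * (K * E)" using K by (simp add: E_def)
      finally show ?thesis by (simp add: algebra_simps)
    next
      case False
      then have "E = S" by (simp add: E_def S_def powr_half_sqrt)
      then show ?thesis using False K S by (simp add: \<delta>_def algebra_simps)
    qed
    then have "C * ((1 + \<delta>) * S) \<le> C * (49 * (1 + K) * E)" using C by (rule mult_left_mono)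
    also have "\<dots> = fluctuation_const \<beta> * E" by (simp add: fluctuation_const_def Let_def C_def K_def)
    finally show ?thesis by (simp add: E_def)
  qed
  have ne: "A \<noteq> {}" "B \<noteq> {}" using card N by auto
  show ?thesis
  proof (cases "Min (fst ` A) \<le> Min (fst ` B)")
    case True
    obtain T where T: "lattice_isometry T"
      "card (sym_diff A (T ` model_A h l r)) + card (sym_diff B (T ` model_B h l r)) \<le>
        2 * (h + (ca - (l + 1)) * ra + (ra - h) * ca) +
        2 * (h + q * rb + (cb - (l + 1)) * rb + (rb - p) * cb + (ra - h) * cb)" (is "?d \<le> ?n")
      using model_distance[OF pair conn fin ne _ _ split(2) True, of l] card split(1) unfolding params by auto
    have "real ?d \<le> real ?n" using T(2) by (rule of_nat_mono)
    also have "\<dots> \<le> C * ((1 + \<delta>) * S)"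
      unfolding C_def
      by (rule model_distance_bound[OF split S K \<delta> near_h(1) near_a(1) near_b(1) near_h(2) near_a(2) near_b(2)
            stab(6,7) _ stab(3,1) diff]) (use pq in simp)
    also note scale
    finally show ?thesis using T(1) by blast
  next
    case False
    then have "Min (fst ` B) \<le> Min (fst ` A)" by simp
    then obtain T where T: "lattice_isometry T"
      "card (sym_diff B (T ` model_A h l r)) + card (sym_diff A (T ` model_B h l r)) \<le>
        2 * (h + (cb - (l + 1)) * rb + (rb - h) * cb) +
        2 * (h + q * ra + (ca - (l + 1)) * ra + (ra - p) * ca + (rb - h) * ca)" (is "?d \<le> ?n")
      using model_distance[OF bubble_pair_commute[OF pair] _ fin(2,1) ne(2,1) _ _ split(2), of l] conn card split(1)
      unfolding params by (auto simp: Un_commute Int_commute)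
    have "real ?d \<le> real ?n" using T(2) by (rule of_nat_mono)
    also have "\<dots> \<le> C * ((1 + \<delta>) * S)"
      unfolding C_def
      by (rule model_distance_bound[OF split S K \<delta> near_h(1) near_b(1) near_a(1) near_h(2) near_b(2) near_a(2)
            stab(7,6) _ stab(2,1) diff(2,1)]) (use pq in simp)
    also note scale
    finally have bound: "real ?d \<le> fluctuation_const \<beta> * real N powr (if \<beta> \<in> \<rat> then 3 / 4 else 1 / 2)" .
    \<comment> \<open>Here \<open>B\<close> begins further left and takes the left half of the
      model; composing with the mirror image restores the labels.\<close>
    obtain R where R: "lattice_isometry R" "R ` model_A h l r = model_B h l r" "R ` model_B h l r = model_A h l r"
      using isometry_exchanging_models by blast
    have "lattice_isometry (T \<circ> R)" using T(1) R(1) by (rule composition)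
    moreover have "(T \<circ> R) ` model_A h l r = T ` model_B h l r" "(T \<circ> R) ` model_B h l r = T ` model_A h l r"
      by (simp_all only: image_comp[symmetric] R)
    ultimately show ?thesis using bound by (intro exI[of _ "T \<circ> R"]) (simp only: add.commute)
  qed
qed

text \<open>Transposition exchanges shared rows with shared columns and keeps the cost, and
  \<open>prod.swap\<close> is itself a lattice isometry.\<close>

lemma fluctuation:
  assumes "0 < \<beta>" "\<beta> \<le> 1 / 2" "1 \<le> N" "optimal_height \<beta> N h" "N = h * l + r" "r < h"
    and pair: "bubble_pair A B" and conn: "lattice_connected (A \<union> B)"
    and fin: "finite A" "finite B" and card: "card A = N" "card B = N"
    and cost: "cost_of \<beta> A B = height_energy \<beta> N h"
  shows "\<exists>T. lattice_isometry T \<and>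
    real (card (sym_diff A (T ` model_A h l r)) + card (sym_diff B (T ` model_B h l r)))
      \<le> fluctuation_const \<beta> * real N powr (if \<beta> \<in> \<rat> then 3 / 4 else 1 / 2)"
proof (cases "shared_cols A B \<le> shared_rows A B")
  case True
  then show ?thesis using fluctuation_rows assms by blast
next
  case False
  let ?A = "prod.swap ` A" and ?B = "prod.swap ` B"
  have "lattice_connected (?A \<union> ?B)"
    unfolding image_Un[symmetric] using conn by (rule lattice_connected_image) (simp add: unit_dist_swap)
  moreover have "cost_of \<beta> ?A ?B = height_energy \<beta> N h"
    using cost unfolding cost_of_def snd_swap_image fst_swap_image by (metis bubble_cost_transpose)
  moreover have "shared_cols ?A ?B \<le> shared_rows ?A ?B"
    using False unfolding snd_swap_image fst_swap_image by simp
  moreover have "card ?A = N" "card ?B = N" using card by (simp_all add: card_image)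
  ultimately obtain T where T: "lattice_isometry T"
    "real (card (sym_diff ?A (T ` model_A h l r)) + card (sym_diff ?B (T ` model_B h l r)))
      \<le> fluctuation_const \<beta> * real N powr (if \<beta> \<in> \<rat> then 3 / 4 else 1 / 2)"
    using fluctuation_rows[OF assms(1-6) bubble_pair_swap[OF pair], of] fin by blast
  have swap: "card (sym_diff X ((prod.swap \<circ> T) ` Y)) = card (sym_diff (prod.swap ` X) (T ` Y))" for X Y
  proof -
    have "sym_diff X ((prod.swap \<circ> T) ` Y) = prod.swap ` sym_diff (prod.swap ` X) (T ` Y)"
      by (simp add: image_Un image_set_diff image_image)
    then show ?thesis by (simp add: card_image)
  qed
  show ?thesis
    using T(2) composition[OF lattice_isometry_swap T(1)] by (intro exI[of _ "prod.swap \<circ> T"]) (simp only: swap simp_thms)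
qed

lemma minimizer_bubble_pair:
  assumes \<beta>: "0 < \<beta>" "\<beta> < 1" and "1 \<le> M" "1 \<le> N" and sol: "solves_double_bubble \<beta> M N A B"
  shows "bubble_pair A B" "lattice_connected (A \<union> B)"
proof -
  have A: "lattice_connected A" using minimizer_connected[OF \<beta> sol] .
  have B: "lattice_connected B" using minimizer_connected[OF \<beta> solves_double_bubble_commute[OF sol]] .
  show "bubble_pair A B"
    using minimizer_cost(1,3-5)[OF \<beta> sol] A B by (simp add: bubble_pair_def admissible_def)
  obtain a b where "a \<in> A" "b \<in> B" "unit_dist a b" using minimizer_contact[OF \<beta> sol assms(3,4)] .
  then show "lattice_connected (A \<union> B)" using lattice_connected_Un[OF A B] by blast
qed

theorem theorem1p1:
  fixes \<beta> :: real
  assumes "0 < \<beta>" and "\<beta> < 1"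
  shows "\<exists>C\<^sub>1 C\<^sub>2 :: real. \<forall>N\<^sub>A N\<^sub>B :: nat. \<forall>A B :: (int \<times> int) set.
    1 \<le> N\<^sub>A \<and> 1 \<le> N\<^sub>B \<and> solves_double_bubble \<beta> N\<^sub>A N\<^sub>B A B \<longrightarrow>
      \<comment> \<open>connectedness\<close>
      (\<forall>S \<in> {A, B, A \<union> B}. lattice_connected S \<and>
        (\<forall>z. lattice_connected (S \<inter> Row z) \<and> lattice_connected (S \<inter> Col z))) \<and>
      \<comment> \<open>separation\<close>
      separation (row_slice A) (row_slice B) \<and>
      separation (col_slice A) (col_slice B) \<and>
      separation (col_slice B) (col_slice A) \<and>
      \<comment> \<open>interface\<close>
      (\<forall>x \<in> interface A B. interface A B \<noteq> {x} \<longrightarrow>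
        (\<exists>y \<in> interface A B - {x}. norm (x - y) \<in> {1 / sqrt 2, 1})) \<and>
      (\<exists>\<iota>. piecewise_affine_path \<iota> \<and>
        monotone_on_unit (\<lambda>t. fst (\<iota> t)) \<and> monotone_on_unit (\<lambda>t. snd (\<iota> t)) \<and>
        interface A B \<subseteq> path_image \<iota>) \<and>
      (\<forall>N. N\<^sub>A = N \<and> N\<^sub>B = N \<and> \<beta> \<le> 1 / 2 \<longrightarrow>
        \<comment> \<open>minimal perimeter\<close>
        (\<exists>h. optimal_height \<beta> N h \<and> perimeter \<beta> A B = height_energy \<beta> N h) \<and>
        (\<forall>h. optimal_height \<beta> N h \<longrightarrow>
          \<bar>real h - sqrt (2 * real N / (2 - \<beta>))\<bar> \<le> C\<^sub>1 * real N powr (1 / 4)) \<and>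
        (\<beta> \<notin> \<rat> \<longrightarrow> (\<exists>!h. optimal_height \<beta> N h)) \<and>
        (\<forall>h l r. optimal_height \<beta> N h \<and> r < h \<and> N = h * l + r \<longrightarrow>
          \<comment> \<open>explicit solution\<close>
          solves_double_bubble \<beta> N N (model_A h l r) (model_B h l r) \<and>
          \<comment> \<open>fluctuations\<close>
          (\<exists>T. lattice_isometry T \<and>
            real (card (sym_diff A (T ` model_A h l r)) + card (sym_diff B (T ` model_B h l r)))
              \<le> C\<^sub>2 * real N powr (if \<beta> \<in> \<rat> then 3 / 4 else 1 / 2))))"
proof (rule exI[of _ 24], rule exI[of _ "fluctuation_const \<beta>"], intro allI impI, goal_cases)
  case (1 M N A B)
  then have MN: "1 \<le> M" "1 \<le> N" and sol: "solves_double_bubble \<beta> M N A B" by auto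
  note min = minimizer_cost[OF assms sol]
  have fin: "finite A" "finite B" and card: "card A = M" "card B = N"
    using min(1) by (simp_all add: admissible_def)
  note pair = minimizer_bubble_pair(1)[OF assms MN sol] and conn = minimizer_bubble_pair(2)[OF assms MN sol]
  have connected: "\<forall>S \<in> {A, B, A \<union> B}. lattice_connected S \<and>
        (\<forall>z. lattice_connected (S \<inter> Row z) \<and> lattice_connected (S \<inter> Col z))"
  proof
    fix S assume S: "S \<in> {A, B, A \<union> B}"
    then have "hv_convex S" "lattice_connected S" using pair conn by (auto simp: bubble_pair_def)
    then show "lattice_connected S \<and> (\<forall>z. lattice_connected (S \<inter> Row z) \<and> lattice_connected (S \<inter> Col z))"
      by (simp add: hv_convex_def lattice_connected_row lattice_connected_col)
  qed
  obtain \<sigma> where \<sigma>: "\<sigma> \<in> {1, - 1 :: real}"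
    "\<forall>p\<in>interface A B. \<forall>q\<in>interface A B. fst p < fst q \<longrightarrow> \<sigma> * snd p \<le> \<sigma> * snd q"
    using interface_chain[OF pair] by blast
  have path: "\<exists>\<iota>. piecewise_affine_path \<iota> \<and> monotone_on_unit (\<lambda>t. fst (\<iota> t)) \<and>
      monotone_on_unit (\<lambda>t. snd (\<iota> t)) \<and> interface A B \<subseteq> path_image \<iota>"
    by (rule chain_in_monotone_path[OF finite_interface[OF fin] \<sigma>(1)]) (use \<sigma>(2) in blast)
  have equal: "\<forall>L. M = L \<and> N = L \<and> \<beta> \<le> 1 / 2 \<longrightarrow>
        (\<exists>h. optimal_height \<beta> L h \<and> perimeter \<beta> A B = height_energy \<beta> L h) \<and>
        (\<forall>h. optimal_height \<beta> L h \<longrightarrow>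
          \<bar>real h - sqrt (2 * real L / (2 - \<beta>))\<bar> \<le> 24 * real L powr (1 / 4)) \<and>
        (\<beta> \<notin> \<rat> \<longrightarrow> (\<exists>!h. optimal_height \<beta> L h)) \<and>
        (\<forall>h l r. optimal_height \<beta> L h \<and> r < h \<and> L = h * l + r \<longrightarrow>
          solves_double_bubble \<beta> L L (model_A h l r) (model_B h l r) \<and>
          (\<exists>T. lattice_isometry T \<and>
            real (card (sym_diff A (T ` model_A h l r)) + card (sym_diff B (T ` model_B h l r)))
              \<le> fluctuation_const \<beta> * real L powr (if \<beta> \<in> \<rat> then 3 / 4 else 1 / 2)))"
  proof (rule allI, rule impI, intro conjI allI impI)
    fix L assume "M = L \<and> N = L \<and> \<beta> \<le> 1 / 2"
    then have L: "M = L" "N = L" and half: "\<beta> \<le> 1 / 2" by auto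
    have L1: "1 \<le> L" and solL: "solves_double_bubble \<beta> L L A B" using MN sol L by auto
    note eq = equal_case[OF assms(1) half L1]
    obtain h\<^sub>1 where h\<^sub>1: "optimal_height \<beta> L h\<^sub>1" using optimal_height_exists[OF assms(2) L1] by blast
    then show "\<exists>h. optimal_height \<beta> L h \<and> perimeter \<beta> A B = height_energy \<beta> L h"
      using eq(2)[OF _ solL] by blast
    show "\<exists>!h. optimal_height \<beta> L h" if "\<beta> \<notin> \<rat>"
      using h\<^sub>1 irrational_optimal_height_unique[OF that] by blast
    show "\<bar>real h - sqrt (2 * real L / (2 - \<beta>))\<bar> \<le> 24 * real L powr (1 / 4)" if h: "optimal_height \<beta> L h" for h
    proof -
      \<comment> \<open>The constant 24 is that of \<open>close_to_ideal_height\<close>, applied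
        with the square root of \<open>N\<close> as \<open>S\<close>.\<close>
      note ideal = ideal_height[OF assms L1 refl]
      have "0 < real h" using h by (simp add: optimal_height_iff)
      from close_to_ideal_height(3)[OF this optimal_height_energy_bounds(2)[OF assms L1 h refl] ideal(2-4)]
      show ?thesis using sqrt_sqrt_powr[OF L1] by simp
    qed
    fix h l r assume "optimal_height \<beta> L h \<and> r < h \<and> L = h * l + r"
    then have hlr: "optimal_height \<beta> L h" "r < h" "L = h * l + r" by auto
    then show "solves_double_bubble \<beta> L L (model_A h l r) (model_B h l r)" using eq(3) by blast
    have "cost_of \<beta> A B = height_energy \<beta> L h" using min(2) eq(2)[OF hlr(1) solL] by (rule trans[OF sym])
    moreover have "card A = L" "card B = L" using card L by simp_all
    ultimately show "\<exists>T. lattice_isometry T \<and>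
        real (card (sym_diff A (T ` model_A h l r)) + card (sym_diff B (T ` model_B h l r)))
          \<le> fluctuation_const \<beta> * real L powr (if \<beta> \<in> \<rat> then 3 / 4 else 1 / 2)"
      using fluctuation[OF assms(1) half L1 hlr(1,3,2) pair conn fin] by blast
  qed
  have neighbours: "\<forall>x \<in> interface A B. interface A B \<noteq> {x} \<longrightarrow>
        (\<exists>y \<in> interface A B - {x}. norm (x - y) \<in> {1 / sqrt 2, 1})"
    using interface_neighbour[OF pair] by blast
  show ?case
    by (intro conjI connected row_separation[OF pair fin] col_separation[OF pair fin]
          col_separation[OF bubble_pair_commute[OF pair] fin(2,1)] neighbours path equal)
qed

end
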